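(* Let $\mathcal P$ be a reference probability measure over $\{0,1\}^{\mathcal X}$ and $\mathcal D$ be a distribution over inputs (i.e. over $\mathcal X\times\{0,1\}$). Consider the source of randomness $\mathcal R$ to be a Poisson point process with intensity $\mathcal P\times\mathrm{Leb}\times\mathrm{Leb}$, where $\mathrm{Leb}$ is the Lebesgue measure over $\mathbb R_+$. Consider a weak learning rule $A$ that is (i) $\rho$-TV indistinguishable with respect to $\mathcal D$ for some $\rho\in(0,1)$; (ii) $(\alpha,\beta)$-accurate for $\mathcal D$ for some $(\alpha,\beta)\in(0,1)^2$ such that $\beta<\frac{2\rho}{\rho+1}-2\sqrt{\frac{2\rho}{\rho+1}}+1$; and (iii) absolutely continuous with respect to $\mathcal P$ on inputs from $\mathcal D$. Then, for any $(\rho',\varepsilon,\beta')\in(0,1)^3$, there exists a learner $\mathrm{Ampl}(A,\mathcal R,\beta',\varepsilon,\rho')$ that is $\rho'$-TV indistinguishable with respect to $\mathcal D$ and $(\alpha+\varepsilon,\beta')$-accurate for $\mathcal D$.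
   Context: An $n$-sample learning rule (learner) over a domain $\mathcal X$ is a randomized map $A:(\mathcal X\times\{0,1\})^n\to\{0,1\}^{\mathcal X}$; $A(S)$ is the distribution of its output on $S$. For a fixed $\mathcal D$: $A$ is $\rho$-TV indistinguishable with respect to $\mathcal D$ if $\mathbf E_{S,S'\sim\mathcal D^n}[d_{\mathrm{TV}}(A(S),A(S'))]\le\rho$ ($S,S'$ independent). $A$ is $(\alpha,\beta)$-accurate for $\mathcal D$ if $\Pr_{S\sim\mathcal D^n,\,h\sim A(S)}[\mathrm{err}_{\mathcal D}(h)>\alpha]\le\beta$, where $\mathrm{err}_{\mathcal D}(h)=\Pr_{(x,y)\sim\mathcal D}[h(x)\ne y]$. $A$ is absolutely continuous with respect to $\mathcal P$ on inputs from $\mathcal D$ if for almost every sample $S\sim\mathcal D^n$, $A(S)$ is absolutely continuous with respect to $\mathcal P$. The notation $\mathrm{Ampl}(A,\mathcal R,\beta',\varepsilon,\rho')$ expresses that the new learner is built from black-box access to $A$ (with its parameters), access to the process $\mathcal R$, the target parameters, and a finite number of i.i.d. samples from $\mathcal D$ (i.e. $\mathcal D$ is accessed only through samples; the learner may use a larger sample size than $A$). *)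

theory Defs
  imports "HOL-Probability.Probability"
begin

text \<open>
  The domain is the type \<open>'x\<close> with a sigma-algebra \<open>X\<close>; labels are \<open>bool\<close>. The sigma-algebra \<open>H\<close> lives
  on a set \<open>space H\<close> of hypotheses, which need not be all of \<open>'x \<Rightarrow> bool\<close>: when \<open>X\<close> is not discrete,
  joint measurability of evaluation forces every hypothesis to be measurable. For countable discrete
  \<open>X\<close>, the product sigma-algebra on all of \<open>'x \<Rightarrow> bool\<close> qualifies. Measurable evaluation makes
  the error of a hypothesis a random variable, and countable generation does the same for the
  total variation distance between \<open>A S\<close> and \<open>A S'\<close>.
\<close>

definition hypothesis_space :: "'x measure \<Rightarrow> ('x \<Rightarrow> bool) measure \<Rightarrow> bool" where
  "hypothesis_space X H \<longleftrightarrow>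
     space X = UNIV \<and>
     (\<lambda>(h, x). h x) \<in> H \<Otimes>\<^sub>M X \<rightarrow>\<^sub>M count_space UNIV \<and>
     (\<exists>E. countable E \<and> E \<subseteq> Pow (space H) \<and> sets H = sigma_sets (space H) E)"

abbreviation examples :: "'x measure \<Rightarrow> ('x \<times> bool) measure" where
  "examples X \<equiv> X \<Otimes>\<^sub>M count_space UNIV"

abbreviation iid :: "nat \<Rightarrow> 'a measure \<Rightarrow> (nat \<Rightarrow> 'a) measure" where
  "iid n M \<equiv> PiM {..<n} (\<lambda>_. M)"

definition learning_rule ::
  "'x measure \<Rightarrow> ('x \<Rightarrow> bool) measure \<Rightarrow> nat \<Rightarrow> ((nat \<Rightarrow> 'x \<times> bool) \<Rightarrow> ('x \<Rightarrow> bool) measure) \<Rightarrow> bool"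
where
  "learning_rule X H n A \<longleftrightarrow> A \<in> iid n (examples X) \<rightarrow>\<^sub>M prob_algebra H"

definition tv_dist :: "'a measure \<Rightarrow> 'a measure \<Rightarrow> real" where
  "tv_dist M N = (SUP B\<in>sets M. \<bar>measure M B - measure N B\<bar>)"

definition tv_indistinguishable ::
  "('x \<times> bool) measure \<Rightarrow> nat \<Rightarrow> ((nat \<Rightarrow> 'x \<times> bool) \<Rightarrow> ('x \<Rightarrow> bool) measure) \<Rightarrow> real \<Rightarrow> bool"
where
  "tv_indistinguishable D n A \<rho> \<longleftrightarrow>
     (\<integral>\<^sup>+ (S, S'). ennreal (tv_dist (A S) (A S')) \<partial>(iid n D \<Otimes>\<^sub>M iid n D)) \<le> ennreal \<rho>"

definition err :: "('x \<times> bool) measure \<Rightarrow> ('x \<Rightarrow> bool) \<Rightarrow> real" where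
  "err D h = measure D {(x, y) \<in> space D. h x \<noteq> y}"

definition accurate ::
  "('x \<Rightarrow> bool) measure \<Rightarrow> ('x \<times> bool) measure \<Rightarrow> nat \<Rightarrow>
   ((nat \<Rightarrow> 'x \<times> bool) \<Rightarrow> ('x \<Rightarrow> bool) measure) \<Rightarrow> real \<Rightarrow> real \<Rightarrow> bool"
where
  "accurate H D n A \<alpha> \<beta> \<longleftrightarrow>
     measure (iid n D \<bind> A) {h \<in> space H. err D h > \<alpha>} \<le> \<beta>"

definition abs_cont_on_inputs ::
  "('x \<Rightarrow> bool) measure \<Rightarrow> ('x \<times> bool) measure \<Rightarrow> nat \<Rightarrow>
   ((nat \<Rightarrow> 'x \<times> bool) \<Rightarrow> ('x \<Rightarrow> bool) measure) \<Rightarrow> bool"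
where
  "abs_cont_on_inputs P D n A \<longleftrightarrow> (AE S in iid n D. absolutely_continuous P (A S))"

text \<open>
  A Poisson point process of infinite total intensity almost surely has infinitely many points, so it
  is given as the law \<open>R\<close> of a random sequence enumerating its points (with multiplicity). The order
  of enumeration is arbitrary. Counts are in \<open>ennreal\<close>, so that infinite counts do not collapse to 0.
\<close>

definition num_points :: "(nat \<Rightarrow> 'a) \<Rightarrow> 'a set \<Rightarrow> ennreal" where
  "num_points r B = (\<Sum>i. indicator B (r i))"

definition poisson_point_process :: "'a measure \<Rightarrow> (nat \<Rightarrow> 'a) measure \<Rightarrow> bool" where
  "poisson_point_process \<mu> R \<longleftrightarrow>
     prob_space R \<and> sets R = sets (PiM UNIV (\<lambda>_. \<mu>)) \<and>
     (\<forall>B\<in>sets \<mu>. emeasure \<mu> B < \<infinity> \<longrightarrow>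
        (\<forall>j::nat. measure R {r \<in> space R. num_points r B = of_nat j} =
                  exp (- measure \<mu> B) * measure \<mu> B ^ j / fact j)) \<and>
     (\<forall>F. finite F \<and> F \<subseteq> sets \<mu> \<and> disjoint F \<longrightarrow>
        prob_space.indep_vars R (\<lambda>_. borel) (\<lambda>B r. num_points r B) F)"

abbreviation leb_nonneg :: "real measure" where
  "leb_nonneg \<equiv> restrict_space lborel {0..}"

text \<open>
  A procedure with black-box access to a learner and to a source of randomness \<open>R\<close>. On a sample
  \<open>S\<close> of size \<open>m\<close>, it queries the \<open>n\<close>-sample learner \<open>A\<close> on \<open>N\<close> subsamples of \<open>S\<close> (selected by the
  index map \<open>q\<close>), takes \<open>k\<close> independent draws of \<open>R\<close>, and computes its output with \<open>G\<close>. The map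
  \<open>G\<close> sees \<open>A\<close> only through the answers to these queries, and the unknown distribution
  only through \<open>S\<close>.
\<close>

definition blackbox_procedure ::
  "'x measure \<Rightarrow> ('x \<Rightarrow> bool) measure \<Rightarrow> 'r measure \<Rightarrow> nat \<Rightarrow> nat \<Rightarrow> nat \<Rightarrow> (nat \<Rightarrow> nat \<Rightarrow> nat) \<Rightarrow> nat \<Rightarrow>
   ((nat \<Rightarrow> ('x \<Rightarrow> bool) measure) \<times> (nat \<Rightarrow> 'x \<times> bool) \<times> (nat \<Rightarrow> 'r) \<Rightarrow> ('x \<Rightarrow> bool)) \<Rightarrow> bool"
where
  "blackbox_procedure X H R n m N q k G \<longleftrightarrow>
     (\<forall>i<N. \<forall>j<n. q i j < m) \<and>
     G \<in> iid N (prob_algebra H) \<Otimes>\<^sub>M iid m (examples X) \<Otimes>\<^sub>M iid k R \<rightarrow>\<^sub>M H"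

definition run_procedure ::
  "('x \<Rightarrow> bool) measure \<Rightarrow> 'r measure \<Rightarrow> nat \<Rightarrow> nat \<Rightarrow> (nat \<Rightarrow> nat \<Rightarrow> nat) \<Rightarrow> nat \<Rightarrow>
   ((nat \<Rightarrow> ('x \<Rightarrow> bool) measure) \<times> (nat \<Rightarrow> 'x \<times> bool) \<times> (nat \<Rightarrow> 'r) \<Rightarrow> ('x \<Rightarrow> bool)) \<Rightarrow>
   ((nat \<Rightarrow> 'x \<times> bool) \<Rightarrow> ('x \<Rightarrow> bool) measure) \<Rightarrow> (nat \<Rightarrow> 'x \<times> bool) \<Rightarrow> ('x \<Rightarrow> bool) measure"
where
  "run_procedure H R n N q k G A S =
     distr (iid k R) H (\<lambda>r. G (\<lambda>i\<in>{..<N}. A (\<lambda>j\<in>{..<n}. S (q i j)), S, r))"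

end

theory Submission
  imports Defs
begin

text \<open>
  Query \<open>A\<close> on pairs of disjoint subsamples and let \<open>f\<^sub>1, f\<^sub>2\<close> be the densities of the two answers
  with respect to \<open>P\<close>. The overlap \<open>min f\<^sub>1 f\<^sub>2\<close> has expected total mass at least \<open>1 - \<rho>\<close> by TV
  indistinguishability, and at most \<open>\<beta>\<close> of it lies on hypotheses of error above \<open>\<alpha>\<close>; the condition
  on \<open>\<beta>\<close> gives \<open>\<beta> < 1 - \<rho>\<close>, so a fixed amount of mass is accurate. Discard the hypotheses whose
  empirical error on fresh examples exceeds \<open>\<alpha> + \<epsilon> / 2\<close> and average over \<open>K\<close> independent blocks.
  As \<open>(min f\<^sub>1 f\<^sub>2)\<^sup>2 \<le> f\<^sub>1 f\<^sub>2\<close>, the second moment at \<open>h\<close> is at most the square of the mean density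
  at \<open>h\<close>, whose integral is \<open>1\<close>: the average is within \<open>O(1 / sqrt K)\<close> of its expectation in
  \<open>L\<^sup>1(P)\<close>, uniformly in \<open>A\<close> and in the distribution of the examples. Hence the normalized average
  hardly depends on the sample, and it is nearly supported on hypotheses of error at most
  \<open>\<alpha> + \<epsilon>\<close>. It remains to sample from it. The part of the Poisson process below the graph of a
  probability density within unit time has mean size \<open>1\<close>; when it consists of exactly one point,
  the hypothesis of that point is distributed according to the density. Independent draws of the
  process are tried until this happens.
\<close>

text \<open>The procedure is fixed before \<open>A\<close> and \<open>D\<close>, so every rate must
  depend on the parameters alone. This rules out averaging the densities of single answers: they may
  be arbitrarily concentrated, and then the average approaches its mean in L1 at no uniform rate.
  The minimum of two independent densities cures this, and indistinguishability is what keeps that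
  minimum from vanishing. The limit of the averages depends on \<open>A\<close> and
  \<open>D\<close>, but the procedure never has to know it. A second obstacle is measurability: the
  density must be a measurable function of the answer, defined also for answers that are not
  absolutely continuous, and an arbitrary choice of Radon-Nikodym derivatives does not guarantee
  this. Hence approximate densities with error \<eta>, which the slack in the condition on \<beta>
  absorbs. Demanding exactly one point of the Poisson process, rather than taking the earliest one,
  reduces the sampler to independent counts in two disjoint sets; the price is a chance of
  rejection, which repetition makes small.\<close>

section \<open>Measurable approximate densities\<close>

text \<open>Syntax instead of a set of functions: countability comes from the datatype, and
  \<open>from_nat\<close> enumerates the expressions independently of any measure.
  \<open>Join\<close> makes finite unions of sets expressible; rational coefficients keep the family
  countable.\<close>

datatype simple_expr =
    Gen nat | Constant rat | Add simple_expr simple_expr | Scale rat simple_expr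
  | Join simple_expr simple_expr

instance simple_expr :: countable
  by countable_datatype

primrec denote :: "(nat \<Rightarrow> 'a set) \<Rightarrow> simple_expr \<Rightarrow> 'a \<Rightarrow> real" where
  "denote E (Gen i) x = indicator (E i) x"
| "denote E (Constant q) x = of_rat q"
| "denote E (Add e f) x = denote E e x + denote E f x"
| "denote E (Scale q e) x = of_rat q * denote E e x"
| "denote E (Join e f) x = max (denote E e x) (denote E f x)"

lemma denote_measurable:
  assumes "\<And>i. E i \<in> sets M"
  shows "denote E e \<in> borel_measurable M"
proof -
  note [measurable] = assms
  show ?thesis by (induction e) simp_all
qed

lemma denote_bounded: "\<exists>c. \<forall>x. \<bar>denote E e x\<bar> \<le> c"
proof (induction e)
  case (Gen i)
  show ?case by (rule exI[of _ 1]) (auto simp: indicator_def)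
next
  case (Constant q)
  then show ?case by auto
next
  case (Add e f)
  then obtain c d where "\<forall>x. \<bar>denote E e x\<bar> \<le> c" "\<forall>x. \<bar>denote E f x\<bar> \<le> d" by auto
  then show ?case by (intro exI[of _ "c + d"]) (auto intro: order.trans[OF abs_triangle_ineq] add_mono)
next
  case (Scale q e)
  then obtain c where "\<forall>x. \<bar>denote E e x\<bar> \<le> c" by auto
  then show ?case by (intro exI[of _ "\<bar>of_rat q\<bar> * c"]) (auto simp: abs_mult intro: mult_left_mono)
next
  case (Join e f)
  then obtain c d where "\<forall>x. \<bar>denote E e x\<bar> \<le> c" "\<forall>x. \<bar>denote E f x\<bar> \<le> d" by auto
  then show ?case by (intro exI[of _ "max c d"]) (auto simp: max_def abs_le_iff split: if_splits; smt (verit))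
qed

lemma denote_integrable:
  assumes "finite_measure M" "\<And>i. E i \<in> sets M"
  shows "integrable M (denote E e)"
proof -
  obtain c where "\<forall>x. \<bar>denote E e x\<bar> \<le> c" using denote_bounded by blast
  then show ?thesis
    by (intro finite_measure.integrable_const_bound[OF assms(1), of _ c] denote_measurable assms) auto
qed

text \<open>The L1 closure \<open>app\<close> of the denotations is stable under sums, maxima, real
  multiples and dominated limits. Hence the sets with indicator in \<open>app\<close> include the
  generators and are closed under complement (\<open>1 - indicator\<close>) and countable union
  (limit of finite maxima), which gives all of \<open>sets M\<close>; integrable functions follow by
  induction. Maxima spare a detour through a generating algebra or pi-system.\<close>

lemma denote_dense:
  fixes f :: "'a \<Rightarrow> real"
  assumes fin: "finite_measure M" and gen: "sets M = sigma_sets (space M) (range E)"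
    and f: "integrable M f" and "\<eta> > 0"
  shows "\<exists>e. (\<integral>x. \<bar>f x - denote E e x\<bar> \<partial>M) < \<eta>"
proof -
  interpret finite_measure M by fact
  have E[measurable]: "E i \<in> sets M" for i unfolding gen by auto
  note int = denote_integrable[OF fin E]
  define app where "app f \<longleftrightarrow> integrable M f \<and> (\<forall>\<eta>>0. \<exists>e. (\<integral>x. \<bar>f x - denote E e x\<bar> \<partial>M) < \<eta>)"
    for f :: "'a \<Rightarrow> real"
  have app_half: "\<exists>e. (\<integral>x. \<bar>f x - denote E e x\<bar> \<partial>M) < \<eta> / 2" if "app f" "\<eta> > 0" for f \<eta>
    using that(1) half_gt_zero[OF that(2)] unfolding app_def by blast
  have app_cong: "app g" if "app f" "\<And>x. x \<in> space M \<Longrightarrow> f x = g x" for f g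
  proof -
    have "integrable M g = integrable M f" using that by (intro Bochner_Integration.integrable_cong) auto
    moreover have "(\<integral>x. \<bar>g x - denote E e x\<bar> \<partial>M) = (\<integral>x. \<bar>f x - denote E e x\<bar> \<partial>M)" for e
      using that by (intro Bochner_Integration.integral_cong) auto
    ultimately show ?thesis using that(1) by (auto simp: app_def)
  qed
  have app_sem: "app (denote E e)" for e
    unfolding app_def using int by (auto intro!: exI[of _ e])
  have app_lim: "app f" if f: "integrable M f"
    and ex: "\<And>\<eta>. \<eta> > 0 \<Longrightarrow> \<exists>g. app g \<and> (\<integral>x. \<bar>f x - g x\<bar> \<partial>M) < \<eta>" for f
    unfolding app_def
  proof (intro conjI allI impI f)
    fix \<eta> :: real assume "\<eta> > 0"
    then obtain g where g: "app g" "(\<integral>x. \<bar>f x - g x\<bar> \<partial>M) < \<eta> / 2" using ex[of "\<eta>/2"] by auto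
    then obtain e where e: "(\<integral>x. \<bar>g x - denote E e x\<bar> \<partial>M) < \<eta> / 2"
      using app_half \<open>\<eta> > 0\<close> by blast
    have gi: "integrable M g" using g by (simp add: app_def)
    have "(\<integral>x. \<bar>f x - denote E e x\<bar> \<partial>M) \<le> (\<integral>x. \<bar>f x - g x\<bar> + \<bar>g x - denote E e x\<bar> \<partial>M)"
      using f gi int by (intro integral_mono) auto
    also have "\<dots> = (\<integral>x. \<bar>f x - g x\<bar> \<partial>M) + (\<integral>x. \<bar>g x - denote E e x\<bar> \<partial>M)"
      using f gi int by (intro Bochner_Integration.integral_add) auto
    finally show "\<exists>e. (\<integral>x. \<bar>f x - denote E e x\<bar> \<partial>M) < \<eta>" using g e by (intro exI[of _ e]) auto
  qed
  \<comment> \<open>The factor 2 is the domination that \<open>integrable_induct\<close> supplies in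
    its limit case; it leads to the majorant \<open>3 * \<bar>f x\<bar>\<close>.\<close>
  have app_dom: "app f" if f: "integrable M f" and s: "\<And>i. app (s i)"
    and lim: "\<And>x. x \<in> space M \<Longrightarrow> (\<lambda>i. s i x) \<longlonglongrightarrow> f x"
    and dom: "\<And>i x. x \<in> space M \<Longrightarrow> \<bar>s i x\<bar> \<le> 2 * \<bar>f x\<bar>" for f s
  proof (rule app_lim[OF f])
    fix \<eta> :: real assume "\<eta> > 0"
    have si: "integrable M (s i)" for i using s by (simp add: app_def)
    have "(\<lambda>i. \<integral>x. \<bar>f x - s i x\<bar> \<partial>M) \<longlonglongrightarrow> (\<integral>x. 0 \<partial>M)"
    proof (rule integral_dominated_convergence[where w="\<lambda>x. 3 * \<bar>f x\<bar>"])
      show "AE x in M. (\<lambda>i. \<bar>f x - s i x\<bar>) \<longlonglongrightarrow> 0"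
      proof (intro AE_I2)
        fix x assume "x \<in> space M"
        from tendsto_diff[OF tendsto_const lim[OF this], of "f x"]
        show "(\<lambda>i. \<bar>f x - s i x\<bar>) \<longlonglongrightarrow> 0" by (simp add: tendsto_rabs_zero)
      qed
      show "AE x in M. norm \<bar>f x - s i x\<bar> \<le> 3 * \<bar>f x\<bar>" for i
      proof (intro AE_I2)
        fix x assume "x \<in> space M"
        from dom[OF this, of i] show "norm \<bar>f x - s i x\<bar> \<le> 3 * \<bar>f x\<bar>" by auto
      qed
    qed (use f si in \<open>auto dest: borel_measurable_integrable\<close>)
    then have "eventually (\<lambda>i. (\<integral>x. \<bar>f x - s i x\<bar> \<partial>M) < \<eta>) sequentially"
      using \<open>\<eta> > 0\<close> by (intro order_tendstoD(2)) auto
    then obtain i where "(\<integral>x. \<bar>f x - s i x\<bar> \<partial>M) < \<eta>" by (auto simp: eventually_sequentially)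
    then show "\<exists>g. app g \<and> (\<integral>x. \<bar>f x - g x\<bar> \<partial>M) < \<eta>" using s by blast
  qed
  have app_add: "app (\<lambda>x. f x + g x)" if fg: "app f" "app g" for f g
    unfolding app_def
  proof (intro conjI allI impI)
    show "integrable M (\<lambda>x. f x + g x)" using that by (auto simp: app_def)
    fix \<eta> :: real assume "\<eta> > 0"
    then obtain e e' where e: "(\<integral>x. \<bar>f x - denote E e x\<bar> \<partial>M) < \<eta> / 2" "(\<integral>x. \<bar>g x - denote E e' x\<bar> \<partial>M) < \<eta> / 2"
      using app_half[OF fg(1)] app_half[OF fg(2)] by blast
    have "(\<integral>x. \<bar>f x + g x - denote E (Add e e') x\<bar> \<partial>M) \<le> (\<integral>x. \<bar>f x - denote E e x\<bar> + \<bar>g x - denote E e' x\<bar> \<partial>M)"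
      using that int by (intro integral_mono) (auto simp: app_def)
    also have "\<dots> = (\<integral>x. \<bar>f x - denote E e x\<bar> \<partial>M) + (\<integral>x. \<bar>g x - denote E e' x\<bar> \<partial>M)"
      using that int by (intro Bochner_Integration.integral_add) (auto simp: app_def)
    finally show "\<exists>e. (\<integral>x. \<bar>f x + g x - denote E e x\<bar> \<partial>M) < \<eta>" using e by (intro exI[of _ "Add e e'"]) auto
  qed
  have app_max: "app (\<lambda>x. max (f x) (g x))" if fg: "app f" "app g" for f g
    unfolding app_def
  proof (intro conjI allI impI)
    show "integrable M (\<lambda>x. max (f x) (g x))" using that by (auto simp: app_def)
    fix \<eta> :: real assume "\<eta> > 0"
    then obtain e e' where e: "(\<integral>x. \<bar>f x - denote E e x\<bar> \<partial>M) < \<eta> / 2" "(\<integral>x. \<bar>g x - denote E e' x\<bar> \<partial>M) < \<eta> / 2"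
      using app_half[OF fg(1)] app_half[OF fg(2)] by blast
    have "(\<integral>x. \<bar>max (f x) (g x) - denote E (Join e e') x\<bar> \<partial>M) \<le> (\<integral>x. \<bar>f x - denote E e x\<bar> + \<bar>g x - denote E e' x\<bar> \<partial>M)"
      using that int by (intro integral_mono) (auto simp: app_def)
    also have "\<dots> = (\<integral>x. \<bar>f x - denote E e x\<bar> \<partial>M) + (\<integral>x. \<bar>g x - denote E e' x\<bar> \<partial>M)"
      using that int by (intro Bochner_Integration.integral_add) (auto simp: app_def)
    finally show "\<exists>e. (\<integral>x. \<bar>max (f x) (g x) - denote E e x\<bar> \<partial>M) < \<eta>" using e by (intro exI[of _ "Join e e'"]) auto
  qed
  have app_ratscale: "app (\<lambda>x. of_rat q * f x)" if af: "app f" for f q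
    unfolding app_def
  proof (intro conjI allI impI)
    show "integrable M (\<lambda>x. of_rat q * f x)" using that by (auto simp: app_def)
    fix \<eta> :: real assume "\<eta> > 0"
    define c where "c = \<bar>of_rat q :: real\<bar> + 1"
    have "c > 0" unfolding c_def by (rule add_nonneg_pos) auto
    then have "\<eta> / c > 0" using \<open>\<eta> > 0\<close> by simp
    then obtain e where e: "(\<integral>x. \<bar>f x - denote E e x\<bar> \<partial>M) < \<eta> / c"
      using af unfolding app_def by blast
    have "(\<integral>x. \<bar>of_rat q * f x - denote E (Scale q e) x\<bar> \<partial>M) = (\<integral>x. \<bar>of_rat q\<bar> * \<bar>f x - denote E e x\<bar> \<partial>M)"
      by (intro Bochner_Integration.integral_cong) (auto simp: right_diff_distrib[symmetric] abs_mult)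
    also have "\<dots> = \<bar>of_rat q\<bar> * (\<integral>x. \<bar>f x - denote E e x\<bar> \<partial>M)" by simp
    also have "\<dots> \<le> c * (\<integral>x. \<bar>f x - denote E e x\<bar> \<partial>M)"
      unfolding c_def by (intro mult_right_mono) (auto intro: integral_nonneg_AE)
    also have "\<dots> < \<eta>" using e \<open>c > 0\<close> by (simp add: field_simps)
    finally show "\<exists>e. (\<integral>x. \<bar>of_rat q * f x - denote E e x\<bar> \<partial>M) < \<eta>" by (intro exI[of _ "Scale q e"]) auto
  qed
  have app_scale: "app (\<lambda>x. c * f x)" if "app f" for f c
  proof (rule app_lim)
    show "integrable M (\<lambda>x. c * f x)" using that by (auto simp: app_def)
    fix \<eta> :: real assume "\<eta> > 0"
    \<comment> \<open>A rational within \<open>\<eta> / (?I + 1)\<close> of \<open>c\<close>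
      suffices; the summand 1 guards against \<open>?I = 0\<close>.\<close>
    let ?I = "(\<integral>x. \<bar>f x\<bar> \<partial>M)"
    have I: "?I \<ge> 0" by (intro integral_nonneg_AE) auto
    have pos: "0 < \<eta> / (?I + 1)" using \<open>\<eta> > 0\<close> by (rule divide_pos_pos) (use I in linarith)
    obtain q where q: "c < of_rat q" "of_rat q < c + \<eta> / (?I + 1)"
      using of_rat_dense[of c "c + \<eta> / (?I + 1)"] pos by auto
    have "(\<integral>x. \<bar>c * f x - of_rat q * f x\<bar> \<partial>M) = (\<integral>x. \<bar>c - of_rat q\<bar> * \<bar>f x\<bar> \<partial>M)"
      by (intro Bochner_Integration.integral_cong) (auto simp: left_diff_distrib[symmetric] abs_mult)
    also have "\<dots> = \<bar>c - of_rat q\<bar> * ?I" by simp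
    also have "\<dots> \<le> \<eta> / (?I + 1) * ?I" using q I by (intro mult_right_mono) auto
    also have "\<dots> < \<eta>"
    proof -
      have "0 < ?I + 1" using I by linarith
      then show ?thesis using \<open>\<eta> > 0\<close> by (simp add: field_simps)
    qed
    finally show "\<exists>g. app g \<and> (\<integral>x. \<bar>c * f x - g x\<bar> \<partial>M) < \<eta>"
      using app_ratscale[OF that] by blast
  qed
  have app_ind: "app (indicator B)" if "B \<in> sets M" for B
    using that unfolding gen
  proof (induction rule: sigma_sets.induct)
    case (Basic a)
    then obtain i where "a = E i" by auto
    with app_sem[of "Gen i"] show ?case by (auto intro: app_cong)
  next
    case Empty
    show ?case by (rule app_cong[OF app_sem[of "Constant 0"]]) auto
  next
    case (Compl a)
    from app_add[OF app_sem[of "Constant 1"] app_scale[OF Compl.IH, of "-1"]]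
    show ?case by (rule app_cong) (auto simp: indicator_def)
  next
    case (Union a)
    have [measurable]: "a i \<in> sets M" for i using Union(1) by (simp add: gen)
    have U: "app (indicator (\<Union>i<n. a i))" for n
    proof (induction n)
      case 0
      show ?case by (rule app_cong[OF app_sem[of "Constant 0"]]) auto
    next
      case (Suc n)
      show ?case
        by (rule app_cong[OF app_max[OF Suc Union.IH[of n]]]) (auto simp: indicator_def lessThan_Suc)
    qed
    show ?case
    proof (rule app_dom[OF _ U])
      show "integrable M (indicator (\<Union> (range a)) :: 'a \<Rightarrow> real)" by (simp add: less_top[symmetric])
      show "(\<lambda>i. indicator (\<Union>i<i. a i) x :: real) \<longlonglongrightarrow> indicator (\<Union> (range a)) x" for x
        using LIMSEQ_indicator_UN[of a x] by simp
    qed (auto simp: indicator_def)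
  qed
  have "app f"
    using f
  proof (induction rule: integrable_induct)
    case (base A c)
    then show ?case using app_scale[OF app_ind, of A c] by (simp add: mult.commute)
  next
    case (add f g)
    then show ?case by (intro app_add)
  next
    case (lim f s)
    then show ?case by (intro app_dom[of f s]) (auto intro: app_add)
  qed
  then show ?thesis using \<open>\<eta> > 0\<close> by (auto simp: app_def)
qed

text \<open>The density is the first member of a countable \<open>L\<^sup>1\<close>-dense family that passes countably many
  tests, which makes it depend measurably on \<open>\<mu>\<close>.\<close>

lemma density_selection:
  fixes H P :: "'a measure"
  assumes gen: "\<exists>E. countable E \<and> E \<subseteq> Pow (space H) \<and> sets H = sigma_sets (space H) E"
    and P: "prob_space P" "sets P = sets H" and \<eta>: "\<eta> > 0"
  obtains d :: "'a measure \<Rightarrow> 'a \<Rightarrow> real" where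
    "case_prod d \<in> borel_measurable (prob_algebra H \<Otimes>\<^sub>M H)"
    "\<And>\<mu> h. 0 \<le> d \<mu> h" "\<And>\<mu>. \<exists>c. \<forall>h. d \<mu> h \<le> c"
    "\<And>\<mu> B. \<mu> \<in> space (prob_algebra H) \<Longrightarrow> absolutely_continuous P \<mu> \<Longrightarrow> B \<in> sets H \<Longrightarrow>
      \<bar>measure \<mu> B - (\<integral>h. indicator B h * d \<mu> h \<partial>P)\<bar> \<le> \<eta>"
proof -
  interpret P: prob_space P by fact
  obtain E where E: "countable E" "E \<subseteq> Pow (space H)" "sets H = sigma_sets (space H) E"
    using gen by blast
  \<comment> \<open>Adjoining the empty set makes the family of generators nonempty, hence the range
    of a sequence, and does not change the sigma-algebra.\<close>
  define G where "G = from_nat_into (insert {} E)"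
  have rG: "range G = insert {} E" unfolding G_def using E by (intro range_from_nat_into) auto
  have spP: "space P = space H" using P(2) by (rule sets_eq_imp_space_eq)
  have sH: "sets H = sigma_sets (space H) (range G)"
    unfolding E(3) rG
    by (intro equalityI sigma_sets_mono sigma_sets_mono') (auto intro: sigma_sets.intros)
  have GH: "G i \<in> sets H" for i unfolding sH by auto
  have GP: "G i \<in> sets P" for i using GH P by simp
  \<comment> \<open>Positive parts serve as candidate densities, and expressions clipped to
    \<open>[0, 1]\<close> as the tests \<open>\<phi>\<close>, which stand in for indicators.\<close>
  define g where "g j x = max 0 (denote G (from_nat j) x)" for j :: nat and x
  define \<phi> where "\<phi> e x = max 0 (min 1 (denote G e x))" for e x
  have semH[measurable]: "denote G e \<in> borel_measurable H" for e by (rule denote_measurable[OF GH])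
  have semP[measurable]: "denote G e \<in> borel_measurable P" for e by (rule denote_measurable[OF GP])
  have gH[measurable]: "g j \<in> borel_measurable H" for j unfolding g_def by measurable
  have gP[measurable]: "g j \<in> borel_measurable P" for j unfolding g_def by measurable
  have pH[measurable]: "\<phi> e \<in> borel_measurable H" for e unfolding \<phi>_def by measurable
  have pP[measurable]: "\<phi> e \<in> borel_measurable P" for e unfolding \<phi>_def by measurable
  have p01: "0 \<le> \<phi> e x" "\<phi> e x \<le> 1" for e x by (auto simp: \<phi>_def)
  have g0: "0 \<le> g j x" for j x by (simp add: g_def)
  have gb: "\<exists>c. \<forall>x. g j x \<le> c" for j
  proof -
    obtain c where "\<forall>x. \<bar>denote G (from_nat j) x\<bar> \<le> c" using denote_bounded by blast
    then show ?thesis by (intro exI[of _ "max 0 c"]) (auto simp: g_def max_def abs_le_iff; smt (verit))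
  qed
  have gi: "integrable P (g j)" for j
  proof -
    obtain c where "\<forall>x. g j x \<le> c" using gb by blast
    then show ?thesis using g0 by (intro P.integrable_const_bound[of _ c]) auto
  qed
  \<comment> \<open>Testing against all of \<open>sets H\<close> could be an uncountable
    conjunction; over expressions it is countable, hence measurable in \<open>\<mu>\<close>.\<close>
  define Q where "Q j \<mu> \<longleftrightarrow> (\<forall>e. \<bar>(\<integral>x. \<phi> e x \<partial>\<mu>) - (\<integral>x. \<phi> e x * g j x \<partial>P)\<bar> \<le> \<eta>)" for j \<mu>
  have int_meas[measurable]: "(\<lambda>\<mu>. \<integral>x. \<phi> e x \<partial>\<mu>) \<in> borel_measurable (prob_algebra H)" for e
    unfolding prob_algebra_def
    by (intro measurable_restrict_space1 integral_measurable_subprob_algebra pH)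
  have Qm[measurable]: "Measurable.pred (prob_algebra H) (Q j)" for j
    unfolding Q_def by measurable
  \<comment> \<open>If no candidate passes, \<open>LEAST\<close> is some fixed number, and
    \<open>d \<mu>\<close> is still a bounded nonnegative function.\<close>
  define s where "s \<mu> = (LEAST j. Q j \<mu>)" for \<mu>
  have s_meas: "s \<in> prob_algebra H \<rightarrow>\<^sub>M count_space UNIV" unfolding s_def by measurable
  define d where "d \<mu> h = g (s \<mu>) h" for \<mu> h
  have "case_prod d \<in> borel_measurable (prob_algebra H \<Otimes>\<^sub>M H)"
    unfolding d_def split_beta
    by (rule measurable_compose_countable[where f="\<lambda>j x. g j (snd x)"])
       (use s_meas in \<open>auto intro: measurable_compose[OF measurable_fst]\<close>)
  moreover have "\<bar>measure \<mu> B - (\<integral>h. indicator B h * d \<mu> h \<partial>P)\<bar> \<le> \<eta>"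
    if \<mu>: "\<mu> \<in> space (prob_algebra H)" and ac: "absolutely_continuous P \<mu>" and B: "B \<in> sets H" for \<mu> B
  proof -
    from \<mu> have sm: "sets \<mu> = sets H" and pm: "prob_space \<mu>" by (auto simp: space_prob_algebra)
    interpret \<mu>: prob_space \<mu> by fact
    have [measurable]: "B \<in> sets P" using B P by simp
    obtain D where D[measurable]: "D \<in> borel_measurable P"
      and AE: "AE x in P. RN_deriv P \<mu> x = ennreal (D x)" and D0: "\<And>x. 0 \<le> D x"
      using P.real_RN_deriv[OF \<mu>.finite_measure_axioms ac] sm P(2) by metis
    have dens: "\<mu> = density P D"
    proof -
      have "\<mu> = density P (RN_deriv P \<mu>)" using P.density_RN_deriv[OF ac] sm P(2) by simp
      also have "\<dots> = density P D" by (intro density_cong AE) auto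
      finally show ?thesis .
    qed
    have Di: "integrable P D"
    proof (rule integrableI_nonneg)
      have "(\<integral>\<^sup>+x. ennreal (D x) \<partial>P) = emeasure \<mu> (space \<mu>)"
        by (subst dens, subst emeasure_density) (auto simp: dens intro!: nn_integral_cong)
      then show "(\<integral>\<^sup>+x. ennreal (D x) \<partial>P) < \<infinity>" by (simp add: \<mu>.emeasure_space_1)
    qed (use D0 in auto)
    have int\<mu>: "(\<integral>x. f x \<partial>\<mu>) = (\<integral>x. f x * D x \<partial>P)" if "f \<in> borel_measurable P" for f :: "'a \<Rightarrow> real"
      unfolding dens using that D0 by (subst integral_density) (auto simp: mult.commute)
    have bi: "integrable P (\<lambda>x. f x * h x)" if "integrable P h" "f \<in> borel_measurable P" "\<And>x. \<bar>f x\<bar> \<le> 1" for f h :: "'a \<Rightarrow> real"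
      by (rule Bochner_Integration.integrable_bound[OF that(1)])
         (use that in \<open>auto simp: abs_mult mult_left_le_one_le dest: borel_measurable_integrable\<close>)
    have p1: "\<bar>\<phi> e x\<bar> \<le> 1" for e x using p01[of e x] by auto
    have ip: "integrable P (\<lambda>x. \<phi> e x * D x)" "integrable P (\<lambda>x. \<phi> e x * g j x)" for e j
      using p1 by (auto intro!: bi Di gi)
    have ii: "integrable P (\<lambda>x. indicator B x * D x)" "integrable P (\<lambda>x. indicator B x * g j x)" for j
      by (auto intro!: bi Di gi simp: indicator_def)
    \<comment> \<open>An expression within \<open>\<eta>\<close> of the density \<open>D\<close> in
      L1 yields a candidate that passes: the positive part is only closer to the nonnegative
      \<open>D\<close>, and tests take values in \<open>[0, 1]\<close>.\<close>
    have "\<exists>j. Q j \<mu>"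
    proof -
      obtain e where e: "(\<integral>x. \<bar>D x - denote G e x\<bar> \<partial>P) < \<eta>"
        using denote_dense[OF P.finite_measure_axioms _ Di \<eta>, of G] sH P(2) spP by auto
      have ge: "g (to_nat e) x = max 0 (denote G e x)" for x by (simp add: g_def)
      have "\<bar>(\<integral>x. \<phi> e' x \<partial>\<mu>) - (\<integral>x. \<phi> e' x * g (to_nat e) x \<partial>P)\<bar> \<le> \<eta>" for e'
      proof -
        have "(\<integral>x. \<phi> e' x \<partial>\<mu>) - (\<integral>x. \<phi> e' x * g (to_nat e) x \<partial>P)
          = (\<integral>x. \<phi> e' x * D x - \<phi> e' x * g (to_nat e) x \<partial>P)"
          unfolding int\<mu>[OF pP] by (rule Bochner_Integration.integral_diff[symmetric, OF ip])
        also have "\<bar>\<dots>\<bar> \<le> (\<integral>x. \<bar>\<phi> e' x * D x - \<phi> e' x * g (to_nat e) x\<bar> \<partial>P)"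
          by (rule integral_abs_bound)
        also have "\<dots> \<le> (\<integral>x. \<bar>D x - denote G e x\<bar> \<partial>P)"
        proof (rule integral_mono)
          fix x
          have "\<bar>\<phi> e' x * D x - \<phi> e' x * g (to_nat e) x\<bar> = \<phi> e' x * \<bar>D x - g (to_nat e) x\<bar>"
            using p01(1)[of e' x] by (simp add: right_diff_distrib[symmetric] abs_mult)
          also have "\<dots> \<le> \<bar>D x - g (to_nat e) x\<bar>" using p01 by (intro mult_left_le_one_le) auto
          also have "\<dots> \<le> \<bar>D x - denote G e x\<bar>" using D0[of x] by (auto simp: ge)
          finally show "\<bar>\<phi> e' x * D x - \<phi> e' x * g (to_nat e) x\<bar> \<le> \<bar>D x - denote G e x\<bar>" .
        qed (use ip in \<open>auto intro!: Di denote_integrable P.finite_measure_axioms GP\<close>)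
        finally show ?thesis using e by simp
      qed
      then show ?thesis unfolding Q_def by blast
    qed
    then have Qs: "Q (s \<mu>) \<mu>" unfolding s_def by (rule LeastI_ex)
    let ?g = "g (s \<mu>)"
    show ?thesis
    proof (rule field_le_epsilon)
      fix \<zeta> :: real assume "\<zeta> > 0"
      \<comment> \<open>From tests back to the set \<open>B\<close>: \<open>?M\<close> is the sum of
        \<open>\<mu>\<close> and the measure with density \<open>?g\<close>, so one approximation of
        the indicator of \<open>B\<close> in L1 of \<open>?M\<close> controls the replacement in
        both integrals. Its error \<open>\<zeta>\<close> is arbitrary and disappears.\<close>
      let ?M = "density P (\<lambda>x. D x + ?g x)"
      have fM: "finite_measure ?M"
      proof (rule finite_measureI)
        have "integrable P (\<lambda>x. D x + ?g x)" using Di gi by auto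
        then have "(\<integral>\<^sup>+x. ennreal (D x + ?g x) \<partial>P) < \<infinity>"
          using D0 g0 by (subst (asm) integrable_iff_bounded) (auto simp: abs_of_nonneg)
        then show "emeasure ?M (space ?M) \<noteq> \<infinity>"
          by (subst emeasure_density) (auto simp: top_unique less_top cong: nn_integral_cong_simp)
      qed
      have "integrable ?M (indicator B :: 'a \<Rightarrow> real)"
        using fM by (intro finite_measure.integrable_const_bound[of _ _ 1]) (auto simp: indicator_def)
      moreover have "sets ?M = sigma_sets (space ?M) (range G)" using sH P(2) spP by simp
      ultimately obtain e where e: "(\<integral>x. \<bar>indicator B x - denote G e x\<bar> \<partial>?M) < \<zeta>"
        using denote_dense[OF fM, of G "indicator B"] \<open>\<zeta> > 0\<close> by blast
      have semi: "integrable ?M (denote G e)" using GP by (intro denote_integrable fM) auto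
      have ibp: "integrable P (\<lambda>x. (indicator B x - \<phi> e x) * (D x - ?g x))"
        proof (intro bi Bochner_Integration.integrable_diff Di gi)
        show "\<bar>indicator B x - \<phi> e x\<bar> \<le> 1" for x using p01[of e x] by (auto simp: indicator_def)
      qed simp
      have "measure \<mu> B - (\<integral>h. indicator B h * d \<mu> h \<partial>P) = (\<integral>x. indicator B x * D x \<partial>P) - (\<integral>h. indicator B h * ?g h \<partial>P)"
      proof -
        have "measure \<mu> B = (\<integral>x. indicator B x \<partial>\<mu>)" using B sm by simp
        also have "\<dots> = (\<integral>x. indicator B x * D x \<partial>P)" by (subst int\<mu>) auto
        finally show ?thesis by (simp add: d_def)
      qed
      also have "\<dots> = (\<integral>x. indicator B x * D x - indicator B x * ?g x \<partial>P)"
        by (rule Bochner_Integration.integral_diff[symmetric, OF ii])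
      also have "\<dots> = (\<integral>x. (\<phi> e x * D x - \<phi> e x * ?g x) + (indicator B x - \<phi> e x) * (D x - ?g x) \<partial>P)"
        by (intro Bochner_Integration.integral_cong) (auto simp: algebra_simps)
      also have "\<dots> = (\<integral>x. \<phi> e x * D x - \<phi> e x * ?g x \<partial>P) + (\<integral>x. (indicator B x - \<phi> e x) * (D x - ?g x) \<partial>P)"
        by (intro Bochner_Integration.integral_add Bochner_Integration.integrable_diff ip ibp)
      also have "\<bar>\<dots>\<bar> \<le> \<bar>\<integral>x. \<phi> e x * D x - \<phi> e x * ?g x \<partial>P\<bar> + \<bar>\<integral>x. (indicator B x - \<phi> e x) * (D x - ?g x) \<partial>P\<bar>"
        by (rule abs_triangle_ineq)
      also have "\<bar>\<integral>x. \<phi> e x * D x - \<phi> e x * ?g x \<partial>P\<bar> \<le> \<eta>"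
      proof -
        have "(\<integral>x. \<phi> e x * D x - \<phi> e x * ?g x \<partial>P) = (\<integral>x. \<phi> e x \<partial>\<mu>) - (\<integral>x. \<phi> e x * ?g x \<partial>P)"
          unfolding int\<mu>[OF pP] by (rule Bochner_Integration.integral_diff[OF ip])
        then show ?thesis using Qs unfolding Q_def by metis
      qed
      also have "\<bar>\<integral>x. (indicator B x - \<phi> e x) * (D x - ?g x) \<partial>P\<bar> \<le> \<zeta>"
      proof -
        have "\<bar>\<integral>x. (indicator B x - \<phi> e x) * (D x - ?g x) \<partial>P\<bar> \<le> (\<integral>x. \<bar>(indicator B x - \<phi> e x) * (D x - ?g x)\<bar> \<partial>P)"
          by (rule integral_abs_bound)
        also have "\<dots> \<le> (\<integral>x. (D x + ?g x) * \<bar>indicator B x - denote G e x\<bar> \<partial>P)"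
        proof (rule integral_mono)
          show "integrable P (\<lambda>x. (D x + ?g x) * \<bar>indicator B x - denote G e x\<bar>)"
          proof -
            have "integrable ?M (\<lambda>x. \<bar>indicator B x - denote G e x\<bar>)"
              using semi \<open>integrable ?M (indicator B)\<close> by auto
            then show ?thesis using D0 g0 by (subst (asm) integrable_density) auto
          qed
          show "integrable P (\<lambda>x. \<bar>(indicator B x - \<phi> e x) * (D x - ?g x)\<bar>)"
            by (intro integrable_abs ibp)
          fix x
          have "\<bar>indicator B x - \<phi> e x\<bar> \<le> \<bar>indicator B x - denote G e x\<bar>"
            by (auto simp: \<phi>_def indicator_def)
          moreover have "\<bar>D x - ?g x\<bar> \<le> D x + ?g x" using D0[of x] g0[of "s \<mu>" x] by auto
          ultimately show "\<bar>(indicator B x - \<phi> e x) * (D x - ?g x)\<bar> \<le> (D x + ?g x) * \<bar>indicator B x - denote G e x\<bar>"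
            unfolding abs_mult by (subst mult.commute) (intro mult_mono, auto)
        qed
        also have "\<dots> = (\<integral>x. \<bar>indicator B x - denote G e x\<bar> \<partial>?M)"
          using D0 g0 by (subst integral_density) auto
        finally show ?thesis using e by simp
      qed
      finally show "\<bar>measure \<mu> B - (\<integral>h. indicator B h * d \<mu> h \<partial>P)\<bar> \<le> \<eta> + \<zeta>" by simp
    qed
  qed
  ultimately show thesis using that[of d] g0 gb by (auto simp: d_def)
qed

section \<open>Sampling from a density with a Poisson process\<close>

lemma num_points_measurable [measurable]:
  assumes [measurable]: "B \<in> sets M" and "sets R = sets (PiM UNIV (\<lambda>_. M))"
  shows "(\<lambda>r. num_points r B) \<in> borel_measurable R"
  unfolding num_points_def measurable_cong_sets[OF assms(2) refl] by measurable

lemma num_points_Diff: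
  assumes "C \<subseteq> B"
  shows "num_points r B = num_points r C + num_points r (B - C)"
  unfolding num_points_def
  by (subst suminf_add) (use assms in \<open>auto intro!: arg_cong[where f=suminf] simp: indicator_def fun_eq_iff\<close>)

lemma num_points_ge_1: "r i \<in> B \<Longrightarrow> 1 \<le> num_points r B"
  using ennreal_suminf_lessD[of "\<lambda>i. indicator B (r i)" 1 i]
  by (auto simp: num_points_def indicator_def not_less[symmetric])

text \<open>A unique point of \<open>B\<close> is found by \<open>LEAST\<close> in any enumeration.
  Whether it lies in \<open>C\<close> thereby becomes a question about counts, which is what the law
  of the process describes.\<close>

lemma num_points_eq_1_Least:
  assumes "num_points r B = 1" "C \<subseteq> B"
  shows "r (LEAST i. r i \<in> B) \<in> C \<longleftrightarrow> num_points r C = 1"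
proof -
  let ?i = "LEAST i. r i \<in> B"
  have "\<exists>i. r i \<in> B"
  proof (rule ccontr)
    assume "\<not> ?thesis"
    then have "num_points r B = 0" by (simp add: num_points_def)
    with assms(1) show False by simp
  qed
  then have i: "r ?i \<in> B" by (rule LeastI_ex)
  note sum = num_points_Diff[OF assms(2), of r, unfolded assms(1)]
  show ?thesis
  proof
    assume "r ?i \<in> C"
    then have "1 \<le> num_points r C" by (rule num_points_ge_1)
    moreover have "num_points r C \<le> 1" using sum by (metis le_iff_add)
    ultimately show "num_points r C = 1" by simp
  next
    assume *: "num_points r C = 1"
    show "r ?i \<in> C"
    proof (rule ccontr)
      assume "r ?i \<notin> C"
      \<comment> \<open>Otherwise the point in \<open>C\<close> and the one in \<open>B - C\<close>
        would make two points of \<open>B\<close>.\<close>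
      with i have "1 \<le> num_points r (B - C)" by (intro num_points_ge_1) auto
      then have "(2::ennreal) \<le> 1" using sum * by (metis add_left_mono one_add_one)
      then show False by simp
    qed
  qed
qed

text \<open>The event means one point in \<open>C\<close> and none in \<open>B - C\<close>. These
  counts are independent, and with \<open>c\<close>, \<open>b\<close> the masses of
  \<open>C\<close>, \<open>B\<close> the product \<open>exp (- c) * c * exp (- (b - c))\<close>
  collapses to \<open>c * exp (- b)\<close>. Given a single point in \<open>B\<close>, its position
  is thus distributed proportionally to \<open>\<mu>\<close>.\<close>

lemma poisson_single_point:
  assumes R: "poisson_point_process \<mu> R" and B: "B \<in> sets \<mu>" "emeasure \<mu> B < \<infinity>"
    and C: "C \<in> sets \<mu>" "C \<subseteq> B"
  shows "measure R {r \<in> space R. num_points r B = 1 \<and> num_points r C = 1} =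
    measure \<mu> C * exp (- measure \<mu> B)"
proof (cases "C = {}")
  case True
  then show ?thesis by (simp add: num_points_def)
next
  case False
  interpret prob_space R using R by (simp add: poisson_point_process_def)
  have sR: "sets R = sets (PiM UNIV (\<lambda>_. \<mu>))" using R by (simp add: poisson_point_process_def)
  let ?D = "B - C"
  have D: "?D \<in> sets \<mu>" using B C by auto
  have fC: "emeasure \<mu> C < \<infinity>" using C B emeasure_mono[of C B \<mu>] by (auto intro: le_less_trans)
  have fD: "emeasure \<mu> ?D < \<infinity>" using D B emeasure_mono[of ?D B \<mu>] by (auto intro: le_less_trans)
  have mB: "measure \<mu> B = measure \<mu> C + measure \<mu> ?D"
    using measure_Union[of \<mu> C ?D] fC fD C D by (simp add: Un_absorb1 less_top top_unique)
  have pois: "prob {r \<in> space R. num_points r B = of_nat j} = exp (- measure \<mu> B) * measure \<mu> B ^ j / fact j"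
    if "B \<in> sets \<mu>" "emeasure \<mu> B < \<infinity>" for B j
    using R that unfolding poisson_point_process_def by blast
  have ind: "indep_vars (\<lambda>_. borel) (\<lambda>B r. num_points r B) {C, ?D}"
  proof -
    have "finite {C, ?D} \<and> {C, ?D} \<subseteq> sets \<mu> \<and> disjoint {C, ?D}"
      using C D by (auto simp: disjoint_def)
    with R show ?thesis unfolding poisson_point_process_def by blast
  qed
  \<comment> \<open>If \<open>C\<close> and \<open>B\<close> were both empty, the family
    \<open>{C, B - C}\<close> would collapse to one member; the case split excludes this.\<close>
  have ne: "C \<noteq> ?D" using False by auto
  have eq: "(num_points r B = 1 \<and> num_points r C = 1) \<longleftrightarrow> (num_points r C = 1 \<and> num_points r ?D = 0)" for r
    using num_points_Diff[OF C(2), of r] ennreal_add_left_cancel[of 1 "num_points r ?D" 0] by auto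
  let ?A = "\<lambda>E. if E = C then {1} else {0 :: ennreal}"
  have "prob (\<Inter>E\<in>{C, ?D}. (\<lambda>r. num_points r E) -` ?A E \<inter> space R) =
    (\<Prod>E\<in>{C, ?D}. prob ((\<lambda>r. num_points r E) -` ?A E \<inter> space R))"
    by (rule indep_varsD[OF ind]) auto
  also have "\<dots> = prob {r \<in> space R. num_points r C = of_nat 1} * prob {r \<in> space R. num_points r ?D = of_nat 0}"
    using ne by (auto simp: vimage_def Int_def conj_commute)
  also have "\<dots> = measure \<mu> C * exp (- measure \<mu> B)"
    unfolding pois[OF C(1) fC] pois[OF D fD] mB by (simp add: exp_add[symmetric])
  also have "(\<Inter>E\<in>{C, ?D}. (\<lambda>r. num_points r E) -` ?A E \<inter> space R) =
    {r \<in> space R. num_points r B = 1 \<and> num_points r C = 1}"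
    unfolding eq using ne by auto
  finally show ?thesis .
qed

text \<open>The value \<open>k\<close> encodes that the trials \<open>0..<k\<close> all fail; the
  disjunct \<open>k \<le> j\<close> also gives \<open>LEAST\<close> a witness in every case.\<close>

definition first_success :: "nat \<Rightarrow> (nat \<Rightarrow> bool) \<Rightarrow> nat" where
  "first_success k Q = (LEAST j. k \<le> j \<or> Q j)"

lemma first_success_eq: "j < k \<Longrightarrow> Q j \<Longrightarrow> (\<And>i. i < j \<Longrightarrow> \<not> Q i) \<Longrightarrow> first_success k Q = j"
  unfolding first_success_def by (rule Least_equality) (auto simp: not_less[symmetric])

text \<open>The bound is an equality up to the law of the default outcome, which accounts for the missing
  mass \<open>(1 - p) ^ k\<close>.\<close>

lemma iid_first_success:
  assumes R: "prob_space R" and S: "S \<in> sets R" and T: "T \<in> sets R" "T \<subseteq> S"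
    and p: "measure R S = p" and T': "measure R T = p * c"
    and V: "V \<in> sets (iid k R)"
      "\<And>j \<omega>. j < k \<Longrightarrow> \<omega> \<in> space (iid k R) \<Longrightarrow> \<omega> j \<in> T \<Longrightarrow> (\<And>i. i < j \<Longrightarrow> \<omega> i \<notin> S) \<Longrightarrow> \<omega> \<in> V"
  shows "(1 - (1 - p) ^ k) * c \<le> measure (iid k R) V"
proof -
  interpret R: prob_space R by fact
  interpret finite_product_prob_space "\<lambda>_. R" "{..<k}" by unfold_locales auto
  \<comment> \<open>Box \<open>j\<close>: failure before trial \<open>j\<close>, an outcome in
    \<open>T\<close> at \<open>j\<close>, no constraint afterwards. The boxes are disjoint and
    contained in \<open>V\<close>, and their probabilities form a geometric sum.\<close>
  define A where "A j i = (if i < j then space R - S else if i = j then T else space R)" for j i :: nat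
  have A: "A j i \<in> sets R" for j i using S T by (auto simp: A_def)
  have prob_A: "measure (iid k R) (Pi\<^sub>E {..<k} (A j)) = (1 - p) ^ j * (p * c)" if "j < k" for j
  proof -
    have "measure (iid k R) (Pi\<^sub>E {..<k} (A j)) = (\<Prod>i<k. measure R (A j i))"
      using A by (intro prob_times) auto
    also have "\<dots> = (\<Prod>i\<in>{..<j} \<union> {j} \<union> {j<..<k}. measure R (A j i))"
      using that by (intro prod.cong) auto
    also have "\<dots> = (\<Prod>i<j. measure R (A j i)) * measure R (A j j) * (\<Prod>i\<in>{j<..<k}. measure R (A j i))"
      by (subst prod.union_disjoint, auto)+
    also have "(\<Prod>i<j. measure R (A j i)) = (1 - p) ^ j"
      using S by (simp add: A_def R.prob_compl p)
    also have "measure R (A j j) = p * c" by (simp add: A_def T')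
    also have "(\<Prod>i\<in>{j<..<k}. measure R (A j i)) = 1"
      by (intro prod.neutral) (auto simp: A_def R.prob_space)
    finally show ?thesis by simp
  qed
  have disj: "disjoint_family_on (\<lambda>j. Pi\<^sub>E {..<k} (A j)) {..<k}"
  proof -
    have "Pi\<^sub>E {..<k} (A i) \<inter> Pi\<^sub>E {..<k} (A j) = {}" if "i < j" "j < k" for i j
    proof (intro equals0I)
      fix \<omega> assume \<omega>: "\<omega> \<in> Pi\<^sub>E {..<k} (A i) \<inter> Pi\<^sub>E {..<k} (A j)"
      then have "\<omega> i \<in> A i i" "\<omega> i \<in> A j i" using that by (auto simp: PiE_iff)
      then show False using that T by (auto simp: A_def)
    qed
    then show ?thesis unfolding disjoint_family_on_def
      by (metis Int_commute lessThan_iff linorder_neqE_nat)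
  qed
  \<comment> \<open>The formula for the geometric sum divides by \<open>p\<close>; for
    \<open>p = 0\<close> both sides vanish.\<close>
  have "(1 - (1 - p) ^ k) * c = (\<Sum>j<k. (1 - p) ^ j) * p * c"
    using sum_gp_strict[of "1 - p" k] by (cases "p = 0") auto
  also have "\<dots> = (\<Sum>j<k. (1 - p) ^ j * (p * c))" by (simp add: sum_distrib_right mult.assoc)
  also have "\<dots> = (\<Sum>j<k. measure (iid k R) (Pi\<^sub>E {..<k} (A j)))" using prob_A by (intro sum.cong) auto
  also have "\<dots> = measure (iid k R) (\<Union>j<k. Pi\<^sub>E {..<k} (A j))"
    using A disj by (intro finite_measure_finite_Union[symmetric]) (auto intro!: sets_PiM_I_finite)
  also have "\<dots> \<le> measure (iid k R) V"
  proof (intro finite_measure_mono V(1) UN_least subsetI)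
    fix j \<omega> assume j: "j \<in> {..<k}" and \<omega>: "\<omega> \<in> Pi\<^sub>E {..<k} (A j)"
    have i: "\<omega> i \<in> A j i" if "i < k" for i using \<omega> that by auto
    have "\<omega> \<in> space (iid k R)"
      using \<omega> A[THEN sets.sets_into_space] by (auto simp: space_PiM PiE_iff subset_iff)
    then show "\<omega> \<in> V" using V(2)[of j \<omega>] j i[of j] i by (auto simp: A_def split: if_splits) (metis DiffD2 less_trans)
  qed
  finally show ?thesis .
qed

text \<open>With \<open>C\<close> the whole space this is the acceptance region, with
  \<open>C\<close> an event the part of it where the accepted hypothesis lies in the event;
  \<open>poisson_single_point\<close> is applied to such a nested pair.\<close>

definition region :: "'a set \<Rightarrow> ('a \<Rightarrow> real) \<Rightarrow> ('a \<times> real \<times> real) set" where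
  "region C f = {(h, y, t). h \<in> C \<and> 0 \<le> y \<and> y \<le> f h \<and> 0 \<le> t \<and> t \<le> 1}"

lemma sigma_finite_leb_nonneg: "sigma_finite_measure leb_nonneg"
  by (rule sigma_finite_measure_restrict_space) (auto intro: sigma_finite_lborel)

lemma fst_leb_measurable [measurable]:
  "(\<lambda>z. fst (snd z)) \<in> borel_measurable (P \<Otimes>\<^sub>M leb_nonneg \<Otimes>\<^sub>M leb_nonneg)"
  "(\<lambda>z. snd (snd z)) \<in> borel_measurable (P \<Otimes>\<^sub>M leb_nonneg \<Otimes>\<^sub>M leb_nonneg)"
proof -
  have id: "(\<lambda>x. x) \<in> borel_measurable leb_nonneg"
    by (rule measurable_restrict_space1) simp
  show "(\<lambda>z. fst (snd z)) \<in> borel_measurable (P \<Otimes>\<^sub>M leb_nonneg \<Otimes>\<^sub>M leb_nonneg)"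
    by (rule measurable_compose[OF measurable_compose[OF measurable_snd measurable_fst] id])
  show "(\<lambda>z. snd (snd z)) \<in> borel_measurable (P \<Otimes>\<^sub>M leb_nonneg \<Otimes>\<^sub>M leb_nonneg)"
    by (rule measurable_compose[OF measurable_compose[OF measurable_snd measurable_snd] id])
qed

text \<open>The density comes with a parameter \<open>x w\<close> because the learner samples from a
  density computed from its input: the sampler has to be measurable jointly in the input and the
  process.\<close>

lemma pred_region:
  assumes f: "case_prod f \<in> borel_measurable (L \<Otimes>\<^sub>M P)" and C[measurable]: "C \<in> sets P"
    and x: "x \<in> N \<rightarrow>\<^sub>M L" and z: "z \<in> N \<rightarrow>\<^sub>M P \<Otimes>\<^sub>M leb_nonneg \<Otimes>\<^sub>M leb_nonneg"
  shows "Measurable.pred N (\<lambda>w. z w \<in> region C (f (x w)))"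
proof -
  note [measurable] = x z
  have [measurable]: "(\<lambda>w. f (x w) (fst (z w))) \<in> borel_measurable N"
  proof -
    have "(\<lambda>w. (x w, fst (z w))) \<in> N \<rightarrow>\<^sub>M L \<Otimes>\<^sub>M P" by measurable
    from measurable_compose[OF this f] show ?thesis by simp
  qed
  have [measurable]: "(\<lambda>w. fst (snd (z w))) \<in> borel_measurable N" "(\<lambda>w. snd (snd (z w))) \<in> borel_measurable N"
    using measurable_compose[OF z fst_leb_measurable(1)] measurable_compose[OF z fst_leb_measurable(2)] by auto
  have [measurable]: "(\<lambda>w. fst (z w)) \<in> N \<rightarrow>\<^sub>M P" by measurable
  show ?thesis
    unfolding region_def split_beta mem_Collect_eq by measurable
qed

lemma
  fixes f :: "'a \<Rightarrow> real"
  assumes f[measurable]: "f \<in> borel_measurable P" and f0: "\<And>h. 0 \<le> f h" and C[measurable]: "C \<in> sets P"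
  shows sets_region: "region C f \<in> sets (P \<Otimes>\<^sub>M leb_nonneg \<Otimes>\<^sub>M leb_nonneg)"
    and emeasure_region: "emeasure (P \<Otimes>\<^sub>M leb_nonneg \<Otimes>\<^sub>M leb_nonneg) (region C f) =
      (\<integral>\<^sup>+h. ennreal (indicator C h * f h) \<partial>P)"
proof -
  let ?L = "leb_nonneg" and ?M = "P \<Otimes>\<^sub>M leb_nonneg \<Otimes>\<^sub>M leb_nonneg"
  interpret L: sigma_finite_measure ?L by (rule sigma_finite_leb_nonneg)
  interpret LL: pair_sigma_finite ?L ?L by unfold_locales
  have "region C f = {z \<in> space ?M. z \<in> region C f}"
    using sets.sets_into_space[OF C] by (auto simp: region_def space_pair_measure)
  \<comment> \<open>A one-point parameter space specializes the joint statement to a single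
    density.\<close>
  also have "\<dots> \<in> sets ?M"
    using pred_region[of "\<lambda>_. f" "count_space {()}" P C "\<lambda>_. ()" ?M "\<lambda>z. z"] C
    by (simp add: pred_def measurable_compose[OF measurable_snd f] split_beta)
  finally show *: "region C f \<in> sets ?M" .
  have L: "emeasure ?L {0..c} = ennreal c" if "0 \<le> c" for c
    using that by (subst emeasure_restrict_space) (auto simp: Int_absorb2)
  have Ls: "{0..c} \<in> sets ?L" for c :: real
    by (auto simp: sets_restrict_space image_iff intro!: bexI[of _ "{0..c}"])
  have "emeasure ?M (region C f) = (\<integral>\<^sup>+h. emeasure (?L \<Otimes>\<^sub>M ?L) (Pair h -` region C f) \<partial>P)"
    by (rule LL.P.emeasure_pair_measure_alt[OF *])
  also have "\<dots> = (\<integral>\<^sup>+h. ennreal (indicator C h * f h) \<partial>P)"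
  proof (rule nn_integral_cong)
    fix h
    have "Pair h -` region C f = (if h \<in> C then {0..f h} \<times> {0..1} else {})"
      by (auto simp: region_def)
    then show "emeasure (?L \<Otimes>\<^sub>M ?L) (Pair h -` region C f) = ennreal (indicator C h * f h)"
      using L.emeasure_pair_measure_Times[OF Ls Ls, of "f h" 1] L f0 by simp
  qed
  finally show "emeasure ?M (region C f) = (\<integral>\<^sup>+h. ennreal (indicator C h * f h) \<partial>P)" .
qed

text \<open>The black-box model allows finitely many draws, hence the cutoff \<open>k\<close> and
  the default \<open>h0\<close>. For a probability density the default occurs with probability
  \<open>(1 - exp (-1)) ^ k\<close>.\<close>

definition poisson_sample ::
  "'a set \<Rightarrow> 'a \<Rightarrow> nat \<Rightarrow> ('a \<Rightarrow> real) \<Rightarrow> (nat \<Rightarrow> nat \<Rightarrow> 'a \<times> real \<times> real) \<Rightarrow> 'a" where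
  "poisson_sample \<Omega> h0 k f \<omega> =
    (let j = first_success k (\<lambda>j. num_points (\<omega> j) (region \<Omega> f) = 1)
     in if j < k then fst (\<omega> j (LEAST i. \<omega> j i \<in> region \<Omega> f)) else h0)"

lemma poisson_sample_measurable:
  fixes R :: "(nat \<Rightarrow> 'a \<times> real \<times> real) measure"
  assumes f: "case_prod f \<in> borel_measurable (L \<Otimes>\<^sub>M P)"
    and h0: "h0 \<in> space P"
    and R: "sets R = sets (PiM UNIV (\<lambda>_. P \<Otimes>\<^sub>M leb_nonneg \<Otimes>\<^sub>M leb_nonneg))"
  shows "(\<lambda>(x, \<omega>). poisson_sample (space P) h0 k (f x) \<omega>) \<in> L \<Otimes>\<^sub>M iid k R \<rightarrow>\<^sub>M P"
proof -
  let ?N = "L \<Otimes>\<^sub>M iid k R" and ?M = "P \<Otimes>\<^sub>M leb_nonneg \<Otimes>\<^sub>M leb_nonneg"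
  let ?B = "\<lambda>w. region (space P) (f (fst w))"
  have pt: "(\<lambda>w. snd w j i) \<in> ?N \<rightarrow>\<^sub>M ?M" if "j < k" for j i
  proof -
    have "(\<lambda>w. snd w j) \<in> ?N \<rightarrow>\<^sub>M R"
      using that by (intro measurable_compose[OF measurable_snd measurable_component_singleton]) simp
    then have "(\<lambda>w. snd w j) \<in> ?N \<rightarrow>\<^sub>M PiM UNIV (\<lambda>_. ?M)" by (simp add: measurable_cong_sets[OF refl R])
    then show ?thesis by (rule measurable_compose) simp
  qed
  have pred[measurable]: "Measurable.pred ?N (\<lambda>w. snd w j i \<in> ?B w)" if "j < k" for j i
    by (rule pred_region[OF f _ _ pt[OF that]]) auto
  have num: "(\<lambda>w. num_points (snd w j) (?B w)) \<in> borel_measurable ?N" if "j < k" for j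
    unfolding num_points_def using pred[OF that] by measurable
  have succ: "Measurable.pred ?N (\<lambda>w. k \<le> j \<or> num_points (snd w j) (?B w) = 1)" for j
  proof (cases "j < k")
    case True
    note [measurable] = num[OF True]
    show ?thesis by measurable
  qed (simp add: not_less)
  have fs: "(\<lambda>w. first_success k (\<lambda>j. num_points (snd w j) (?B w) = 1)) \<in> ?N \<rightarrow>\<^sub>M count_space UNIV"
    unfolding first_success_def using succ by measurable
  \<comment> \<open>The index \<open>first_success\<close> has countably many values, so each fixed
    \<open>j\<close> can be treated alone; from \<open>k\<close> on there are no draws in the
    product and the value is \<open>h0\<close>.\<close>
  have point: "(\<lambda>w. if j < k then fst (snd w j (LEAST i. snd w j i \<in> ?B w)) else h0) \<in> ?N \<rightarrow>\<^sub>M P" for j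
  proof (cases "j < k")
    case True
    note [measurable] = pred[OF True]
    have "(\<lambda>w. LEAST i. snd w j i \<in> ?B w) \<in> ?N \<rightarrow>\<^sub>M count_space UNIV" by measurable
    from measurable_compose_countable[OF pt[OF True] this]
    have "(\<lambda>w. snd w j (LEAST i. snd w j i \<in> ?B w)) \<in> ?N \<rightarrow>\<^sub>M ?M" .
    then show ?thesis using True by (simp add: measurable_compose[OF _ measurable_fst])
  qed (simp add: h0)
  show ?thesis
    using measurable_compose_countable[OF point fs]
    by (simp add: poisson_sample_def Let_def split_beta)
qed

text \<open>\<open>iid_first_success\<close> bounds the probability of \<open>C\<close> from below,
  and equally that of its complement. As the two masses sum to 1 on both sides of the comparison,
  these lower bounds give a two-sided estimate, whatever the default \<open>h0\<close>
  contributes.\<close>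

lemma poisson_sample_law:
  fixes R :: "(nat \<Rightarrow> 'a \<times> real \<times> real) measure"
  assumes P: "prob_space P" and f[measurable]: "f \<in> borel_measurable P" and f0: "\<And>h. 0 \<le> f h"
    and f1: "(\<integral>\<^sup>+h. f h \<partial>P) = 1" and h0: "h0 \<in> space P"
    and R: "poisson_point_process (P \<Otimes>\<^sub>M leb_nonneg \<Otimes>\<^sub>M leb_nonneg) R" and C[measurable]: "C \<in> sets P"
  shows "\<bar>measure (iid k R) {\<omega> \<in> space (iid k R). poisson_sample (space P) h0 k f \<omega> \<in> C} - (\<integral>h. indicator C h * f h \<partial>P)\<bar>
    \<le> (1 - exp (-1)) ^ k"
proof -
  let ?M = "P \<Otimes>\<^sub>M leb_nonneg \<Otimes>\<^sub>M leb_nonneg" and ?Q = "iid k R"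
  let ?s = "poisson_sample (space P) h0 k f" and ?I = "\<lambda>C. \<integral>h. indicator C h * f h \<partial>P"
  let ?\<kappa> = "(1 - exp (-1)) ^ k :: real"
  interpret P: prob_space P by fact
  interpret R: prob_space R using R by (simp add: poisson_point_process_def)
  interpret Q: prob_space ?Q by (intro prob_space_PiM R.prob_space_axioms)
  have sR: "sets R = sets (PiM UNIV (\<lambda>_. ?M))" using R by (simp add: poisson_point_process_def)
  have fi: "integrable P f" using f1 f0 by (intro integrableI_nonneg) auto
  have ifi: "integrable P (\<lambda>h. indicator C h * f h)" if "C \<in> sets P" for C
    using integrable_mult_indicator[OF that fi] by (simp add: mult.commute)
  have em: "emeasure ?M (region C f) = ennreal (?I C)" if "C \<in> sets P" for C
    unfolding emeasure_region[OF f f0 that]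
    by (rule nn_integral_eq_integral[OF ifi[OF that]]) (use f0 in auto)
  have I0: "0 \<le> ?I C" for C using f0 by (intro integral_nonneg_AE) auto
  have me: "measure ?M (region C f) = ?I C" if "C \<in> sets P" for C
    using em[OF that] I0 by (simp add: measure_def)
  have I1: "?I (space P) = 1"
  proof -
    have "?I (space P) = (\<integral>h. f h \<partial>P)" by (intro Bochner_Integration.integral_cong) auto
    also have "\<dots> = 1" using f1 f0 by (subst integral_eq_nn_integral) auto
    finally show ?thesis .
  qed
  let ?B = "region (space P) f"
  have B: "?B \<in> sets ?M" by (rule sets_region[OF f f0]) simp
  define S where "S = {r \<in> space R. num_points r ?B = 1}"
  have S: "S \<in> sets R" unfolding S_def using num_points_measurable[OF B sR] by measurable
  have sm: "?s \<in> ?Q \<rightarrow>\<^sub>M P"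
    using measurable_compose[OF measurable_Pair1'[of "()" "count_space {()}" ?Q] poisson_sample_measurable[of "\<lambda>_. f" "count_space {()}" P h0 R k]]
      measurable_compose[OF measurable_snd f, of "count_space {()}"] h0 sR
    by (simp add: split_beta)
  have lower: "(1 - ?\<kappa>) * ?I C \<le> measure ?Q {\<omega> \<in> space ?Q. ?s \<omega> \<in> C}" if C: "C \<in> sets P" for C
  proof -
    define T where "T = {r \<in> space R. num_points r ?B = 1 \<and> num_points r (region C f) = 1}"
    have BC: "region C f \<subseteq> ?B" using sets.sets_into_space[OF C] by (auto simp: region_def)
    have sC: "region C f \<in> sets ?M" by (rule sets_region[OF f f0 C])
    show ?thesis
    proof (rule iid_first_success)
      show "prob_space R" by (rule R.prob_space_axioms)
      show "S \<in> sets R" by fact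
      show "T \<in> sets R" unfolding T_def
        using num_points_measurable[OF B sR] num_points_measurable[OF sC sR] by measurable
      show "T \<subseteq> S" by (auto simp: T_def S_def)
      have fB: "emeasure ?M ?B < \<infinity>" by (simp add: em)
      \<comment> \<open>A region of mass 1 holds exactly one point with probability
        \<open>exp (-1)\<close>, and given this the point falls into \<open>region C f\<close> with
        probability \<open>?I C\<close>.\<close>
      from poisson_single_point[OF R B fB sC BC] show "measure R T = exp (-1) * ?I C"
        unfolding T_def me[OF C] me[OF sets.top] I1 by (simp add: mult.commute)
      from poisson_single_point[OF R B fB B] show "measure R S = exp (-1)"
        unfolding S_def me[OF sets.top] I1 by simp
      show "{\<omega> \<in> space ?Q. ?s \<omega> \<in> C} \<in> sets ?Q" using measurable_sets[OF sm C] by (simp add: vimage_def Int_def conj_commute)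
      fix j \<omega> assume j: "j < k" and \<omega>: "\<omega> \<in> space ?Q" "\<omega> j \<in> T" "\<And>i. i < j \<Longrightarrow> \<omega> i \<notin> S"
      have "first_success k (\<lambda>j. num_points (\<omega> j) ?B = 1) = j"
      proof (rule first_success_eq[OF j])
        show "num_points (\<omega> j) ?B = 1" using \<omega> by (simp add: T_def)
        show "num_points (\<omega> i) ?B \<noteq> 1" if "i < j" for i
        proof -
          have "\<omega> i \<in> space R" using \<omega>(1) that j by (auto simp: space_PiM PiE_iff)
          then show ?thesis using \<omega>(3)[OF that] by (simp add: S_def)
        qed
      qed
      then have "?s \<omega> = fst (\<omega> j (LEAST i. \<omega> j i \<in> ?B))" using j by (simp add: poisson_sample_def)
      moreover have "\<omega> j (LEAST i. \<omega> j i \<in> ?B) \<in> region C f"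
        using \<omega>(2) num_points_eq_1_Least[OF _ BC, of "\<omega> j"] by (simp add: T_def)
      ultimately show "\<omega> \<in> {\<omega> \<in> space ?Q. ?s \<omega> \<in> C}" using \<omega>(1) by (auto simp: region_def)
    qed
  qed
  have \<kappa>: "0 \<le> ?\<kappa>" by simp
  have compl_I: "?I (space P - C) = 1 - ?I C"
  proof -
    have "?I (space P - C) = (\<integral>h. indicator (space P) h * f h - indicator C h * f h \<partial>P)"
      by (intro Bochner_Integration.integral_cong) (auto simp: indicator_def)
    then show ?thesis using I1 by (simp add: ifi)
  qed
  have compl: "measure ?Q {\<omega> \<in> space ?Q. ?s \<omega> \<in> space P - C} = 1 - measure ?Q {\<omega> \<in> space ?Q. ?s \<omega> \<in> C}"
  proof -
    have "{\<omega> \<in> space ?Q. ?s \<omega> \<in> space P - C} = space ?Q - {\<omega> \<in> space ?Q. ?s \<omega> \<in> C}"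
      using measurable_space[OF sm] by auto
    moreover have "{\<omega> \<in> space ?Q. ?s \<omega> \<in> C} \<in> sets ?Q" using measurable_sets[OF sm C] by (simp add: vimage_def Int_def conj_commute)
    ultimately show ?thesis by (simp add: Q.prob_compl)
  qed
  have Ile: "?I C \<le> 1" using compl_I I0[of "space P - C"] by simp
  have "?I C - ?\<kappa> \<le> (1 - ?\<kappa>) * ?I C"
    using mult_left_mono[OF Ile \<kappa>] by (simp add: algebra_simps)
  moreover have "1 - ?I C - ?\<kappa> \<le> (1 - ?\<kappa>) * (1 - ?I C)"
    using mult_nonneg_nonneg[OF \<kappa> I0[of C]] by (simp add: algebra_simps)
  ultimately show ?thesis
    using lower[OF C] lower[of "space P - C"] compl compl_I by (simp add: abs_le_iff)
qed

section \<open>Averages over independent samples\<close>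

lemma prob_space_iid: "prob_space D \<Longrightarrow> prob_space (iid m D)"
  by (intro prob_space_PiM)

lemma indep_vars_iid_coordinates:
  assumes D: "prob_space D"
  shows "prob_space.indep_vars (iid m D) (\<lambda>_. D) (\<lambda>i S. S i) {..<m}"
proof -
  interpret product_prob_space "\<lambda>_. D" "{..<m}" by (intro product_prob_spaceI D)
  show ?thesis
  proof (cases "m = 0")
    \<comment> \<open>The description of independence by a product law, used in the other case, is
      for nonempty index sets.\<close>
    case True
    then show ?thesis unfolding P.indep_vars_def P.indep_sets_def by auto
  next
    case False
    have "distr (iid m D) (iid m D) (\<lambda>S. \<lambda>i\<in>{..<m}. S i) = distr (iid m D) (iid m D) (\<lambda>S. S)"
      by (rule distr_cong) (auto simp: space_PiM PiE_iff extensional_restrict)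
    also have "\<dots> = iid m D" by (rule distr_id)
    also have "\<dots> = (\<Pi>\<^sub>M i\<in>{..<m}. distr (iid m D) D (\<lambda>S. S i))"
      by (intro PiM_cong refl PiM_component[symmetric])
    finally show ?thesis
      using False by (subst P.indep_vars_iff_distr_eq_PiM') auto
  qed
qed

lemma distr_iid_block:
  assumes D: "prob_space D" and le: "o' + b \<le> m"
  shows "distr (iid m D) (iid b D) (\<lambda>S. \<lambda>j\<in>{..<b}. S (o' + j)) = iid b D"
  using distr_PiM_reindex[of "{..<m}" "\<lambda>_. D" "\<lambda>j. o' + j" "{..<b}"] assms by auto

lemma distr_iid_split:
  assumes D: "prob_space D"
  shows "distr (iid (a + b) D) (iid a D \<Otimes>\<^sub>M iid b D)
      (\<lambda>S. (\<lambda>j\<in>{..<a}. S j, \<lambda>j\<in>{..<b}. S (a + j))) = iid a D \<Otimes>\<^sub>M iid b D"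
proof -
  let ?M = "iid (a + b) D"
  interpret prob_space ?M by (rule prob_space_iid[OF D])
  let ?r = "\<lambda>S. \<lambda>j\<in>{..<b}. S (a + j)"
  have "indep_var (PiM {..<a} (\<lambda>_. D)) (\<lambda>S. restrict (\<lambda>i. S i) {..<a})
      (PiM {a..<a + b} (\<lambda>_. D)) (\<lambda>S. restrict (\<lambda>i. S i) {a..<a + b})"
    by (rule indep_var_restrict[OF indep_vars_iid_coordinates[OF D]]) auto
  then have *: "indep_var (iid a D) (id \<circ> (\<lambda>S. restrict (\<lambda>i. S i) {..<a}))
      (iid b D) (?r \<circ> (\<lambda>S. restrict (\<lambda>i. S i) {a..<a + b}))"
  proof (rule indep_var_compose)
    show "?r \<in> PiM {a..<a + b} (\<lambda>_. D) \<rightarrow>\<^sub>M iid b D"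
      by (intro measurable_restrict measurable_component_singleton) auto
  qed simp
  have r: "?r \<circ> (\<lambda>S. restrict (\<lambda>i. S i) {a..<a + b}) = ?r"
    by (auto simp: fun_eq_iff restrict_def)
  have "distr ?M (iid a D) (\<lambda>S. \<lambda>j\<in>{..<a}. S j) \<Otimes>\<^sub>M distr ?M (iid b D) ?r =
      distr ?M (iid a D \<Otimes>\<^sub>M iid b D) (\<lambda>S. (\<lambda>j\<in>{..<a}. S j, ?r S))"
    using *[unfolded r id_comp indep_var_distribution_eq] by blast
  then show ?thesis
    using distr_iid_block[OF D, of 0 a "a + b"] distr_iid_block[OF D, of a b "a + b"] by simp
qed

text \<open>Coordinates over disjoint intervals of indices are independent, and shifting each
  interval back to \<open>{..<b}\<close> makes the blocks identically distributed. This turns the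
  single sample of the learner into \<open>K\<close> independent experiments.\<close>

lemma distr_iid_blocks:
  assumes D: "prob_space D" and K: "0 < K"
  shows "distr (iid (K * b) D) (iid K (iid b D)) (\<lambda>S. \<lambda>i\<in>{..<K}. \<lambda>j\<in>{..<b}. S (i * b + j)) = iid K (iid b D)"
proof -
  let ?M = "iid (K * b) D"
  interpret prob_space ?M by (rule prob_space_iid[OF D])
  have sub: "i * b + b \<le> K * b" if "i < K" for i
    using mult_le_mono1[of "Suc i" K b] that by simp
  have "disjoint_family_on (\<lambda>i. {i * b..<i * b + b}) {..<K}"
  proof -
    have "{i * b..<i * b + b} \<inter> {j * b..<j * b + b} = {}" if "i < j" for i j
      using mult_le_mono1[of "Suc i" j b] that by auto
    then show ?thesis unfolding disjoint_family_on_def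
      by (metis Int_commute linorder_neqE_nat)
  qed
  then have "indep_vars (\<lambda>i. PiM {i * b..<i * b + b} (\<lambda>_. D)) (\<lambda>i S. restrict (\<lambda>j. S j) {i * b..<i * b + b}) {..<K}"
    using sub by (intro indep_vars_restrict[OF indep_vars_iid_coordinates[OF D]]) force+
  then have *: "indep_vars (\<lambda>i. iid b D)
      (\<lambda>i. (\<lambda>S. \<lambda>j\<in>{..<b}. S (i * b + j)) \<circ> (\<lambda>S. restrict (\<lambda>j. S j) {i * b..<i * b + b})) {..<K}"
  proof (rule indep_vars_compose)
    show "(\<lambda>S. \<lambda>j\<in>{..<b}. S (i * b + j)) \<in> PiM {i * b..<i * b + b} (\<lambda>_. D) \<rightarrow>\<^sub>M iid b D" for i
      by (intro measurable_restrict measurable_component_singleton) auto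
  qed
  have r: "(\<lambda>S. \<lambda>j\<in>{..<b}. S (i * b + j)) \<circ> (\<lambda>S. restrict (\<lambda>j. S j) {i * b..<i * b + b}) =
      (\<lambda>S. \<lambda>j\<in>{..<b}. S (i * b + j))" for i
    by (auto simp: fun_eq_iff restrict_def)
  have ind: "indep_vars (\<lambda>i. iid b D) (\<lambda>i S. \<lambda>j\<in>{..<b}. S (i * b + j)) {..<K}"
    using *[unfolded r] .
  have "distr ?M (iid K (iid b D)) (\<lambda>S. \<lambda>i\<in>{..<K}. \<lambda>j\<in>{..<b}. S (i * b + j)) =
      (\<Pi>\<^sub>M i\<in>{..<K}. distr ?M (iid b D) (\<lambda>S. \<lambda>j\<in>{..<b}. S (i * b + j)))"
    using K ind sub by (subst indep_vars_iff_distr_eq_PiM'[symmetric])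
      (auto simp: indep_vars_def)
  also have "\<dots> = iid K (iid b D)"
    by (intro PiM_cong refl distr_iid_block[OF D] sub) auto
  finally show ?thesis .
qed

text \<open>After centring, the cross terms of the expanded square vanish by independence; the
  \<open>K\<close> diagonal terms are at most \<open>c\<close>, as a variance is at most the second
  moment.\<close>

lemma
  fixes f :: "'a \<Rightarrow> real"
  assumes M: "prob_space M" and f[measurable]: "f \<in> borel_measurable M"
    and f2: "integrable M (\<lambda>x. (f x)\<^sup>2)" and c: "(\<integral>x. (f x)\<^sup>2 \<partial>M) \<le> c" and K: "0 < K"
  shows iid_average_integrable: "integrable (iid K M) (\<lambda>\<omega>. ((\<Sum>i<K. f (\<omega> i)) / K - (\<integral>x. f x \<partial>M))\<^sup>2)"
    and iid_average_variance:
      "(\<integral>\<omega>. ((\<Sum>i<K. f (\<omega> i)) / K - (\<integral>x. f x \<partial>M))\<^sup>2 \<partial>iid K M) \<le> c / K"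
proof -
  interpret product_prob_space "\<lambda>_. M" "{..<K}" by (intro product_prob_spaceI M)
  interpret M: prob_space M by fact
  let ?m = "\<integral>x. f x \<partial>M"
  define g where "g = (\<lambda>x. f x - ?m)"
  have fi: "integrable M f" by (rule M.square_integrable_imp_integrable[OF f f2])
  have gi: "integrable M g" using fi by (auto simp: g_def)
  have gm: "g \<in> borel_measurable M" using gi by auto
  have g2: "integrable M (\<lambda>x. (g x)\<^sup>2)" using fi f2 by (auto simp: g_def power2_diff)
  have Eg: "(\<integral>x. g x \<partial>M) = 0" using fi by (simp add: g_def M.prob_space)
  have Eg2: "(\<integral>x. (g x)\<^sup>2 \<partial>M) \<le> c"
    using M.variance_eq[OF fi f2] c by (simp add: g_def) (smt (verit) zero_le_power2)
  \<comment> \<open>Writes \<open>g (\<omega> i) * g (\<omega> j)\<close> as a product over all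
    coordinates, one factor each, so that the integral of a product over a product measure applies
    to the diagonal and the cross terms alike.\<close>
  let ?\<phi> = "\<lambda>i j l. if i = j \<and> l = i then (\<lambda>x. (g x)\<^sup>2) else if l = i \<or> l = j then g else (\<lambda>_. 1)"
  have phi: "integrable M (?\<phi> i j l)" for i j l :: nat using gi g2 by auto
  have prod: "(\<Prod>l<K. ?\<phi> i j l (\<omega> l)) = g (\<omega> i) * g (\<omega> j)" if "i < K" "j < K" for i j :: nat and \<omega>
  proof (cases "i = j")
    case True
    have "(\<Prod>l<K. ?\<phi> i j l (\<omega> l)) = (\<Prod>l\<in>{i}. ?\<phi> i j l (\<omega> l))"
      using that True by (intro prod.mono_neutral_right) auto
    then show ?thesis using True by (simp add: power2_eq_square)
  next
    case False
    have "(\<Prod>l<K. ?\<phi> i j l (\<omega> l)) = (\<Prod>l\<in>{i, j}. ?\<phi> i j l (\<omega> l))"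
      using that False by (intro prod.mono_neutral_right) auto
    then show ?thesis using False by simp
  qed
  have int: "integrable (iid K M) (\<lambda>\<omega>. g (\<omega> i) * g (\<omega> j))" if "i < K" "j < K" for i j
    using product_integrable_prod[of "{..<K}" "?\<phi> i j"] phi prod[OF that] by simp
  have Eij: "(\<integral>\<omega>. g (\<omega> i) * g (\<omega> j) \<partial>iid K M) = (if i = j then (\<integral>x. (g x)\<^sup>2 \<partial>M) else 0)"
    if "i < K" "j < K" for i j
  proof -
    have "(\<integral>\<omega>. g (\<omega> i) * g (\<omega> j) \<partial>iid K M) = (\<Prod>l<K. integral\<^sup>L M (?\<phi> i j l))"
      using product_integral_prod[of "{..<K}" "?\<phi> i j"] phi prod[OF that] by simp
    also have "\<dots> = (if i = j then (\<integral>x. (g x)\<^sup>2 \<partial>M) else 0)"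
    proof (cases "i = j")
      case True
      have "(\<Prod>l<K. integral\<^sup>L M (?\<phi> i j l)) = (\<Prod>l\<in>{i}. integral\<^sup>L M (?\<phi> i j l))"
        using that True by (intro prod.mono_neutral_right) (auto simp: M.prob_space)
      then show ?thesis using True by simp
    next
      case False
      then show ?thesis using that Eg by (auto intro!: bexI[of _ i])
    qed
    finally show ?thesis .
  qed
  have eq: "((\<Sum>i<K. f (\<omega> i)) / K - ?m)\<^sup>2 = (\<Sum>i<K. \<Sum>j<K. g (\<omega> i) * g (\<omega> j)) / (real K)\<^sup>2" for \<omega>
  proof -
    have "(\<Sum>i<K. f (\<omega> i)) / K - ?m = (\<Sum>i<K. g (\<omega> i)) / K"
      using K by (simp add: g_def sum_subtractf field_simps)
    then show ?thesis by (simp add: power_divide power2_eq_square sum_product)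
  qed
  show "integrable (iid K M) (\<lambda>\<omega>. ((\<Sum>i<K. f (\<omega> i)) / K - ?m)\<^sup>2)"
    unfolding eq by (intro Bochner_Integration.integrable_divide Bochner_Integration.integrable_sum int) auto
  have "(\<integral>\<omega>. ((\<Sum>i<K. f (\<omega> i)) / K - ?m)\<^sup>2 \<partial>iid K M) =
      (\<Sum>i<K. \<Sum>j<K. \<integral>\<omega>. g (\<omega> i) * g (\<omega> j) \<partial>iid K M) / (real K)\<^sup>2"
  proof -
    have "(\<integral>\<omega>. (\<Sum>i<K. \<Sum>j<K. g (\<omega> i) * g (\<omega> j)) \<partial>iid K M) = (\<Sum>i<K. \<integral>\<omega>. (\<Sum>j<K. g (\<omega> i) * g (\<omega> j)) \<partial>iid K M)"
      by (intro Bochner_Integration.integral_sum Bochner_Integration.integrable_sum int) auto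
    also have "\<dots> = (\<Sum>i<K. \<Sum>j<K. \<integral>\<omega>. g (\<omega> i) * g (\<omega> j) \<partial>iid K M)"
      by (intro sum.cong refl Bochner_Integration.integral_sum int) auto
    finally show ?thesis unfolding eq by simp
  qed
  also have "(\<Sum>i<K. \<Sum>j<K. \<integral>\<omega>. g (\<omega> i) * g (\<omega> j) \<partial>iid K M) = (\<Sum>i<K. \<integral>x. (g x)\<^sup>2 \<partial>M)"
  proof (intro sum.cong refl)
    fix i assume "i \<in> {..<K}"
    then have "(\<Sum>j<K. \<integral>\<omega>. g (\<omega> i) * g (\<omega> j) \<partial>iid K M) = (\<Sum>j<K. if i = j then (\<integral>x. (g x)\<^sup>2 \<partial>M) else 0)"
      by (intro sum.cong) (auto simp: Eij)
    then show "(\<Sum>j<K. \<integral>\<omega>. g (\<omega> i) * g (\<omega> j) \<partial>iid K M) = (\<integral>x. (g x)\<^sup>2 \<partial>M)"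
      using \<open>i \<in> {..<K}\<close> by simp
  qed
  also have "\<dots> / (real K)\<^sup>2 = (\<integral>x. (g x)\<^sup>2 \<partial>M) / K" using K by (simp add: power2_eq_square)
  also have "\<dots> \<le> c / K" using Eg2 by (intro divide_right_mono) auto
  finally show "(\<integral>\<omega>. ((\<Sum>i<K. f (\<omega> i)) / K - ?m)\<^sup>2 \<partial>iid K M) \<le> c / K" .
qed

lemma iid_average_L1:
  fixes f :: "'a \<Rightarrow> real"
  assumes M: "prob_space M" and f[measurable]: "f \<in> borel_measurable M"
    and c: "(\<integral>\<^sup>+x. ennreal ((f x)\<^sup>2) \<partial>M) \<le> ennreal (c\<^sup>2)" and c0: "0 \<le> c" and K: "0 < K"
  shows "(\<integral>\<^sup>+\<omega>. ennreal \<bar>(\<Sum>i<K. f (\<omega> i)) / K - (\<integral>x. f x \<partial>M)\<bar> \<partial>iid K M) \<le> ennreal (c / sqrt K)"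
proof -
  interpret M: prob_space M by fact
  interpret Q: prob_space "iid K M" by (rule prob_space_iid[OF M])
  let ?X = "\<lambda>\<omega>. (\<Sum>i<K. f (\<omega> i)) / K - (\<integral>x. f x \<partial>M)"
  have f2: "integrable M (\<lambda>x. (f x)\<^sup>2)"
    by (rule integrableI_nonneg) (use c in \<open>auto intro: le_less_trans\<close>)
  have f2c: "(\<integral>x. (f x)\<^sup>2 \<partial>M) \<le> c\<^sup>2"
  proof -
    have "ennreal (\<integral>x. (f x)\<^sup>2 \<partial>M) \<le> ennreal (c\<^sup>2)"
      using c by (subst nn_integral_eq_integral[symmetric, OF f2]) auto
    then show ?thesis by simp
  qed
  have [measurable]: "?X \<in> borel_measurable (iid K M)" by measurable
  note X2 = iid_average_integrable[OF M f f2 f2c K] iid_average_variance[OF M f f2 f2c K]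
  have Xi: "integrable (iid K M) ?X"
    by (rule Q.square_integrable_imp_integrable[OF _ X2(1)]) measurable
  \<comment> \<open>Cauchy-Schwarz, in the form that the variance of
    \<open>\<bar>?X \<omega>\<bar>\<close> is nonnegative.\<close>
  have "(\<integral>\<omega>. \<bar>?X \<omega>\<bar> \<partial>iid K M)\<^sup>2 \<le> (\<integral>\<omega>. (?X \<omega>)\<^sup>2 \<partial>iid K M)"
  proof -
    have "0 \<le> (\<integral>\<omega>. \<bar>?X \<omega>\<bar>\<^sup>2 \<partial>iid K M) - (\<integral>\<omega>. \<bar>?X \<omega>\<bar> \<partial>iid K M)\<^sup>2"
      using Q.variance_eq[of "\<lambda>\<omega>. \<bar>?X \<omega>\<bar>"] Q.variance_positive[of "\<lambda>\<omega>. \<bar>?X \<omega>\<bar>"] Xi X2(1) by simp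
    then show ?thesis by simp
  qed
  also have "\<dots> \<le> (c / sqrt K)\<^sup>2" using X2(2) by (simp add: power_divide)
  finally have "(\<integral>\<omega>. \<bar>?X \<omega>\<bar> \<partial>iid K M) \<le> c / sqrt K"
    by (rule power2_le_imp_le) (use c0 in auto)
  then show ?thesis
    using Xi by (subst nn_integral_eq_integral) (auto intro: ennreal_leI)
qed

text \<open>Chebyshev's inequality, with 1 bounding the second moment of an indicator.\<close>

lemma iid_frequency_deviation:
  assumes M: "prob_space M" and A[measurable]: "A \<in> sets M" and K: "0 < K" and a: "0 < a"
  shows "measure (iid K M) {\<omega> \<in> space (iid K M). a \<le> \<bar>(\<Sum>i<K. indicator A (\<omega> i)) / K - measure M A\<bar>}
    \<le> 1 / (K * a\<^sup>2)"
proof -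
  interpret M: prob_space M by fact
  interpret Q: prob_space "iid K M" by (rule prob_space_iid[OF M])
  let ?f = "indicator A :: _ \<Rightarrow> real"
  let ?X = "\<lambda>\<omega>. (\<Sum>i<K. ?f (\<omega> i)) / K - measure M A"
  have f2: "integrable M (\<lambda>x. (?f x)\<^sup>2)" by (intro M.integrable_const_bound[of _ 1]) (auto split: split_indicator)
  have "(\<integral>x. (?f x)\<^sup>2 \<partial>M) \<le> (\<integral>x. 1 \<partial>M)" using f2 by (intro integral_mono) (auto simp: indicator_def)
  then have f1: "(\<integral>x. (?f x)\<^sup>2 \<partial>M) \<le> 1" by (simp add: M.prob_space)
  have m: "(\<integral>x. ?f x \<partial>M) = measure M A" by simp
  note X2 = iid_average_integrable[OF M _ f2 f1 K, unfolded m] iid_average_variance[OF M _ f2 f1 K, unfolded m]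
  have "measure (iid K M) {\<omega> \<in> space (iid K M). a\<^sup>2 \<le> (?X \<omega>)\<^sup>2} \<le> (\<integral>\<omega>. (?X \<omega>)\<^sup>2 \<partial>iid K M) / a\<^sup>2"
    using a X2(1) by (intro integral_Markov_inequality_measure[of _ _ "{}"]) auto
  also have "\<dots> \<le> 1 / K / a\<^sup>2" using X2(2) by (intro divide_right_mono) auto
  finally show ?thesis using a by (simp add: abs_le_square_iff[symmetric])
qed

section \<open>Overlap of the output distributions\<close>

lemma AE_pair_fst:
  assumes "sigma_finite_measure M" "AE x in N. Q x"
  shows "AE z in N \<Otimes>\<^sub>M M. Q (fst z)"
proof -
  interpret sigma_finite_measure M by fact
  obtain Z where Z: "Z \<in> null_sets N" "{x \<in> space N. \<not> Q x} \<subseteq> Z" using assms(2) by (rule AE_E3) auto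
  then have "Z \<times> space M \<in> null_sets (N \<Otimes>\<^sub>M M)"
    by (auto simp: null_sets_def emeasure_pair_measure_Times)
  then show ?thesis by (rule AE_I') (use Z in \<open>auto simp: space_pair_measure\<close>)
qed

lemma AE_pair_snd:
  assumes "sigma_finite_measure M" "AE x in M. Q x"
  shows "AE z in N \<Otimes>\<^sub>M M. Q (snd z)"
proof -
  interpret sigma_finite_measure M by fact
  obtain Z where Z: "Z \<in> null_sets M" "{x \<in> space M. \<not> Q x} \<subseteq> Z" using assms(2) by (rule AE_E3) auto
  then have "space N \<times> Z \<in> null_sets (N \<Otimes>\<^sub>M M)"
    by (auto simp: null_sets_def emeasure_pair_measure_Times)
  then show ?thesis by (rule AE_I') (use Z in \<open>auto simp: space_pair_measure\<close>)
qed

lemma tv_dist_ge: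
  assumes "prob_space M" "prob_space N" "B \<in> sets M"
  shows "\<bar>measure M B - measure N B\<bar> \<le> tv_dist M N"
  unfolding tv_dist_def
proof (rule cSUP_upper[OF assms(3)])
  interpret M: prob_space M by fact
  interpret N: prob_space N by fact
  show "bdd_above ((\<lambda>B. \<bar>measure M B - measure N B\<bar>) ` sets M)"
  proof (rule bdd_aboveI2[where M=1])
    show "\<bar>measure M B - measure N B\<bar> \<le> 1" for B
      using M.prob_le_1[of B] N.prob_le_1[of B] measure_nonneg[of M B] measure_nonneg[of N B] by linarith
  qed
qed

lemma tv_dist_le:
  assumes "\<And>B. B \<in> sets M \<Longrightarrow> \<bar>measure M B - measure N B\<bar> \<le> c"
  shows "tv_dist M N \<le> c"
  unfolding tv_dist_def using assms by (intro cSUP_least) auto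

text \<open>On \<open>B\<close>, where \<open>f1 \<le> f2\<close>, the minimum integrates to about
  \<open>measure M1 B\<close>, and off \<open>B\<close> to about \<open>1 - measure M2 B\<close>.
  Their sum falls short of 1 by a difference of probabilities, which the total variation distance
  bounds; each approximation costs one \<open>\<eta>\<close>.\<close>

lemma overlap_lower_bound:
  fixes f1 f2 :: "'a \<Rightarrow> real"
  assumes "prob_space M1" "prob_space M2" "sets M1 = sets P" "sets M2 = sets P"
    and f: "integrable P f1" "integrable P f2" "\<And>h. 0 \<le> f1 h" "\<And>h. 0 \<le> f2 h"
    and a1: "\<And>B. B \<in> sets P \<Longrightarrow> \<bar>measure M1 B - (\<integral>h. indicator B h * f1 h \<partial>P)\<bar> \<le> \<eta>"
    and a2: "\<And>B. B \<in> sets P \<Longrightarrow> \<bar>measure M2 B - (\<integral>h. indicator B h * f2 h \<partial>P)\<bar> \<le> \<eta>"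
  shows "1 - 2 * \<eta> \<le> tv_dist M1 M2 + (\<integral>h. min (f1 h) (f2 h) \<partial>P)"
proof -
  interpret M1: prob_space M1 by fact
  interpret M2: prob_space M2 by fact
  have [measurable]: "f1 \<in> borel_measurable P" "f2 \<in> borel_measurable P" using f by auto
  define B where "B = {h \<in> space P. f1 h \<le> f2 h}"
  have B: "B \<in> sets P" unfolding B_def by measurable
  let ?C = "space P - B"
  have C: "?C \<in> sets P" using B by auto
  have int: "integrable P (\<lambda>h. indicator A h * f h)" if "A \<in> sets P" "integrable P f" for A and f :: "'a \<Rightarrow> real"
    using integrable_mult_indicator[OF that] by simp
  have "(\<integral>h. min (f1 h) (f2 h) \<partial>P) = (\<integral>h. indicator B h * f1 h + indicator ?C h * f2 h \<partial>P)"
    by (intro Bochner_Integration.integral_cong) (auto simp: B_def indicator_def)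
  also have "\<dots> = (\<integral>h. indicator B h * f1 h \<partial>P) + (\<integral>h. indicator ?C h * f2 h \<partial>P)"
    using f B C by (intro Bochner_Integration.integral_add int) auto
  finally have "(\<integral>h. min (f1 h) (f2 h) \<partial>P) \<ge> measure M1 B - \<eta> + (measure M2 ?C - \<eta>)"
    using a1[OF B] a2[OF C] by linarith
  moreover have "measure M2 ?C = 1 - measure M2 B"
    using M2.prob_compl[of B] B assms(4) sets_eq_imp_space_eq[OF assms(4)] by simp
  moreover have "\<bar>measure M1 B - measure M2 B\<bar> \<le> tv_dist M1 M2"
    using B assms by (intro tv_dist_ge) auto
  ultimately show ?thesis by linarith
qed

text \<open>The loss \<open>3 * \<eta>\<close> consists of \<open>2 * \<eta>\<close> from
  \<open>overlap_lower_bound\<close> and one \<open>\<eta>\<close> from measuring \<open>bad\<close>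
  by densities: the overlap on \<open>bad\<close> is at most a single density there, whose mean mass
  is about the probability of a bad output. The integral over \<open>h\<close> is outermost because
  the later estimates are made at each \<open>h\<close>.\<close>

lemma
  fixes d :: "'s \<Rightarrow> 'h \<Rightarrow> real"
  assumes N: "prob_space N" and P: "prob_space P" and sP: "sets P = sets H"
    and A: "A \<in> N \<rightarrow>\<^sub>M prob_algebra H"
    and d: "case_prod d \<in> borel_measurable (N \<Otimes>\<^sub>M P)" "\<And>S h. 0 \<le> d S h" "\<And>S. S \<in> space N \<Longrightarrow> integrable P (d S)"
    and approx: "AE S in N. \<forall>B\<in>sets H. \<bar>measure (A S) B - (\<integral>h. indicator B h * d S h \<partial>P)\<bar> \<le> \<eta>"
    and \<eta>: "0 \<le> \<eta>"
  shows density_total_mass: "(\<integral>\<^sup>+h. \<integral>\<^sup>+S. ennreal (d S h) \<partial>N \<partial>P) \<le> ennreal (1 + \<eta>)"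
    and overlap_mass: "\<lbrakk>(\<integral>\<^sup>+(S, S'). ennreal (tv_dist (A S) (A S')) \<partial>(N \<Otimes>\<^sub>M N)) \<le> ennreal \<rho>;
      measure (N \<bind> A) bad \<le> \<beta>; bad \<in> sets H; 0 \<le> \<rho>; 0 \<le> \<beta>\<rbrakk> \<Longrightarrow>
      ennreal (1 - \<rho> - \<beta> - 3 * \<eta>) \<le>
      (\<integral>\<^sup>+h. indicator (space P - bad) h * (\<integral>\<^sup>+z. ennreal (min (d (fst z) h) (d (snd z) h)) \<partial>(N \<Otimes>\<^sub>M N)) \<partial>P)"
proof -
  interpret N: prob_space N by fact
  interpret P: prob_space P by fact
  interpret NN: pair_prob_space N N ..
  interpret NP: pair_sigma_finite N P ..
  interpret NNP: pair_sigma_finite "N \<Otimes>\<^sub>M N" P ..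
  note [measurable] = d(1)
  have spP: "space P = space H" by (rule sets_eq_imp_space_eq[OF sP])
  have AS: "prob_space (A S)" "sets (A S) = sets P" if "S \<in> space N" for S
    using measurable_space[OF A that] sP by (auto simp: space_prob_algebra)
  have mass: "(\<integral>\<^sup>+h. indicator B h * (\<integral>\<^sup>+S. ennreal (d S h) \<partial>N) \<partial>P) = (\<integral>\<^sup>+S. ennreal (\<integral>h. indicator B h * d S h \<partial>P) \<partial>N)"
    if B[measurable]: "B \<in> sets P" for B
  proof -
    have "(\<integral>\<^sup>+h. indicator B h * (\<integral>\<^sup>+S. ennreal (d S h) \<partial>N) \<partial>P) = (\<integral>\<^sup>+h. \<integral>\<^sup>+S. indicator B h * ennreal (d S h) \<partial>N \<partial>P)"
      by (intro nn_integral_cong nn_integral_cmult[symmetric]) measurable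
    also have "\<dots> = (\<integral>\<^sup>+S. \<integral>\<^sup>+h. indicator B h * ennreal (d S h) \<partial>P \<partial>N)"
      by (rule NP.Fubini') measurable
    also have "\<dots> = (\<integral>\<^sup>+S. ennreal (\<integral>h. indicator B h * d S h \<partial>P) \<partial>N)"
    proof (rule nn_integral_cong)
      fix S assume S: "S \<in> space N"
      have "integrable P (\<lambda>h. indicator B h * d S h)"
        using integrable_mult_indicator[OF B d(3)[OF S]] by simp
      then show "(\<integral>\<^sup>+h. indicator B h * ennreal (d S h) \<partial>P) = ennreal (\<integral>h. indicator B h * d S h \<partial>P)"
        by (subst nn_integral_eq_integral[symmetric])
           (use d(2) in \<open>auto intro!: nn_integral_cong simp: indicator_def\<close>)
    qed
    finally show ?thesis .
  qed
  show "(\<integral>\<^sup>+h. \<integral>\<^sup>+S. ennreal (d S h) \<partial>N \<partial>P) \<le> ennreal (1 + \<eta>)"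
  proof -
    have "(\<integral>\<^sup>+h. \<integral>\<^sup>+S. ennreal (d S h) \<partial>N \<partial>P) = (\<integral>\<^sup>+S. ennreal (\<integral>h. indicator (space P) h * d S h \<partial>P) \<partial>N)"
      by (subst mass[symmetric]) (auto intro!: nn_integral_cong)
    also have "\<dots> \<le> (\<integral>\<^sup>+S. ennreal (1 + \<eta>) \<partial>N)"
    proof (rule nn_integral_mono_AE)
      show "AE S in N. ennreal (\<integral>h. indicator (space P) h * d S h \<partial>P) \<le> ennreal (1 + \<eta>)"
        using approx AE_space
      proof eventually_elim
        case (elim S)
        then have "\<bar>measure (A S) (space P) - (\<integral>h. indicator (space P) h * d S h \<partial>P)\<bar> \<le> \<eta>"
          using sP sets.top[of P] by auto
        then show ?case
          using prob_space.prob_le_1[OF AS(1)[OF elim(2)], of "space P"] by (intro ennreal_leI) linarith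
      qed
    qed
    finally show ?thesis by (simp add: N.emeasure_space_1)
  qed
  assume tv: "(\<integral>\<^sup>+(S, S'). ennreal (tv_dist (A S) (A S')) \<partial>(N \<Otimes>\<^sub>M N)) \<le> ennreal \<rho>"
    and acc: "measure (N \<bind> A) bad \<le> \<beta>" and bad: "bad \<in> sets H" and nonneg: "0 \<le> \<rho>" "0 \<le> \<beta>"
  have badP[measurable]: "bad \<in> sets P" using bad sP by simp
  let ?m = "\<lambda>S S' h. ennreal (min (d S h) (d S' h))"
  let ?g = "\<lambda>h. \<integral>\<^sup>+z. ?m (fst z) (snd z) h \<partial>(N \<Otimes>\<^sub>M N)"
  have m1[measurable]: "(\<lambda>(z, h). ?m (fst z) (snd z) h) \<in> borel_measurable ((N \<Otimes>\<^sub>M N) \<Otimes>\<^sub>M P)" by measurable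
  have total: "ennreal (1 - 2 * \<eta>) \<le> ennreal \<rho> + (\<integral>\<^sup>+h. ?g h \<partial>P)"
  proof -
    let ?I = "\<lambda>S S'. \<integral>\<^sup>+h. ?m S S' h \<partial>P"
    have I[measurable]: "(\<lambda>z. ?I (fst z) (snd z)) \<in> borel_measurable (N \<Otimes>\<^sub>M N)"
      by measurable
    have "ennreal (1 - 2 * \<eta>) = (\<integral>\<^sup>+z. ennreal (1 - 2 * \<eta>) \<partial>(N \<Otimes>\<^sub>M N))"
      by (simp add: NN.P.emeasure_space_1)
    \<comment> \<open>Subtracting and adding the overlap means that additivity of the integral is
      applied to functions of the measurable \<open>?I\<close>; the total variation distance enters
      only by monotonicity.\<close>
    also have "\<dots> \<le> (\<integral>\<^sup>+z. (ennreal (1 - 2 * \<eta>) - ?I (fst z) (snd z)) + ?I (fst z) (snd z) \<partial>(N \<Otimes>\<^sub>M N))"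
    proof (rule nn_integral_mono)
      have "a \<le> (a - b) + b" for a b :: ennreal
        by (cases "b \<le> a") (auto simp: diff_add_cancel_ennreal intro: add_increasing)
      then show "ennreal (1 - 2 * \<eta>) \<le> (ennreal (1 - 2 * \<eta>) - ?I (fst z) (snd z)) + ?I (fst z) (snd z)" for z .
    qed
    also have "\<dots> = (\<integral>\<^sup>+z. ennreal (1 - 2 * \<eta>) - ?I (fst z) (snd z) \<partial>(N \<Otimes>\<^sub>M N)) + (\<integral>\<^sup>+z. ?I (fst z) (snd z) \<partial>(N \<Otimes>\<^sub>M N))"
      by (intro nn_integral_add) measurable
    also have "(\<integral>\<^sup>+z. ennreal (1 - 2 * \<eta>) - ?I (fst z) (snd z) \<partial>(N \<Otimes>\<^sub>M N)) \<le> ennreal \<rho>"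
    proof (rule order_trans[OF _ tv], rule nn_integral_mono_AE)
      define good where "good S \<longleftrightarrow> (\<forall>B\<in>sets H. \<bar>measure (A S) B - (\<integral>h. indicator B h * d S h \<partial>P)\<bar> \<le> \<eta>)" for S
      have g: "AE S in N. good S" using approx by (simp add: good_def)
      have "AE z in N \<Otimes>\<^sub>M N. good (fst z)" "AE z in N \<Otimes>\<^sub>M N. good (snd z)"
        by (rule AE_pair_fst[OF N.sigma_finite_measure_axioms g] AE_pair_snd[OF N.sigma_finite_measure_axioms g])+
      with AE_space show "AE z in N \<Otimes>\<^sub>M N. ennreal (1 - 2 * \<eta>) - ?I (fst z) (snd z) \<le> (case z of (S, S') \<Rightarrow> ennreal (tv_dist (A S) (A S')))"
      proof eventually_elim
        case (elim z)
        obtain S S' where z: "z = (S, S')" by (cases z)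
        have S: "S \<in> space N" "S' \<in> space N" using elim z by (auto simp: space_pair_measure)
        have int: "integrable P (\<lambda>h. min (d S h) (d S' h))" using d(3)[OF S(1)] d(3)[OF S(2)] by auto
        have "1 - 2 * \<eta> \<le> tv_dist (A S) (A S') + (\<integral>h. min (d S h) (d S' h) \<partial>P)"
          using elim d S AS unfolding good_def z by (intro overlap_lower_bound) (auto simp: sP)
        then have "ennreal (1 - 2 * \<eta>) \<le> ennreal (tv_dist (A S) (A S') + (\<integral>h. min (d S h) (d S' h) \<partial>P))"
          by (rule ennreal_leI)
        also have "\<dots> = ennreal (tv_dist (A S) (A S')) + ennreal (\<integral>h. min (d S h) (d S' h) \<partial>P)"
          using tv_dist_ge[OF AS(1)[OF S(1)] AS(1)[OF S(2)] sets.empty_sets] d(2)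
          by (intro ennreal_plus integral_nonneg_AE) auto
        also have "ennreal (\<integral>h. min (d S h) (d S' h) \<partial>P) = ?I S S'"
          using d(2) by (intro nn_integral_eq_integral[symmetric] int) auto
        finally show ?case unfolding z by (simp add: ennreal_minus_le_iff add.commute)
      qed
    qed
    also have "(\<integral>\<^sup>+z. ?I (fst z) (snd z) \<partial>(N \<Otimes>\<^sub>M N)) = (\<integral>\<^sup>+h. ?g h \<partial>P)"
      by (rule NNP.Fubini'[OF m1, symmetric])
    finally show ?thesis by (simp add: add_right_mono)
  qed
  have badmass: "(\<integral>\<^sup>+h. indicator bad h * ?g h \<partial>P) \<le> ennreal (\<beta> + \<eta>)"
  proof -
    have "(\<integral>\<^sup>+h. indicator bad h * ?g h \<partial>P) \<le> (\<integral>\<^sup>+h. indicator bad h * (\<integral>\<^sup>+S. ennreal (d S h) \<partial>N) \<partial>P)"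
    proof (intro nn_integral_mono mult_left_mono)
      fix h assume [simp]: "h \<in> space P"
      \<comment> \<open>The minimum is at most its first argument, and then \<open>S'\<close>
        integrates out with mass 1.\<close>
      have "?g h \<le> (\<integral>\<^sup>+z. ennreal (d (fst z) h) \<partial>(N \<Otimes>\<^sub>M N))"
        by (intro nn_integral_mono) (auto intro: ennreal_leI)
      also have "\<dots> = (\<integral>\<^sup>+S. \<integral>\<^sup>+S'. ennreal (d S h) \<partial>N \<partial>N)"
        by (subst N.nn_integral_fst[symmetric]) (simp_all, measurable)
      finally show "?g h \<le> (\<integral>\<^sup>+S. ennreal (d S h) \<partial>N)" by (simp add: N.emeasure_space_1)
    qed simp
    also have "\<dots> = (\<integral>\<^sup>+S. ennreal (\<integral>h. indicator bad h * d S h \<partial>P) \<partial>N)" by (rule mass[OF badP])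
    also have "\<dots> \<le> (\<integral>\<^sup>+S. ennreal (measure (A S) bad) + ennreal \<eta> \<partial>N)"
    proof (rule nn_integral_mono_AE)
      show "AE S in N. ennreal (\<integral>h. indicator bad h * d S h \<partial>P) \<le> ennreal (measure (A S) bad) + ennreal \<eta>"
        using approx
      proof eventually_elim
        case (elim S)
        then have "(\<integral>h. indicator bad h * d S h \<partial>P) \<le> measure (A S) bad + \<eta>" using bad by (auto simp: abs_le_iff)
        then show ?case using \<eta> by (simp add: ennreal_plus[symmetric] del: ennreal_plus)
      qed
    qed
    also have "\<dots> = (\<integral>\<^sup>+S. emeasure (A S) bad + ennreal \<eta> \<partial>N)"
      using AS by (intro nn_integral_cong) (simp add: finite_measure.emeasure_eq_measure prob_space.finite_measure)
    also have "\<dots> = emeasure (N \<bind> A) bad + ennreal \<eta>"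
    proof -
      have "(\<lambda>S. emeasure (A S) bad) \<in> borel_measurable N"
        using measurable_emeasure_subprob_algebra[OF bad] measurable_prob_algebraD[OF A] by (rule measurable_compose[rotated])
      then show ?thesis
        using emeasure_bind_prob_algebra[of N N A H bad] A bad N
        by (subst nn_integral_add) (auto simp: N.emeasure_space_1 space_prob_algebra)
    qed
    also have "emeasure (N \<bind> A) bad = ennreal (measure (N \<bind> A) bad)"
    proof -
      have "prob_space (N \<bind> A)"
        using prob_space_bind'[of N N A H] A N by (auto simp: space_prob_algebra)
      then show ?thesis by (simp add: finite_measure.emeasure_eq_measure prob_space.finite_measure)
    qed
    also have "ennreal (measure (N \<bind> A) bad) + ennreal \<eta> \<le> ennreal (\<beta> + \<eta>)"
      using acc \<eta> nonneg by (simp add: ennreal_plus[symmetric] del: ennreal_plus)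
    finally show ?thesis .
  qed
  have gm: "?g \<in> borel_measurable P"
    by measurable
  have "(\<integral>\<^sup>+h. ?g h \<partial>P) = (\<integral>\<^sup>+h. indicator (space P - bad) h * ?g h + indicator bad h * ?g h \<partial>P)"
    by (intro nn_integral_cong) (auto simp: indicator_def)
  also have "\<dots> = (\<integral>\<^sup>+h. indicator (space P - bad) h * ?g h \<partial>P) + (\<integral>\<^sup>+h. indicator bad h * ?g h \<partial>P)"
    using gm by (intro nn_integral_add) auto
  finally have split: "(\<integral>\<^sup>+h. ?g h \<partial>P) = (\<integral>\<^sup>+h. indicator (space P - bad) h * ?g h \<partial>P) + (\<integral>\<^sup>+h. indicator bad h * ?g h \<partial>P)" .
  define G where "G = (\<integral>\<^sup>+h. indicator (space P - bad) h * ?g h \<partial>P)"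
  have le: "ennreal (1 - 2 * \<eta>) \<le> ennreal \<rho> + (G + ennreal (\<beta> + \<eta>))"
    using order_trans[OF total[unfolded split] add_left_mono[OF add_left_mono[OF badmass]]]
    unfolding G_def .
  \<comment> \<open>Terms can be moved across the inequality once \<open>G\<close> is finite; for
    infinite \<open>G\<close> the claim is trivial.\<close>
  have "ennreal (1 - \<rho> - \<beta> - 3 * \<eta>) \<le> G"
  proof (cases G)
    case (real r)
    have "ennreal (1 - 2 * \<eta>) \<le> ennreal (\<rho> + (r + (\<beta> + \<eta>)))"
      using le real \<eta> nonneg by simp
    then have "1 - 2 * \<eta> \<le> \<rho> + (r + (\<beta> + \<eta>))"
      using real \<eta> nonneg by (subst (asm) ennreal_le_iff) auto
    then show ?thesis unfolding real by (intro ennreal_leI) linarith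
  qed simp
  then show "ennreal (1 - \<rho> - \<beta> - 3 * \<eta>) \<le> (\<integral>\<^sup>+h. indicator (space P - bad) h * ?g h \<partial>P)"
    unfolding G_def .
qed

section \<open>One block: mean and second moment of the tested overlap\<close>

lemma distr_iid_split3:
  assumes D: "prob_space D"
  shows "distr (iid (a + (b + c)) D) (iid a D \<Otimes>\<^sub>M (iid b D \<Otimes>\<^sub>M iid c D))
      (\<lambda>\<omega>. (\<lambda>j\<in>{..<a}. \<omega> j, \<lambda>j\<in>{..<b}. \<omega> (a + j), \<lambda>j\<in>{..<c}. \<omega> (a + (b + j)))) =
    iid a D \<Otimes>\<^sub>M (iid b D \<Otimes>\<^sub>M iid c D)"
proof -
  let ?A = "iid a D" and ?B = "iid b D" and ?C = "iid c D" and ?E = "iid (b + c) D"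
  let ?s = "\<lambda>\<omega>. (\<lambda>j\<in>{..<b}. \<omega> j, \<lambda>j\<in>{..<c}. \<omega> (b + j))"
  let ?t = "\<lambda>\<omega>. (\<lambda>j\<in>{..<a}. \<omega> j, \<lambda>j\<in>{..<b + c}. \<omega> (a + j))"
  interpret E: prob_space ?E by (rule prob_space_iid[OF D])
  interpret BC: pair_prob_space ?B ?C
    by (simp add: pair_prob_space_def pair_sigma_finite_def prob_space_iid[OF D] prob_space_imp_sigma_finite)
  have s: "?s \<in> ?E \<rightarrow>\<^sub>M ?B \<Otimes>\<^sub>M ?C" and t: "?t \<in> iid (a + (b + c)) D \<rightarrow>\<^sub>M ?A \<Otimes>\<^sub>M ?E"
    by (intro measurable_Pair measurable_restrict measurable_component_singleton; simp)+
  have "?A \<Otimes>\<^sub>M (?B \<Otimes>\<^sub>M ?C) = distr ?A ?A (\<lambda>x. x) \<Otimes>\<^sub>M distr ?E (?B \<Otimes>\<^sub>M ?C) ?s"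
    by (simp add: distr_iid_split[OF D] distr_id)
  also have "\<dots> = distr (?A \<Otimes>\<^sub>M ?E) (?A \<Otimes>\<^sub>M (?B \<Otimes>\<^sub>M ?C)) (\<lambda>(x, y). (x, ?s y))"
    by (rule pair_measure_distr) (use s in \<open>simp_all add: distr_iid_split[OF D] BC.P.sigma_finite_measure_axioms\<close>)
  also have "?A \<Otimes>\<^sub>M ?E = distr (iid (a + (b + c)) D) (?A \<Otimes>\<^sub>M ?E) ?t"
    by (rule distr_iid_split[OF D, symmetric])
  also have "distr (distr (iid (a + (b + c)) D) (?A \<Otimes>\<^sub>M ?E) ?t) (?A \<Otimes>\<^sub>M (?B \<Otimes>\<^sub>M ?C)) (\<lambda>(x, y). (x, ?s y)) =
      distr (iid (a + (b + c)) D) (?A \<Otimes>\<^sub>M (?B \<Otimes>\<^sub>M ?C)) ((\<lambda>(x, y). (x, ?s y)) \<circ> ?t)"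
    by (rule distr_distr[OF _ t]) (use s in measurable)
  also have "(\<lambda>(x, y). (x, ?s y)) \<circ> ?t =
      (\<lambda>\<omega>. (\<lambda>j\<in>{..<a}. \<omega> j, \<lambda>j\<in>{..<b}. \<omega> (a + j), \<lambda>j\<in>{..<c}. \<omega> (a + (b + j))))"
    by (auto simp: fun_eq_iff)
  finally show ?thesis ..
qed

text \<open>Applied at a fixed hypothesis: \<open>f\<close> is its density as a function of the
  subsample, and \<open>V\<close> the set of test samples that accept it. The three parts of a block
  are independent, so the mean factors; in the second moment the test factor is at most 1, and the
  mean of a product of two independent densities is the square of the mean.\<close>

lemma
  fixes f :: "(nat \<Rightarrow> 'z) \<Rightarrow> real"
  assumes D: "prob_space D" and f[measurable]: "f \<in> borel_measurable (iid n D)" and f0: "\<And>S. 0 \<le> f S"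
    and V[measurable]: "V \<in> sets (iid T D)"
  defines "F \<equiv> \<lambda>\<omega>. min (f (\<lambda>j\<in>{..<n}. \<omega> j)) (f (\<lambda>j\<in>{..<n}. \<omega> (n + j))) *
      indicator V (\<lambda>j\<in>{..<T}. \<omega> (n + (n + j)))"
  shows block_mean: "(\<integral>\<^sup>+\<omega>. ennreal (F \<omega>) \<partial>iid (n + (n + T)) D) =
      (\<integral>\<^sup>+z. ennreal (min (f (fst z)) (f (snd z))) \<partial>(iid n D \<Otimes>\<^sub>M iid n D)) * emeasure (iid T D) V"
    and block_second_moment: "(\<integral>\<^sup>+\<omega>. ennreal ((F \<omega>)\<^sup>2) \<partial>iid (n + (n + T)) D) \<le> (\<integral>\<^sup>+S. ennreal (f S) \<partial>iid n D)\<^sup>2"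
proof -
  let ?N = "iid n D" and ?L = "iid T D" and ?M = "iid (n + (n + T)) D"
  interpret N: prob_space ?N by (rule prob_space_iid[OF D])
  interpret L: prob_space ?L by (rule prob_space_iid[OF D])
  interpret NL: pair_prob_space ?N ?L ..
  let ?p = "\<lambda>\<omega>. (\<lambda>j\<in>{..<n}. \<omega> j, \<lambda>j\<in>{..<n}. \<omega> (n + j), \<lambda>j\<in>{..<T}. \<omega> (n + (n + j)))"
  have p: "?p \<in> ?M \<rightarrow>\<^sub>M ?N \<Otimes>\<^sub>M (?N \<Otimes>\<^sub>M ?L)"
    by (intro measurable_Pair measurable_restrict measurable_component_singleton; simp)
  have int: "(\<integral>\<^sup>+\<omega>. G (?p \<omega>) \<partial>?M) = (\<integral>\<^sup>+x. \<integral>\<^sup>+y. \<integral>\<^sup>+z. G (x, y, z) \<partial>?L \<partial>?N \<partial>?N)"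
    if [measurable]: "G \<in> borel_measurable (?N \<Otimes>\<^sub>M (?N \<Otimes>\<^sub>M ?L))" for G
  proof -
    have "(\<integral>\<^sup>+\<omega>. G (?p \<omega>) \<partial>?M) = (\<integral>\<^sup>+w. G w \<partial>distr ?M (?N \<Otimes>\<^sub>M (?N \<Otimes>\<^sub>M ?L)) ?p)"
      using p by (subst nn_integral_distr) auto
    also have "\<dots> = (\<integral>\<^sup>+x. \<integral>\<^sup>+w. G (x, w) \<partial>(?N \<Otimes>\<^sub>M ?L) \<partial>?N)"
      by (simp add: distr_iid_split3[OF D] NL.P.nn_integral_fst)
    also have "\<dots> = (\<integral>\<^sup>+x. \<integral>\<^sup>+y. \<integral>\<^sup>+z. G (x, y, z) \<partial>?L \<partial>?N \<partial>?N)"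
      by (intro nn_integral_cong L.nn_integral_fst[symmetric]) measurable
    finally show ?thesis .
  qed
  let ?G = "\<lambda>(x, y, z). ennreal (min (f x) (f y)) * indicator V z"
  have "(\<integral>\<^sup>+\<omega>. ennreal (F \<omega>) \<partial>?M) = (\<integral>\<^sup>+\<omega>. ?G (?p \<omega>) \<partial>?M)"
    by (intro nn_integral_cong) (simp add: F_def indicator_def)
  also have "\<dots> = (\<integral>\<^sup>+x. \<integral>\<^sup>+y. \<integral>\<^sup>+z. ?G (x, y, z) \<partial>?L \<partial>?N \<partial>?N)"
    by (rule int) measurable
  also have "\<dots> = (\<integral>\<^sup>+x. (\<integral>\<^sup>+y. ennreal (min (f x) (f y)) \<partial>?N) \<partial>?N) * emeasure ?L V"
    by (simp add: nn_integral_cmult nn_integral_multc)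
  also have "(\<integral>\<^sup>+x. (\<integral>\<^sup>+y. ennreal (min (f x) (f y)) \<partial>?N) \<partial>?N) = (\<integral>\<^sup>+z. ennreal (min (f (fst z)) (f (snd z))) \<partial>(?N \<Otimes>\<^sub>M ?N))"
    by (subst N.nn_integral_fst[symmetric]) simp_all
  finally show "(\<integral>\<^sup>+\<omega>. ennreal (F \<omega>) \<partial>?M) = (\<integral>\<^sup>+z. ennreal (min (f (fst z)) (f (snd z))) \<partial>(?N \<Otimes>\<^sub>M ?N)) * emeasure ?L V" .
  let ?G2 = "\<lambda>(x, y, z). ennreal (f x) * ennreal (f y)"
  have "(\<integral>\<^sup>+\<omega>. ennreal ((F \<omega>)\<^sup>2) \<partial>?M) \<le> (\<integral>\<^sup>+\<omega>. ?G2 (?p \<omega>) \<partial>?M)"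
  proof (rule nn_integral_mono)
    fix \<omega>
    define u v where "u = f (\<lambda>j\<in>{..<n}. \<omega> j)" and "v = f (\<lambda>j\<in>{..<n}. \<omega> (n + j))"
    have uv: "0 \<le> u" "0 \<le> v" using f0 by (auto simp: u_def v_def)
    have "(F \<omega>)\<^sup>2 \<le> (min u v)\<^sup>2" using uv by (auto simp: F_def u_def v_def indicator_def)
    also have "\<dots> \<le> u * v" using uv by (auto simp: power2_eq_square intro!: mult_mono)
    finally show "ennreal ((F \<omega>)\<^sup>2) \<le> ?G2 (?p \<omega>)"
      using uv by (simp add: ennreal_mult[symmetric] u_def[symmetric] v_def[symmetric] ennreal_leI)
  qed
  also have "\<dots> = (\<integral>\<^sup>+x. \<integral>\<^sup>+y. \<integral>\<^sup>+z. ?G2 (x, y, z) \<partial>?L \<partial>?N \<partial>?N)"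
    by (rule int) measurable
  also have "\<dots> = (\<integral>\<^sup>+S. ennreal (f S) \<partial>?N)\<^sup>2"
    by (simp add: L.emeasure_space_1 nn_integral_cmult nn_integral_multc power2_eq_square)
  finally show "(\<integral>\<^sup>+\<omega>. ennreal ((F \<omega>)\<^sup>2) \<partial>?M) \<le> (\<integral>\<^sup>+S. ennreal (f S) \<partial>?N)\<^sup>2" .
qed

section \<open>Convergence of block averages in L1\<close>

lemma average_measurable:
  fixes F :: "'b \<Rightarrow> 'h \<Rightarrow> real"
  assumes F: "case_prod F \<in> borel_measurable (Q \<Otimes>\<^sub>M P)"
  shows "(\<lambda>(\<omega>, h). (\<Sum>i<K. F (\<omega> i) h) / K) \<in> borel_measurable (iid K Q \<Otimes>\<^sub>M P)"
proof -
  have [measurable]: "(\<lambda>w. F (fst w i) (snd w)) \<in> borel_measurable (iid K Q \<Otimes>\<^sub>M P)" if "i \<in> {..<K}" for i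
  proof -
    have "(\<lambda>w. (fst w i, snd w)) \<in> iid K Q \<Otimes>\<^sub>M P \<rightarrow>\<^sub>M Q \<Otimes>\<^sub>M P"
      using that by (intro measurable_Pair measurable_compose[OF measurable_fst measurable_component_singleton]) auto
    from measurable_compose[OF this F] show ?thesis by simp
  qed
  show ?thesis unfolding split_beta by measurable
qed

text \<open>Bounding the second moment at \<open>h\<close> by the square of a function \<open>c\<close> that is merely integrable
  makes the rate of convergence in \<open>L\<^sup>1\<close> independent of the law of \<open>F\<close>.\<close>

lemma average_L1_convergence:
  fixes F :: "'b \<Rightarrow> 'h \<Rightarrow> real" and c :: "'h \<Rightarrow> ennreal"
  assumes Q: "prob_space Q" and P: "prob_space P"
    and F[measurable]: "case_prod F \<in> borel_measurable (Q \<Otimes>\<^sub>M P)"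
    and c[measurable]: "c \<in> borel_measurable P" and C: "(\<integral>\<^sup>+h. c h \<partial>P) \<le> ennreal C"
    and F2: "\<And>h. h \<in> space P \<Longrightarrow> (\<integral>\<^sup>+\<omega>. ennreal ((F \<omega> h)\<^sup>2) \<partial>Q) \<le> (c h)\<^sup>2" and K: "0 < K"
  shows "(\<integral>\<^sup>+\<omega>. \<integral>\<^sup>+h. ennreal \<bar>(\<Sum>i<K. F (\<omega> i) h) / K - (\<integral>x. F x h \<partial>Q)\<bar> \<partial>P \<partial>iid K Q) \<le> ennreal (C / sqrt K)"
proof -
  interpret Q: prob_space Q by fact
  interpret P: prob_space P by fact
  interpret I: prob_space "iid K Q" by (rule prob_space_iid[OF Q])
  interpret IP: pair_sigma_finite "iid K Q" P ..
  note [measurable] = average_measurable[OF F, of K]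
  have w[measurable]: "(\<lambda>h. \<integral>x. F x h \<partial>Q) \<in> borel_measurable P" by measurable
  let ?X = "\<lambda>\<omega> h. ennreal \<bar>(\<Sum>i<K. F (\<omega> i) h) / K - (\<integral>x. F x h \<partial>Q)\<bar>"
  \<comment> \<open>With \<open>h\<close> outermost, the rate for averages of real random variables
    applies at each \<open>h\<close>.\<close>
  have "(\<integral>\<^sup>+\<omega>. \<integral>\<^sup>+h. ?X \<omega> h \<partial>P \<partial>iid K Q) = (\<integral>\<^sup>+h. \<integral>\<^sup>+\<omega>. ?X \<omega> h \<partial>iid K Q \<partial>P)"
    by (rule IP.Fubini'[symmetric]) measurable
  also have "\<dots> \<le> (\<integral>\<^sup>+h. c h * ennreal (1 / sqrt K) \<partial>P)"
  proof (rule nn_integral_mono_AE)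
    \<comment> \<open>The real-valued rate presupposes a finite second moment at \<open>h\<close>;
      integrability of \<open>c\<close> provides it almost everywhere.\<close>
    have "AE h in P. c h \<noteq> \<infinity>"
      by (rule nn_integral_PInf_AE) (use C in \<open>auto simp: top_unique\<close>)
    then show "AE h in P. (\<integral>\<^sup>+\<omega>. ?X \<omega> h \<partial>iid K Q) \<le> c h * ennreal (1 / sqrt K)"
      using AE_space
    proof eventually_elim
      case (elim h)
      then have ch: "c h = ennreal (enn2real (c h))" by (simp add: less_top)
      have "(\<integral>\<^sup>+\<omega>. ennreal ((F \<omega> h)\<^sup>2) \<partial>Q) \<le> ennreal ((enn2real (c h))\<^sup>2)"
        using F2[OF elim(2)] by (subst (asm) ch) (simp add: ennreal_power)
      then have "(\<integral>\<^sup>+\<omega>. ?X \<omega> h \<partial>iid K Q) \<le> ennreal (enn2real (c h) / sqrt K)"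
        using elim(2) by (intro iid_average_L1[OF Q _ _ _ K]) auto
      also have "\<dots> = ennreal (enn2real (c h)) * ennreal (1 / sqrt K)"
        by (subst ennreal_mult[symmetric]) auto
      finally show ?case by (simp add: ch[symmetric])
    qed
  qed
  also have "\<dots> = (\<integral>\<^sup>+h. c h \<partial>P) * ennreal (1 / sqrt K)" by (rule nn_integral_multc) simp
  also have "\<dots> \<le> ennreal C * ennreal (1 / sqrt K)" by (intro mult_right_mono C) simp
  also have "\<dots> = ennreal (C / sqrt K)" by (subst ennreal_mult''[symmetric]) auto
  finally show ?thesis .
qed

section \<open>Stability of normalization and concentration of the output\<close>

text \<open>Besides the error \<open>\<kappa>\<close> of the sampler there is that of normalizing
  \<open>W\<close> in place of \<open>w\<close>. With total masses \<open>C\<close>,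
  \<open>Z\<close> and masses \<open>a\<close>, \<open>b\<close> on \<open>B\<close>, the identity
  \<open>a / C - b / Z = (a - b) / Z + (a / C) * ((Z - C) / Z)\<close> splits it into two terms,
  each at most the L1 distance over \<open>Z\<close>; hence the factor 2.\<close>

lemma normalized_deviation:
  fixes W w :: "'h \<Rightarrow> real"
  assumes W: "integrable P W" "\<And>h. 0 \<le> W h" and w: "integrable P w" "\<And>h. 0 \<le> w h"
    and Z: "0 < (\<integral>h. w h \<partial>P)" and B: "B \<in> sets P" and p: "0 \<le> p" "p \<le> 1" and \<kappa>: "0 \<le> \<kappa>"
    and close: "0 < (\<integral>h. W h \<partial>P) \<Longrightarrow> \<bar>p - (\<integral>h. indicator B h * W h \<partial>P) / (\<integral>h. W h \<partial>P)\<bar> \<le> \<kappa>"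
  shows "\<bar>p - (\<integral>h. indicator B h * w h \<partial>P) / (\<integral>h. w h \<partial>P)\<bar> \<le> \<kappa> + 2 * (\<integral>h. \<bar>W h - w h\<bar> \<partial>P) / (\<integral>h. w h \<partial>P)"
proof -
  define Z C e where "Z = (\<integral>h. w h \<partial>P)" and "C = (\<integral>h. W h \<partial>P)" and "e = (\<integral>h. \<bar>W h - w h\<bar> \<partial>P)"
  define a b where "a = (\<integral>h. indicator B h * W h \<partial>P)" and "b = (\<integral>h. indicator B h * w h \<partial>P)"
  have ind: "integrable P (\<lambda>h. indicator B h * W h)" "integrable P (\<lambda>h. indicator B h * w h)"
    using integrable_mult_indicator[OF B W(1)] integrable_mult_indicator[OF B w(1)] by auto
  have Zp: "0 < Z" using Z by (simp add: Z_def)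
  have e: "integrable P (\<lambda>h. \<bar>W h - w h\<bar>)" using W w by auto
  have ZC: "\<bar>C - Z\<bar> \<le> e"
  proof -
    have "C - Z = (\<integral>h. W h - w h \<partial>P)" using W w by (simp add: C_def Z_def)
    then show ?thesis unfolding e_def by (metis integral_abs_bound)
  qed
  have ab: "\<bar>a - b\<bar> \<le> e"
  proof -
    have "a - b = (\<integral>h. indicator B h * W h - indicator B h * w h \<partial>P)" using ind by (simp add: a_def b_def)
    also have "\<bar>\<dots>\<bar> \<le> (\<integral>h. \<bar>indicator B h * W h - indicator B h * w h\<bar> \<partial>P)" by (rule integral_abs_bound)
    also have "\<dots> \<le> e" unfolding e_def
      using e ind by (intro integral_mono) (auto simp: indicator_def)
    finally show ?thesis .
  qed
  have a: "0 \<le> a" "a \<le> C"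
    unfolding a_def C_def using W ind by (auto intro!: integral_nonneg_AE integral_mono simp: indicator_def)
  have b: "0 \<le> b" "b \<le> Z"
    unfolding b_def Z_def using w ind by (auto intro!: integral_nonneg_AE integral_mono simp: indicator_def)
  have "\<bar>p - b / Z\<bar> \<le> \<kappa> + 2 * e / Z"
  proof (cases "0 < C")
    case True
    have "a / C - b / Z = (a - b) / Z + (a / C) * ((Z - C) / Z)"
      using True Zp by (simp add: field_simps)
    also have "\<bar>\<dots>\<bar> \<le> \<bar>(a - b) / Z\<bar> + \<bar>a / C\<bar> * \<bar>(Z - C) / Z\<bar>"
      by (metis abs_mult abs_triangle_ineq)
    also have "\<dots> \<le> e / Z + 1 * (e / Z)"
      using ab ZC a True Zp by (intro add_mono mult_mono) (auto simp: divide_right_mono abs_minus_commute)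
    finally have "\<bar>a / C - b / Z\<bar> \<le> 2 * e / Z" by simp
    moreover have "\<bar>p - a / C\<bar> \<le> \<kappa>" using close True by (simp add: C_def a_def)
    ultimately show ?thesis by linarith
  next
    case False
    \<comment> \<open>For \<open>W\<close> of total mass 0 nothing is known about \<open>p\<close>,
      but the L1 distance is then at least \<open>Z\<close>, and the claimed bound is at least
      2.\<close>
    then have "Z \<le> e" using ZC a by linarith
    then have "2 \<le> 2 * e / Z" using Zp by (simp add: field_simps)
    moreover have "0 \<le> b / Z" "b / Z \<le> 1" using b Zp by auto
    ultimately show ?thesis using p \<kappa> by linarith
  qed
  then show ?thesis by (simp add: b_def Z_def e_def)
qed

text \<open>\<open>\<nu>\<close> is a target common to all samples: comparing two outputs through it
  costs \<open>\<gamma>\<close> twice, comparing the mixture over samples with it costs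
  \<open>\<gamma>\<close> once.\<close>

lemma
  fixes \<nu> :: "'h set \<Rightarrow> real" and g :: "'s \<Rightarrow> real"
  assumes M: "prob_space M" and O: "O' \<in> M \<rightarrow>\<^sub>M prob_algebra H"
    and g[measurable]: "g \<in> borel_measurable M" "\<And>S. 0 \<le> g S" and \<gamma>: "(\<integral>\<^sup>+S. ennreal (g S) \<partial>M) \<le> ennreal \<gamma>" "0 \<le> \<gamma>"
    and close: "\<And>S B. S \<in> space M \<Longrightarrow> B \<in> sets H \<Longrightarrow> \<bar>measure (O' S) B - \<nu> B\<bar> \<le> g S"
  shows concentrated_tv: "(\<integral>\<^sup>+(S, S'). ennreal (tv_dist (O' S) (O' S')) \<partial>(M \<Otimes>\<^sub>M M)) \<le> ennreal (2 * \<gamma>)"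
    and concentrated_measure_bind: "\<lbrakk>B \<in> sets H; 0 \<le> \<nu> B\<rbrakk> \<Longrightarrow> measure (M \<bind> O') B \<le> \<nu> B + \<gamma>"
proof -
  interpret M: prob_space M by fact
  interpret MM: pair_prob_space M M ..
  have OS: "prob_space (O' S)" "sets (O' S) = sets H" if "S \<in> space M" for S
    using measurable_space[OF O that] by (auto simp: space_prob_algebra)
  have "(\<integral>\<^sup>+(S, S'). ennreal (tv_dist (O' S) (O' S')) \<partial>(M \<Otimes>\<^sub>M M)) \<le> (\<integral>\<^sup>+z. ennreal (g (fst z)) + ennreal (g (snd z)) \<partial>(M \<Otimes>\<^sub>M M))"
  proof (rule nn_integral_mono)
    fix z assume "z \<in> space (M \<Otimes>\<^sub>M M)"
    then obtain S S' where z: "z = (S, S')" "S \<in> space M" "S' \<in> space M" by (auto simp: space_pair_measure)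
    have "tv_dist (O' S) (O' S') \<le> g S + g S'"
    proof (rule tv_dist_le)
      fix B assume "B \<in> sets (O' S)"
      then have "B \<in> sets H" using OS z by simp
      then show "\<bar>measure (O' S) B - measure (O' S') B\<bar> \<le> g S + g S'"
        using close[OF z(2), of B] close[OF z(3), of B] by linarith
    qed
    then show "(case z of (S, S') \<Rightarrow> ennreal (tv_dist (O' S) (O' S'))) \<le> ennreal (g (fst z)) + ennreal (g (snd z))"
      using g(2) z by (simp add: ennreal_plus[symmetric] ennreal_leI del: ennreal_plus)
  qed
  also have "\<dots> = (\<integral>\<^sup>+z. ennreal (g (fst z)) \<partial>(M \<Otimes>\<^sub>M M)) + (\<integral>\<^sup>+z. ennreal (g (snd z)) \<partial>(M \<Otimes>\<^sub>M M))"
    by (intro nn_integral_add) measurable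
  also have "(\<integral>\<^sup>+z. ennreal (g (fst z)) \<partial>(M \<Otimes>\<^sub>M M)) = (\<integral>\<^sup>+S. ennreal (g S) \<partial>M)"
    by (subst M.nn_integral_fst[symmetric]) (simp_all add: M.emeasure_space_1)
  also have "(\<integral>\<^sup>+z. ennreal (g (snd z)) \<partial>(M \<Otimes>\<^sub>M M)) = (\<integral>\<^sup>+S. ennreal (g S) \<partial>M)"
    by (subst M.nn_integral_fst[symmetric]) (simp_all add: M.emeasure_space_1)
  also have "(\<integral>\<^sup>+S. ennreal (g S) \<partial>M) + (\<integral>\<^sup>+S. ennreal (g S) \<partial>M) \<le> ennreal \<gamma> + ennreal \<gamma>"
    by (intro add_mono \<gamma>)
  also have "\<dots> = ennreal (2 * \<gamma>)" using \<gamma>(2) by (simp add: ennreal_plus[symmetric] del: ennreal_plus)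
  finally show "(\<integral>\<^sup>+(S, S'). ennreal (tv_dist (O' S) (O' S')) \<partial>(M \<Otimes>\<^sub>M M)) \<le> ennreal (2 * \<gamma>)" .
  assume B: "B \<in> sets H" and \<nu>: "0 \<le> \<nu> B"
  have "emeasure (M \<bind> O') B = (\<integral>\<^sup>+S. emeasure (O' S) B \<partial>M)"
    using emeasure_bind_prob_algebra[of M M O' H B] O B M by (simp add: space_prob_algebra)
  also have "\<dots> \<le> (\<integral>\<^sup>+S. ennreal (\<nu> B) + ennreal (g S) \<partial>M)"
  proof (rule nn_integral_mono)
    fix S assume S: "S \<in> space M"
    have "emeasure (O' S) B = ennreal (measure (O' S) B)"
      using OS(1)[OF S] by (simp add: finite_measure.emeasure_eq_measure prob_space.finite_measure)
    also have "\<dots> \<le> ennreal (\<nu> B + g S)" using close[OF S B] by (intro ennreal_leI) linarith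
    finally show "emeasure (O' S) B \<le> ennreal (\<nu> B) + ennreal (g S)" using \<nu> g(2) by simp
  qed
  also have "\<dots> = ennreal (\<nu> B) + (\<integral>\<^sup>+S. ennreal (g S) \<partial>M)"
    by (subst nn_integral_add) (auto simp: M.emeasure_space_1)
  also have "\<dots> \<le> ennreal (\<nu> B + \<gamma>)" using \<gamma> \<nu> by (simp add: add_left_mono)
  finally show "measure (M \<bind> O') B \<le> \<nu> B + \<gamma>"
    using \<gamma>(2) \<nu> by (simp add: measure_def enn2real_leI)
qed

lemma overlap_le_mean:
  fixes f :: "'s \<Rightarrow> real"
  assumes N: "prob_space N" and f[measurable]: "f \<in> borel_measurable N"
  shows "(\<integral>\<^sup>+z. ennreal (min (f (fst z)) (f (snd z))) \<partial>(N \<Otimes>\<^sub>M N)) \<le> (\<integral>\<^sup>+S. ennreal (f S) \<partial>N)"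
proof -
  interpret N: prob_space N by fact
  have "(\<integral>\<^sup>+z. ennreal (min (f (fst z)) (f (snd z))) \<partial>(N \<Otimes>\<^sub>M N)) \<le> (\<integral>\<^sup>+z. ennreal (f (fst z)) \<partial>(N \<Otimes>\<^sub>M N))"
    by (intro nn_integral_mono ennreal_leI) simp
  also have "\<dots> = (\<integral>\<^sup>+S. ennreal (f S) \<partial>N)"
    by (subst N.nn_integral_fst[symmetric]) (simp_all add: N.emeasure_space_1)
  finally show ?thesis .
qed

section \<open>Empirical error of a hypothesis on test examples\<close>

definition error_rate :: "nat \<Rightarrow> (nat \<Rightarrow> 'x \<times> bool) \<Rightarrow> ('x \<Rightarrow> bool) \<Rightarrow> real" where
  "error_rate T z h = (\<Sum>j<T. indicator {(x, y). h x \<noteq> y} (z j)) / real T"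

lemma disagreement_measurable:
  assumes H: "hypothesis_space X H" and h: "h \<in> M \<rightarrow>\<^sub>M H" and e: "e \<in> M \<rightarrow>\<^sub>M examples X"
  shows "Measurable.pred M (\<lambda>w. e w \<in> {(x, y). h w x \<noteq> y})"
proof -
  have ev: "(\<lambda>(h, x). h x) \<in> H \<Otimes>\<^sub>M X \<rightarrow>\<^sub>M count_space UNIV" using H by (simp add: hypothesis_space_def)
  note [measurable] = h e
  have "(\<lambda>w. (h w, fst (e w))) \<in> M \<rightarrow>\<^sub>M H \<Otimes>\<^sub>M X" by measurable
  from measurable_compose[OF this ev] have [measurable]: "(\<lambda>w. h w (fst (e w))) \<in> M \<rightarrow>\<^sub>M count_space UNIV" by simp
  show ?thesis unfolding split_beta mem_Collect_eq by measurable
qed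

lemma error_rate_measurable:
  assumes H: "hypothesis_space X H" and h: "h \<in> M \<rightarrow>\<^sub>M H" and z: "\<And>j. j < T \<Longrightarrow> (\<lambda>w. z w j) \<in> M \<rightarrow>\<^sub>M examples X"
  shows "(\<lambda>w. error_rate T (z w) (h w)) \<in> borel_measurable M"
proof -
  have "(\<lambda>w. indicator {(x, y). h w x \<noteq> y} (z w j)) \<in> borel_measurable M" if "j < T" for j
  proof -
    note [measurable] = disagreement_measurable[OF H h z[OF that]]
    show ?thesis unfolding indicator_def by measurable
  qed
  then show ?thesis unfolding error_rate_def by (intro borel_measurable_divide borel_measurable_sum) auto
qed

lemma space_examples: "hypothesis_space X H \<Longrightarrow> sets D = sets (examples X) \<Longrightarrow> space D = UNIV"
  by (auto simp: hypothesis_space_def space_pair_measure dest: sets_eq_imp_space_eq)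

lemma err_measurable:
  assumes H: "hypothesis_space X H" and D: "prob_space D" "sets D = sets (examples X)"
  shows "err D \<in> borel_measurable H"
proof -
  interpret D: prob_space D by fact
  have "Measurable.pred (H \<Otimes>\<^sub>M D) (\<lambda>w. snd w \<in> {(x, y). fst w x \<noteq> y})"
    by (intro disagreement_measurable[OF H]) (simp_all add: measurable_cong_sets[OF refl D(2)[symmetric]])
  then have "{w \<in> space (H \<Otimes>\<^sub>M D). snd w \<in> {(x, y). fst w x \<noteq> y}} \<in> sets (H \<Otimes>\<^sub>M D)"
    by (simp add: pred_def)
  from D.measurable_emeasure_Pair[OF this]
  have "(\<lambda>h. enn2real (emeasure D (Pair h -` {w \<in> space (H \<Otimes>\<^sub>M D). snd w \<in> {(x, y). fst w x \<noteq> y}}))) \<in> borel_measurable H"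
    by (rule measurable_compose) simp
  then show ?thesis
    by (rule measurable_cong[THEN iffD1, rotated])
       (auto simp: err_def measure_def space_pair_measure intro!: arg_cong[where f=enn2real] arg_cong[where f="emeasure D"])
qed

text \<open>The threshold \<alpha> + \<epsilon> / 2 lies \<open>\<epsilon> / 2\<close> away from
  both \<alpha> and \<alpha> + \<epsilon>, so a wrong verdict requires a deviation of that size.
  Chebyshev with \<open>\<epsilon> / 2\<close> gives the constant 4. Hypotheses with error in
  between may be accepted or not.\<close>

lemma
  fixes \<alpha> \<epsilon> :: real
  assumes H: "hypothesis_space X H" and D: "prob_space D" "sets D = sets (examples X)"
    and h: "h \<in> space H" and T: "0 < T" and \<epsilon>: "0 < \<epsilon>"
  defines "V \<equiv> {z \<in> space (iid T D). error_rate T z h \<le> \<alpha> + \<epsilon> / 2}"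
  shows test_set_measurable: "V \<in> sets (iid T D)"
    and test_accepts: "err D h \<le> \<alpha> \<Longrightarrow> 1 - 4 / (T * \<epsilon>\<^sup>2) \<le> measure (iid T D) V"
    and test_rejects: "\<alpha> + \<epsilon> < err D h \<Longrightarrow> measure (iid T D) V \<le> 4 / (T * \<epsilon>\<^sup>2)"
proof -
  interpret D: prob_space D by fact
  interpret I: prob_space "iid T D" by (rule prob_space_iid[OF D(1)])
  define B where "B = {(x, y). h x \<noteq> y}"
  have D_UNIV: "space D = UNIV" by (rule space_examples[OF H D(2)])
  have B[measurable]: "B \<in> sets D"
    using disagreement_measurable[OF H measurable_const[OF h] measurable_ident_sets[OF D(2)]]
    by (simp add: B_def pred_def D_UNIV)
  have errB: "err D h = measure D B" by (simp add: err_def B_def D_UNIV)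
  have rate: "error_rate T z h = (\<Sum>j<T. indicator B (z j)) / T" for z by (simp add: error_rate_def B_def)
  show V: "V \<in> sets (iid T D)" unfolding V_def rate by measurable
  define U where "U = {z \<in> space (iid T D). \<epsilon> / 2 \<le> \<bar>(\<Sum>j<T. indicator B (z j)) / T - measure D B\<bar>}"
  have U: "U \<in> sets (iid T D)" unfolding U_def by measurable
  have PU: "measure (iid T D) U \<le> 4 / (T * \<epsilon>\<^sup>2)"
    using iid_frequency_deviation[OF D(1) B T, of "\<epsilon> / 2"] \<epsilon> by (simp add: U_def power_divide field_simps)
  show "1 - 4 / (T * \<epsilon>\<^sup>2) \<le> measure (iid T D) V" if "err D h \<le> \<alpha>"
  proof -
    have "1 - 4 / (T * \<epsilon>\<^sup>2) \<le> measure (iid T D) (space (iid T D) - U)"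
      using PU I.prob_compl[OF U] by simp
    also have "\<dots> \<le> measure (iid T D) V"
    proof (intro I.finite_measure_mono V subsetI)
      fix z assume "z \<in> space (iid T D) - U"
      then have z: "z \<in> space (iid T D)" "\<not> \<epsilon> / 2 \<le> \<bar>error_rate T z h - measure D B\<bar>"
        unfolding U_def rate by blast+
      then have "error_rate T z h \<le> \<alpha> + \<epsilon> / 2" using that errB by linarith
      then show "z \<in> V" using z by (simp add: V_def)
    qed
    finally show ?thesis .
  qed
  show "measure (iid T D) V \<le> 4 / (T * \<epsilon>\<^sup>2)" if "\<alpha> + \<epsilon> < err D h"
  proof -
    have "measure (iid T D) V \<le> measure (iid T D) U"
    proof (intro I.finite_measure_mono U subsetI)
      fix z assume "z \<in> V"
      then have z: "z \<in> space (iid T D)" "error_rate T z h \<le> \<alpha> + \<epsilon> / 2"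
        by (auto simp: V_def)
      then have "\<epsilon> / 2 \<le> \<bar>error_rate T z h - measure D B\<bar>" using that errB by linarith
      then show "z \<in> U" using z unfolding U_def rate by blast
    qed
    with PU show ?thesis by simp
  qed
qed

section \<open>The limit weight and its masses\<close>

text \<open>For almost every \<open>h\<close> the limit is \<open>w h = g h * a h\<close>, the mean
  overlap times the probability that the test accepts \<open>h\<close>. The second factor is at
  least 1/2 where the error is at most \<alpha>, which costs half of the mass from
  \<open>overlap_mass\<close>, and at most \<open>4 / (T * \<epsilon>\<^sup>2)\<close> where the
  error exceeds \<alpha> + \<epsilon>.\<close>

lemma
  fixes P H :: "('x \<Rightarrow> bool) measure" and d :: "(nat \<Rightarrow> 'x \<times> bool) \<Rightarrow> ('x \<Rightarrow> bool) \<Rightarrow> real"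
    and \<alpha> \<epsilon> :: real
  assumes H: "hypothesis_space X H" and D: "prob_space D" "sets D = sets (examples X)"
    and P: "prob_space P" "sets P = sets H"
    and A: "A \<in> iid n D \<rightarrow>\<^sub>M prob_algebra H"
    and d: "case_prod d \<in> borel_measurable (iid n D \<Otimes>\<^sub>M P)" "\<And>S h. 0 \<le> d S h" "\<And>S. S \<in> space (iid n D) \<Longrightarrow> integrable P (d S)"
    and approx: "AE S in iid n D. \<forall>B\<in>sets H. \<bar>measure (A S) B - (\<integral>h. indicator B h * d S h \<partial>P)\<bar> \<le> \<eta>"
    and nonneg: "0 \<le> \<eta>" "0 \<le> \<rho>" "0 \<le> \<beta>" and T: "0 < T" and \<epsilon>: "0 < \<epsilon>" "4 / (T * \<epsilon>\<^sup>2) \<le> 1 / 2"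
    and tv: "tv_indistinguishable D n A \<rho>" and acc: "accurate H D n A \<alpha> \<beta>" and \<delta>: "0 < 1 - \<rho> - \<beta> - 3 * \<eta>"
  defines "F \<equiv> \<lambda>\<omega> h. min (d (\<lambda>j\<in>{..<n}. \<omega> j) h) (d (\<lambda>j\<in>{..<n}. \<omega> (n + j)) h) *
      (if error_rate T (\<lambda>j\<in>{..<T}. \<omega> (n + (n + j))) h \<le> \<alpha> + \<epsilon> / 2 then 1 else 0)"
  defines "w \<equiv> \<lambda>h. \<integral>\<omega>. F \<omega> h \<partial>iid (n + (n + T)) D"
  shows block_weight_measurable: "case_prod F \<in> borel_measurable (iid (n + (n + T)) D \<Otimes>\<^sub>M P)"
    and limit_integrable: "integrable P w"
    and limit_mass: "(1 - \<rho> - \<beta> - 3 * \<eta>) / 2 \<le> (\<integral>h. w h \<partial>P)"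
    and limit_inaccurate_mass: "(\<integral>h. indicator {h \<in> space H. \<alpha> + \<epsilon> < err D h} h * w h \<partial>P) \<le> 4 / (T * \<epsilon>\<^sup>2) * (1 + \<eta>)"
    and limit_rate: "0 < K \<Longrightarrow> (\<integral>\<^sup>+\<omega>. \<integral>\<^sup>+h. ennreal \<bar>(\<Sum>i<K. F (\<omega> i) h) / K - w h\<bar> \<partial>P \<partial>iid K (iid (n + (n + T)) D)) \<le> ennreal ((1 + \<eta>) / sqrt K)"
proof -
  let ?N = "iid n D" and ?Q = "iid (n + (n + T)) D"
  let ?\<tau> = "4 / (T * \<epsilon>\<^sup>2)" and ?\<delta> = "1 - \<rho> - \<beta> - 3 * \<eta>"
  interpret N: prob_space ?N by (rule prob_space_iid[OF D(1)])
  interpret Q: prob_space ?Q by (rule prob_space_iid[OF D(1)])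
  interpret I: prob_space "iid T D" by (rule prob_space_iid[OF D(1)])
  interpret P: prob_space P by (rule P(1))
  interpret NNP: pair_sigma_finite "?N \<Otimes>\<^sub>M ?N" P
    by (simp add: pair_sigma_finite_def P.sigma_finite_measure_axioms N.sigma_finite_measure_axioms sigma_finite_pair_measure)
  have spP: "space P = space H" by (rule sets_eq_imp_space_eq[OF P(2)])
  have D_UNIV: "space D = UNIV" by (rule space_examples[OF H D(2)])
  have err[measurable]: "err D \<in> borel_measurable P"
    using err_measurable[OF H D] by (simp add: measurable_cong_sets[OF P(2) refl])
  note [measurable] = d(1)
  have dh[measurable]: "(\<lambda>S. d S h) \<in> borel_measurable ?N" if "h \<in> space P" for h
    using that by measurable
  show Fm[measurable]: "case_prod F \<in> borel_measurable (?Q \<Otimes>\<^sub>M P)"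
  proof -
    have part: "(\<lambda>v. \<lambda>j\<in>{..<l}. fst v (o' + j)) \<in> ?Q \<Otimes>\<^sub>M P \<rightarrow>\<^sub>M iid l D" if "o' + l \<le> n + (n + T)" for o' l
      using that by (intro measurable_restrict measurable_compose[OF measurable_fst measurable_component_singleton]) auto
    have dm: "(\<lambda>v. d (\<lambda>j\<in>{..<n}. fst v (o' + j)) (snd v)) \<in> borel_measurable (?Q \<Otimes>\<^sub>M P)" if "o' + n \<le> n + (n + T)" for o'
      using measurable_compose[OF measurable_Pair[OF part[OF that] measurable_snd] d(1)] by simp
    have "(\<lambda>v. error_rate T (\<lambda>j\<in>{..<T}. fst v (n + (n + j))) (snd v)) \<in> borel_measurable (?Q \<Otimes>\<^sub>M P)"
    proof (rule error_rate_measurable[OF H])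
      show "snd \<in> ?Q \<Otimes>\<^sub>M P \<rightarrow>\<^sub>M H" using measurable_snd by (simp add: measurable_cong_sets[OF refl P(2)[symmetric]])
      show "(\<lambda>v. (\<lambda>j\<in>{..<T}. fst v (n + (n + j))) j) \<in> ?Q \<Otimes>\<^sub>M P \<rightarrow>\<^sub>M examples X" if "j < T" for j
        using that measurable_compose[OF measurable_fst measurable_component_singleton, of "n + (n + j)" "{..<n + (n + T)}" "\<lambda>_. D" P]
        by (simp add: measurable_cong_sets[OF refl D(2)[symmetric]])
    qed
    then show ?thesis
      unfolding F_def split_beta using dm[of 0] dm[of n] by simp
  qed
  have wm[measurable]: "w \<in> borel_measurable P" unfolding w_def by measurable
  define c where "c h = (\<integral>\<^sup>+S. ennreal (d S h) \<partial>?N)" for h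
  define g where "g h = (\<integral>\<^sup>+z. ennreal (min (d (fst z) h) (d (snd z) h)) \<partial>(?N \<Otimes>\<^sub>M ?N))" for h
  define V where "V h = {z \<in> space (iid T D). error_rate T z h \<le> \<alpha> + \<epsilon> / 2}" for h
  define a where "a h = measure (iid T D) (V h)" for h
  have cm[measurable]: "c \<in> borel_measurable P" unfolding c_def by measurable
  have gm[measurable]: "g \<in> borel_measurable P" unfolding g_def by measurable
  have c1: "(\<integral>\<^sup>+h. c h \<partial>P) \<le> ennreal (1 + \<eta>)"
    unfolding c_def by (rule density_total_mass[OF N.prob_space_axioms P A d approx nonneg(1)])
  have gc: "g h \<le> c h" if "h \<in> space P" for h
    unfolding c_def g_def by (rule overlap_le_mean[OF N.prob_space_axioms dh[OF that]])
  have V: "V h \<in> sets (iid T D)" if "h \<in> space P" for h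
    unfolding V_def using that T \<epsilon> spP by (intro test_set_measurable[OF H D]) auto
  \<comment> \<open>As \<open>space D = UNIV\<close>, restricted functions always lie in the sample
    space, and membership in \<open>V h\<close> amounts to the inequality.\<close>
  have F_eq: "F \<omega> h = min (d (\<lambda>j\<in>{..<n}. \<omega> j) h) (d (\<lambda>j\<in>{..<n}. \<omega> (n + j)) h) *
      indicator (V h) (\<lambda>j\<in>{..<T}. \<omega> (n + (n + j)))" for \<omega> h
    by (simp add: F_def V_def indicator_def space_PiM D_UNIV)
  have F0: "0 \<le> F \<omega> h" for \<omega> h using d(2) by (simp add: F_def)
  have w0: "0 \<le> w h" for h unfolding w_def using F0 by (intro integral_nonneg_AE) auto
  have F1: "(\<integral>\<^sup>+\<omega>. ennreal (F \<omega> h) \<partial>?Q) = g h * ennreal (a h)" if h: "h \<in> space P" for h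
    unfolding F_eq g_def a_def I.emeasure_eq_measure[symmetric]
    by (rule block_mean[OF D(1) dh[OF h] d(2) V[OF h]])
  have F2: "(\<integral>\<^sup>+\<omega>. ennreal ((F \<omega> h)\<^sup>2) \<partial>?Q) \<le> (c h)\<^sup>2" if h: "h \<in> space P" for h
    unfolding F_eq c_def by (rule block_second_moment[OF D(1) dh[OF h] d(2) V[OF h]])
  show "(\<integral>\<^sup>+\<omega>. \<integral>\<^sup>+h. ennreal \<bar>(\<Sum>i<K. F (\<omega> i) h) / K - w h\<bar> \<partial>P \<partial>iid K ?Q) \<le> ennreal ((1 + \<eta>) / sqrt K)" if "0 < K"
    unfolding w_def by (rule average_L1_convergence[OF Q.prob_space_axioms P(1) Fm cm c1 F2 that])
  \<comment> \<open>The Bochner integral \<open>w h\<close> agrees with the nonnegative integral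
    where \<open>F\<close> is integrable in \<open>\<omega>\<close>; finiteness of
    \<open>c h\<close> ensures this through the second moment.\<close>
  have w_eq: "AE h in P. ennreal (w h) = g h * ennreal (a h)"
  proof -
    have "AE h in P. c h \<noteq> \<infinity>"
      by (rule nn_integral_PInf_AE) (use c1 in \<open>auto simp: top_unique\<close>)
    then show ?thesis
      using AE_space
    proof eventually_elim
      case (elim h)
      have [measurable]: "(\<lambda>\<omega>. F \<omega> h) \<in> borel_measurable ?Q" using elim(2) by measurable
      have "(c h)\<^sup>2 < \<infinity>" using elim(1) by (simp add: power2_eq_square ennreal_mult_less_top less_top)
      then have "integrable ?Q (\<lambda>\<omega>. (F \<omega> h)\<^sup>2)"
        using F2[OF elim(2)] by (intro integrableI_nonneg) (auto intro: le_less_trans)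
      then have "integrable ?Q (\<lambda>\<omega>. F \<omega> h)" by (rule Q.square_integrable_imp_integrable[rotated]) measurable
      then have "ennreal (w h) = (\<integral>\<^sup>+\<omega>. ennreal (F \<omega> h) \<partial>?Q)"
        unfolding w_def using F0 by (intro nn_integral_eq_integral[symmetric]) auto
      then show ?case using F1[OF elim(2)] by simp
    qed
  qed
  have g1: "(\<integral>\<^sup>+h. g h \<partial>P) \<le> ennreal (1 + \<eta>)"
    using gc by (intro order_trans[OF nn_integral_mono c1])
  have wi_le: "(\<integral>\<^sup>+h. ennreal (w h) \<partial>P) \<le> ennreal (1 + \<eta>)"
  proof (rule order_trans[OF nn_integral_mono_AE g1])
    show "AE h in P. ennreal (w h) \<le> g h"
      using w_eq
    proof eventually_elim
      case (elim h)
      have "g h * ennreal (a h) \<le> g h * 1" unfolding a_def by (intro mult_left_mono) auto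
      then show ?case using elim by simp
    qed
  qed
  show wi: "integrable P w"
    by (rule integrableI_nonneg) (use wi_le w0 in \<open>auto intro: le_less_trans\<close>)
  show "?\<delta> / 2 \<le> (\<integral>h. w h \<partial>P)"
  proof -
    let ?bad = "{h \<in> space H. \<alpha> < err D h}"
    have bad: "?bad \<in> sets H" using err_measurable[OF H D] by measurable
    have badP[measurable]: "?bad \<in> sets P" using bad P(2) by simp
    have "ennreal ?\<delta> \<le> (\<integral>\<^sup>+h. indicator (space P - ?bad) h * g h \<partial>P)"
      unfolding g_def
      using tv acc bad nonneg
      by (intro overlap_mass[OF N.prob_space_axioms P A d approx nonneg(1)])
         (auto simp: tv_indistinguishable_def accurate_def)
    then have "ennreal ?\<delta> * ennreal (1/2) \<le> (\<integral>\<^sup>+h. indicator (space P - ?bad) h * g h \<partial>P) * ennreal (1/2)"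
      by (intro mult_right_mono) auto
    also have "\<dots> = (\<integral>\<^sup>+h. indicator (space P - ?bad) h * g h * ennreal (1/2) \<partial>P)"
      by (rule nn_integral_multc[symmetric]) measurable
    also have "\<dots> \<le> (\<integral>\<^sup>+h. ennreal (w h) \<partial>P)"
    proof (rule nn_integral_mono_AE)
      show "AE h in P. indicator (space P - ?bad) h * g h * ennreal (1/2) \<le> ennreal (w h)"
        using w_eq AE_space
      proof eventually_elim
        case (elim h)
        show ?case
        proof (cases "h \<in> ?bad")
          case False
          then have "1 - ?\<tau> \<le> a h"
            unfolding a_def V_def using elim spP T \<epsilon> by (intro test_accepts[OF H D]) auto
          then have "ennreal (1/2) \<le> ennreal (a h)" using \<epsilon>(2) by (intro ennreal_leI) linarith
          then show ?thesis using elim False by (auto intro!: mult_left_mono)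
        qed simp
      qed
    qed
    also have "\<dots> = ennreal (\<integral>h. w h \<partial>P)" using w0 by (intro nn_integral_eq_integral wi) auto
    finally have "ennreal (?\<delta> / 2) \<le> ennreal (\<integral>h. w h \<partial>P)"
      using \<delta> by (simp add: ennreal_mult[symmetric] del: ennreal_half)
    then show ?thesis using w0 by (subst (asm) ennreal_le_iff) (auto intro: integral_nonneg_AE)
  qed
  show "(\<integral>h. indicator {h \<in> space H. \<alpha> + \<epsilon> < err D h} h * w h \<partial>P) \<le> ?\<tau> * (1 + \<eta>)"
  proof -
    let ?bad = "{h \<in> space H. \<alpha> + \<epsilon> < err D h}"
    have badP[measurable]: "?bad \<in> sets P"
      unfolding spP[symmetric] by measurable
    have \<tau>: "0 \<le> ?\<tau>" using \<epsilon> by simp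
    have i: "integrable P (\<lambda>h. indicator ?bad h * w h)"
      using integrable_mult_indicator[OF badP wi] by simp
    have "ennreal (\<integral>h. indicator ?bad h * w h \<partial>P) = (\<integral>\<^sup>+h. ennreal (indicator ?bad h * w h) \<partial>P)"
      using w0 by (intro nn_integral_eq_integral[symmetric] i) auto
    also have "\<dots> \<le> (\<integral>\<^sup>+h. g h * ennreal ?\<tau> \<partial>P)"
    proof (rule nn_integral_mono_AE)
      show "AE h in P. ennreal (indicator ?bad h * w h) \<le> g h * ennreal ?\<tau>"
        using w_eq AE_space
      proof eventually_elim
        case (elim h)
        show ?case
        proof (cases "h \<in> ?bad")
          case True
          then have "a h \<le> ?\<tau>"
            unfolding a_def V_def using T \<epsilon> by (intro test_rejects[OF H D]) auto
          then show ?thesis using elim True by (auto intro!: mult_left_mono ennreal_leI)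
        qed simp
      qed
    qed
    also have "\<dots> = (\<integral>\<^sup>+h. g h \<partial>P) * ennreal ?\<tau>" by (rule nn_integral_multc) measurable
    also have "\<dots> \<le> ennreal (1 + \<eta>) * ennreal ?\<tau>" by (intro mult_right_mono g1) auto
    also have "\<dots> = ennreal (?\<tau> * (1 + \<eta>))" using \<tau> nonneg by (subst ennreal_mult[symmetric]) (auto simp: mult.commute)
    finally show ?thesis using \<tau> nonneg by (subst (asm) ennreal_le_iff) auto
  qed
qed

section \<open>The amplified learner\<close>

text \<open>With \<open>x = 2 * \<rho> / (\<rho> + 1)\<close> the condition on \<beta> is
  \<open>\<beta> < (1 - sqrt x)\<^sup>2\<close>. Since
  \<open>\<rho> \<le> x \<le> sqrt x \<le> 1\<close>, the square is at most
  \<open>1 - sqrt x\<close>, which is at most \<open>1 - \<rho>\<close>.\<close>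

lemma weak_accuracy_gap:
  fixes \<rho> \<beta> :: real
  assumes "\<rho> \<in> {0<..<1}" and "\<beta> < 2 * \<rho> / (\<rho> + 1) - 2 * sqrt (2 * \<rho> / (\<rho> + 1)) + 1"
  shows "0 < 1 - \<rho> - \<beta>"
proof -
  define x where "x = 2 * \<rho> / (\<rho> + 1)"
  have x: "0 \<le> x" "x \<le> 1" using assms(1) by (auto simp: x_def)
  have "\<rho> * (\<rho> + 1) \<le> 2 * \<rho>" using assms(1) by (auto simp: algebra_simps mult_left_le)
  then have "\<rho> \<le> x" using assms(1) by (simp add: x_def pos_le_divide_eq)
  moreover have "x \<le> sqrt x" using x by (intro real_le_rsqrt) (auto simp: power2_eq_square mult_left_le)
  ultimately show ?thesis using assms(2) unfolding x_def[symmetric] by linarith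
qed

text \<open>Block \<open>i\<close> contributes through answers \<open>2 * i\<close> and
  \<open>2 * i + 1\<close> and through its last \<open>T\<close> examples. The argument
  \<open>u\<close> pairs answers with sample, all that the black-box model reveals; no normalization
  is done yet.\<close>

definition overlap_weight ::
  "(('x \<Rightarrow> bool) measure \<Rightarrow> ('x \<Rightarrow> bool) \<Rightarrow> real) \<Rightarrow> nat \<Rightarrow> nat \<Rightarrow> nat \<Rightarrow> real \<Rightarrow>
    (nat \<Rightarrow> ('x \<Rightarrow> bool) measure) \<times> (nat \<Rightarrow> 'x \<times> bool) \<Rightarrow> ('x \<Rightarrow> bool) \<Rightarrow> real" where
  "overlap_weight d n T K \<theta> u h =
    (\<Sum>i<K. min (d (fst u (2 * i)) h) (d (fst u (2 * i + 1)) h) *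
      (if error_rate T (\<lambda>j\<in>{..<T}. snd u (i * (n + (n + T)) + (n + (n + j)))) h \<le> \<theta> then 1 else 0)) / real K"

lemma overlap_weight_measurable:
  assumes H: "hypothesis_space X H" and P: "sets P = sets H"
    and d: "case_prod d \<in> borel_measurable (prob_algebra H \<Otimes>\<^sub>M H)"
  shows "case_prod (overlap_weight d n T K \<theta>) \<in>
    borel_measurable ((iid (2 * K) (prob_algebra H) \<Otimes>\<^sub>M iid (K * (n + (n + T))) (examples X)) \<Otimes>\<^sub>M P)"
proof -
  let ?M = "(iid (2 * K) (prob_algebra H) \<Otimes>\<^sub>M iid (K * (n + (n + T))) (examples X)) \<Otimes>\<^sub>M P"
  have h: "snd \<in> ?M \<rightarrow>\<^sub>M H" using measurable_snd by (simp add: measurable_cong_sets[OF refl P[symmetric]])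
  have dm: "(\<lambda>v. d (fst (fst v) i) (snd v)) \<in> borel_measurable ?M" if "i < 2 * K" for i
  proof -
    have "(\<lambda>v. (fst (fst v) i, snd v)) \<in> ?M \<rightarrow>\<^sub>M prob_algebra H \<Otimes>\<^sub>M H"
      using that h by (intro measurable_Pair measurable_compose[OF measurable_compose[OF measurable_fst measurable_fst] measurable_component_singleton]) auto
    from measurable_compose[OF this d] show ?thesis by simp
  qed
  have em: "(\<lambda>v. error_rate T (\<lambda>j\<in>{..<T}. snd (fst v) (i * (n + (n + T)) + (n + (n + j)))) (snd v)) \<in> borel_measurable ?M"
    if "i < K" for i
  proof (rule error_rate_measurable[OF H h])
    fix j assume j: "j < T"
    have "i * (n + (n + T)) + (n + (n + j)) < K * (n + (n + T))"
      using mult_le_mono1[of "Suc i" K "n + (n + T)"] that j by simp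
    then show "(\<lambda>v. (\<lambda>j\<in>{..<T}. snd (fst v) (i * (n + (n + T)) + (n + (n + j)))) j) \<in> ?M \<rightarrow>\<^sub>M examples X"
      using j measurable_compose[OF measurable_compose[OF measurable_fst measurable_snd] measurable_component_singleton]
      by simp
  qed
  show ?thesis
    unfolding overlap_weight_def split_beta
    using dm em by (intro borel_measurable_divide borel_measurable_sum borel_measurable_times borel_measurable_min
      measurable_If) auto
qed

text \<open>Query \<open>i\<close> reads block \<open>i div 2\<close>, and within it the first or
  second group of \<open>n\<close> examples according to the parity of \<open>i\<close>. These
  indices have to stay inside the sample.\<close>

lemma sample_index_less:
  fixes i j K n T :: nat
  assumes "i < 2 * K" "j < n"
  shows "i div 2 * (n + (n + T)) + (i mod 2 * n + j) < K * (n + (n + T))"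
proof -
  have "i mod 2 * n + j < n + (n + T)"
  proof -
    have "i mod 2 \<le> 1" by simp
    from mult_le_mono1[OF this, of n] show ?thesis using assms by linarith
  qed
  moreover have "Suc (i div 2) * (n + (n + T)) \<le> K * (n + (n + T))"
    using assms by (intro mult_le_mono1) auto
  ultimately show ?thesis by simp
qed

theorem theorem6:
  fixes X :: "'x measure" and H P :: "('x \<Rightarrow> bool) measure"
    and R :: "(nat \<Rightarrow> ('x \<Rightarrow> bool) \<times> real \<times> real) measure"
    and n :: nat and \<rho> \<alpha> \<beta> \<rho>' \<epsilon> \<beta>' :: real
  assumes "hypothesis_space X H"
    and "prob_space P" and "sets P = sets H"
    and "poisson_point_process (P \<Otimes>\<^sub>M leb_nonneg \<Otimes>\<^sub>M leb_nonneg) R"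
    and "\<rho> \<in> {0<..<1}" and "\<alpha> \<in> {0<..<1}" and "\<beta> \<in> {0<..<1}"
    and "\<beta> < 2 * \<rho> / (\<rho> + 1) - 2 * sqrt (2 * \<rho> / (\<rho> + 1)) + 1"
    and "\<rho>' \<in> {0<..<1}" and "\<epsilon> \<in> {0<..<1}" and "\<beta>' \<in> {0<..<1}"
  shows "\<exists>m N q k G. blackbox_procedure X H R n m N q k G \<and>
    (\<forall>A D. learning_rule X H n A \<and>
           prob_space D \<and> sets D = sets (examples X) \<and>
           tv_indistinguishable D n A \<rho> \<and>
           accurate H D n A \<alpha> \<beta> \<and>
           abs_cont_on_inputs P D n A
       \<longrightarrow> learning_rule X H m (run_procedure H R n N q k G A) \<and>
           tv_indistinguishable D m (run_procedure H R n N q k G A) \<rho>' \<and>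
           accurate H D m (run_procedure H R n N q k G A) (\<alpha> + \<epsilon>) \<beta>')"
proof -
  note H = assms(1) and P = assms(2,3) and R = assms(4)
  interpret P: prob_space P by (rule P(1))
  interpret R: prob_space R using R by (simp add: poisson_point_process_def)
  have spP: "space P = space H" by (rule sets_eq_imp_space_eq[OF P(2)])
  have sR: "sets R = sets (PiM UNIV (\<lambda>_. P \<Otimes>\<^sub>M leb_nonneg \<Otimes>\<^sub>M leb_nonneg))"
    using R by (simp add: poisson_point_process_def)
  define \<delta> where "\<delta> = 1 - \<rho> - \<beta>"
  have \<delta>: "0 < \<delta>" unfolding \<delta>_def by (rule weak_accuracy_gap[OF assms(5,8)])
  have pos: "0 < \<rho>" "0 < \<beta>" "0 < \<epsilon>" "0 < \<rho>'" "0 < \<beta>'" using assms by auto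
  \<comment> \<open>The loss \<open>3 * \<eta>\<close> takes half of \<delta>, and the acceptance
    probability 1/2 takes half of the rest, which leaves the limit weight a mass of at least
    \<open>\<delta> / 4\<close>.\<close>
  define \<eta> where "\<eta> = \<delta> / 6"
  have \<eta>: "0 < \<eta>" "1 + \<eta> \<le> 2" using \<delta> pos by (auto simp: \<eta>_def \<delta>_def)
  define \<theta> where "\<theta> = min \<rho>' \<beta>'"
  have \<theta>: "0 < \<theta>" "\<theta> \<le> \<rho>'" "\<theta> \<le> \<beta>'" using pos by (auto simp: \<theta>_def)
  obtain d where d: "case_prod d \<in> borel_measurable (prob_algebra H \<Otimes>\<^sub>M H)"
    "\<And>\<mu> h. 0 \<le> d \<mu> h" "\<And>\<mu>. \<exists>c. \<forall>h. d \<mu> h \<le> c"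
    "\<And>\<mu> B. \<mu> \<in> space (prob_algebra H) \<Longrightarrow> absolutely_continuous P \<mu> \<Longrightarrow> B \<in> sets H \<Longrightarrow>
      \<bar>measure \<mu> B - (\<integral>h. indicator B h * d \<mu> h \<partial>P)\<bar> \<le> \<eta>"
    by (rule density_selection[OF _ P \<eta>(1)]) (use H in \<open>auto simp: hypothesis_space_def\<close>)
  \<comment> \<open>The bound 1/2 is for accepting accurate hypotheses. The other makes the
    inaccurate mass at most \<open>\<delta> * \<beta>' / 16\<close>, as
    \<open>1 + \<eta> \<le> 2\<close>, hence at most \<open>\<beta>' / 4\<close> after division by a
    total of at least \<open>\<delta> / 4\<close>.\<close>
  obtain T :: nat where T: "0 < T" "4 / (T * \<epsilon>\<^sup>2) \<le> 1 / 2" "4 / (T * \<epsilon>\<^sup>2) \<le> \<delta> * \<beta>' / 32"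
  proof -
    define x where "x = min (1 / 2) (\<delta> * \<beta>' / 32)"
    have x: "0 < x" using \<delta> pos by (simp add: x_def)
    obtain T :: nat where T: "4 / (x * \<epsilon>\<^sup>2) < T" using reals_Archimedean2 by blast
    have "0 < 4 / (x * \<epsilon>\<^sup>2)" using x pos by simp
    then have "0 < real T" using T by linarith
    then have T0: "0 < T" by simp
    have "4 / (T * \<epsilon>\<^sup>2) \<le> x" using T T0 x pos by (simp add: field_simps)
    then show thesis using that[OF T0] by (simp add: x_def)
  qed
  \<comment> \<open>Normalization multiplies the L1 error by at most
    \<open>2 / (\<delta> / 4)\<close>, so this choice yields \<open>\<theta> / 4\<close>; the number
    \<open>k\<close> of draws is chosen so that sampling costs at most another
    \<open>\<theta> / 4\<close>.\<close>
  obtain K :: nat where K: "0 < K" "(1 + \<eta>) / sqrt K \<le> \<delta> * \<theta> / 32"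
  proof -
    obtain K :: nat where K: "(64 / (\<delta> * \<theta>))\<^sup>2 < K" using reals_Archimedean2 by blast
    have "0 < real K" using K zero_le_power2[of "64 / (\<delta> * \<theta>)"] by linarith
    then have K0: "0 < K" by simp
    have "64 / (\<delta> * \<theta>) \<le> sqrt K" using K by (intro real_le_rsqrt) simp
    then have "2 / sqrt K \<le> \<delta> * \<theta> / 32" using K0 \<delta> \<theta> by (simp add: field_simps)
    moreover have "(1 + \<eta>) / sqrt K \<le> 2 / sqrt K" using \<eta> by (intro divide_right_mono) auto
    ultimately show thesis using that[OF K0] by linarith
  qed
  obtain k where k: "(1 - exp (-1)) ^ k < \<theta> / 4"
    using real_arch_pow_inv[of "\<theta> / 4" "1 - exp (-1)"] \<theta> by auto
  define \<kappa> :: real where "\<kappa> = (1 - exp (-1)) ^ k"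
  have \<kappa>: "0 \<le> \<kappa>" "\<kappa> \<le> \<theta> / 4" using k by (auto simp: \<kappa>_def)
  define b where "b = n + (n + T)"
  define m where "m = K * b"
  define q where "q i j = i div 2 * b + (i mod 2 * n + j)" for i j :: nat
  obtain h0 where h0: "h0 \<in> space P" using P.not_empty by blast
  define W where "W = overlap_weight d n T K (\<alpha> + \<epsilon> / 2)"
  define f where "f u h = W u h / (\<integral>h. W u h \<partial>P)" for u h
  \<comment> \<open>If \<open>W u\<close> has integral \<open>0\<close>, then \<open>f u = 0\<close> since \<open>x / 0 = 0\<close>, and the sampler returns an irrelevant point.\<close>
  define G where "G = (\<lambda>(\<mu>s, S, r). poisson_sample (space P) h0 k (f (\<mu>s, S)) r)"
  let ?L = "iid (2 * K) (prob_algebra H) \<Otimes>\<^sub>M iid m (examples X)"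
  have W[measurable]: "case_prod W \<in> borel_measurable (?L \<Otimes>\<^sub>M P)"
    unfolding W_def m_def b_def by (rule overlap_weight_measurable[OF H P(2) d(1)])
  have W0: "0 \<le> W u h" for u h
    unfolding W_def overlap_weight_def using d(2) by (intro divide_nonneg_nonneg sum_nonneg) auto
  \<comment> \<open>Boundedness makes \<open>W u\<close> integrable on every input, including
    answers that have no density with respect to \<open>P\<close>.\<close>
  have Wb: "\<exists>c. \<forall>h. W u h \<le> c" for u
  proof -
    have "\<forall>i. \<exists>c. \<forall>h. d (fst u (2 * i)) h \<le> c" using d(3) by blast
    from choice[OF this] obtain c where c: "\<And>i h. d (fst u (2 * i)) h \<le> c i" by blast
    have c0: "0 \<le> c i" for i by (rule order_trans[OF d(2) c])
    have "W u h \<le> (\<Sum>i<K. c i) / K" for h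
      unfolding W_def overlap_weight_def using c c0 d(2) by (intro divide_right_mono sum_mono) (auto simp: min.coboundedI1 intro: order_trans)
    then show ?thesis by blast
  qed
  have Wi: "integrable P (W u)" if "u \<in> space ?L" for u
  proof -
    obtain c where "\<And>h. W u h \<le> c" using Wb by blast
    moreover have "W u \<in> borel_measurable P" using measurable_Pair2[OF W that] by simp
    ultimately show ?thesis using W0 by (intro P.integrable_const_bound[of _ c]) auto
  qed
  have fm: "case_prod f \<in> borel_measurable (?L \<Otimes>\<^sub>M P)" unfolding f_def split_beta by measurable
  have Gm: "G \<in> iid (2 * K) (prob_algebra H) \<Otimes>\<^sub>M iid m (examples X) \<Otimes>\<^sub>M iid k R \<rightarrow>\<^sub>M H"
  proof -
    have "(\<lambda>v. ((fst v, fst (snd v)), snd (snd v))) \<in>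
        iid (2 * K) (prob_algebra H) \<Otimes>\<^sub>M iid m (examples X) \<Otimes>\<^sub>M iid k R \<rightarrow>\<^sub>M ?L \<Otimes>\<^sub>M iid k R" by measurable
    from measurable_compose[OF this poisson_sample_measurable[OF fm h0 sR, of k]]
    show ?thesis by (simp add: G_def split_beta measurable_cong_sets[OF refl P(2)])
  qed
  have bb: "blackbox_procedure X H R n m (2 * K) q k G"
    unfolding blackbox_procedure_def q_def m_def b_def
    using Gm sample_index_less[of _ K _ n T] by (simp add: m_def b_def)
  have main: "learning_rule X H m (run_procedure H R n (2 * K) q k G A) \<and>
      tv_indistinguishable D m (run_procedure H R n (2 * K) q k G A) \<rho>' \<and>
      accurate H D m (run_procedure H R n (2 * K) q k G A) (\<alpha> + \<epsilon>) \<beta>'"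
    if A: "learning_rule X H n A" and D: "prob_space D" "sets D = sets (examples X)"
      and tv: "tv_indistinguishable D n A \<rho>" and acc: "accurate H D n A \<alpha> \<beta>" and ac: "abs_cont_on_inputs P D n A"
    for A D
  proof -
    let ?O = "run_procedure H R n (2 * K) q k G A"
    have seq: "sets (iid l D) = sets (iid l (examples X))" for l by (intro sets_PiM_cong refl D(2))
    have Am: "A \<in> iid n (examples X) \<rightarrow>\<^sub>M prob_algebra H" using A by (simp add: learning_rule_def)
    have AmD: "A \<in> iid n D \<rightarrow>\<^sub>M prob_algebra H" using Am by (simp add: measurable_cong_sets[OF seq refl])
    define \<mu>s where "\<mu>s S = (\<lambda>i\<in>{..<2 * K}. A (\<lambda>j\<in>{..<n}. S (q i j)))" for S
    have \<mu>m[measurable]: "\<mu>s \<in> iid m (examples X) \<rightarrow>\<^sub>M iid (2 * K) (prob_algebra H)"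
      unfolding \<mu>s_def
    proof (intro measurable_restrict measurable_compose[OF _ Am] measurable_component_singleton)
      fix i j assume "i \<in> {..<2 * K}" "j \<in> {..<n}"
      then show "q i j \<in> {..<m}" using sample_index_less[of i K j n T] by (simp add: q_def m_def b_def)
    qed
    have O_eq: "?O S = distr (iid k R) H (\<lambda>r. G (\<mu>s S, S, r))" for S
      by (simp add: run_procedure_def \<mu>s_def)
    have GS: "(\<lambda>(S, r). G (\<mu>s S, S, r)) \<in> iid m (examples X) \<Otimes>\<^sub>M iid k R \<rightarrow>\<^sub>M H"
    proof -
      have "(\<lambda>v. (\<mu>s (fst v), fst v, snd v)) \<in> iid m (examples X) \<Otimes>\<^sub>M iid k R \<rightarrow>\<^sub>M
          iid (2 * K) (prob_algebra H) \<Otimes>\<^sub>M iid m (examples X) \<Otimes>\<^sub>M iid k R" by measurable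
      from measurable_compose[OF this Gm] show ?thesis unfolding split_beta .
    qed
    have GS': "(\<lambda>r. G (\<mu>s S, S, r)) \<in> iid k R \<rightarrow>\<^sub>M H" if "S \<in> space (iid m (examples X))" for S
      using measurable_Pair2[OF GS that] by simp
    interpret Q: prob_space "iid k R" by (rule prob_space_iid[OF R.prob_space_axioms])
    have Om: "?O \<in> iid m (examples X) \<rightarrow>\<^sub>M prob_algebra H"
      unfolding O_eq[abs_def]
    proof (rule measurable_prob_algebraI)
      show "prob_space (distr (iid k R) H (\<lambda>r. G (\<mu>s S, S, r)))" if "S \<in> space (iid m (examples X))" for S
        by (rule Q.prob_space_distr[OF GS'[OF that]])
      show "(\<lambda>S. distr (iid k R) H (\<lambda>r. G (\<mu>s S, S, r))) \<in> iid m (examples X) \<rightarrow>\<^sub>M subprob_algebra H"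
        by (rule measurable_distr2[OF GS]) (simp add: space_subprob_algebra Q.subprob_space_axioms)
    qed
    have OmD: "?O \<in> iid m D \<rightarrow>\<^sub>M prob_algebra H" using Om by (simp add: measurable_cong_sets[OF seq refl])
    have spm: "space (iid m D) = space (iid m (examples X))" by (rule sets_eq_imp_space_eq[OF seq])
    define dA where "dA = (\<lambda>S. d (A S))"
    have dA: "case_prod dA \<in> borel_measurable (iid n D \<Otimes>\<^sub>M P)"
    proof -
      have "(\<lambda>v. (A (fst v), snd v)) \<in> iid n D \<Otimes>\<^sub>M P \<rightarrow>\<^sub>M prob_algebra H \<Otimes>\<^sub>M H"
        using measurable_snd[of "iid n D" P]
        by (intro measurable_Pair measurable_compose[OF measurable_fst AmD]) (simp_all add: measurable_cong_sets[OF refl P(2)[symmetric]])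
      from measurable_compose[OF this d(1)] show ?thesis by (simp add: dA_def split_beta)
    qed
    have dA0: "0 \<le> dA S h" for S h by (simp add: dA_def d(2))
    have dAi: "integrable P (dA S)" if "S \<in> space (iid n D)" for S
    proof -
      obtain c where "\<And>h. dA S h \<le> c" using d(3) unfolding dA_def by blast
      moreover have "dA S \<in> borel_measurable P" using measurable_Pair2[OF dA that] by simp
      ultimately show ?thesis using dA0 by (intro P.integrable_const_bound[of _ c]) auto
    qed
    have approx: "AE S in iid n D. \<forall>B\<in>sets H. \<bar>measure (A S) B - (\<integral>h. indicator B h * dA S h \<partial>P)\<bar> \<le> \<eta>"
      using ac[unfolded abs_cont_on_inputs_def] AE_space
    proof eventually_elim
      case (elim S)
      then show ?case using d(4)[OF measurable_space[OF AmD elim(2)] elim(1)] by (auto simp: dA_def)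
    qed
    define F where "F = (\<lambda>\<omega> h. min (dA (\<lambda>j\<in>{..<n}. \<omega> j) h) (dA (\<lambda>j\<in>{..<n}. \<omega> (n + j)) h) *
      (if error_rate T (\<lambda>j\<in>{..<T}. \<omega> (n + (n + j))) h \<le> \<alpha> + \<epsilon> / 2 then 1 else 0))"
    define w where "w = (\<lambda>h. \<integral>\<omega>. F \<omega> h \<partial>iid b D)"
    have gap: "1 - \<rho> - \<beta> - 3 * \<eta> = \<delta> / 2"
      using \<eta>_def \<delta>_def by linarith
    have gap0: "0 < 1 - \<rho> - \<beta> - 3 * \<eta>" unfolding gap using \<delta> by simp
    note prems = H D P AmD dA dA0 dAi approx less_imp_le[OF \<eta>(1)] less_imp_le[OF pos(1)] less_imp_le[OF pos(2)]
      T(1) pos(3) T(2) tv acc gap0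
    have Fm: "case_prod F \<in> borel_measurable (iid b D \<Otimes>\<^sub>M P)"
      unfolding F_def b_def by (rule block_weight_measurable[OF prems])
    have wi: "integrable P w"
      unfolding w_def F_def b_def by (rule limit_integrable[OF prems])
    have mass: "(1 - \<rho> - \<beta> - 3 * \<eta>) / 2 \<le> (\<integral>h. w h \<partial>P)"
      unfolding w_def F_def b_def by (rule limit_mass[OF prems])
    have bad_mass: "(\<integral>h. indicator {h \<in> space H. \<alpha> + \<epsilon> < err D h} h * w h \<partial>P) \<le> 4 / (T * \<epsilon>\<^sup>2) * (1 + \<eta>)"
      unfolding w_def F_def b_def by (rule limit_inaccurate_mass[OF prems])
    have L1_rate: "(\<integral>\<^sup>+\<omega>. \<integral>\<^sup>+h. ennreal \<bar>(\<Sum>i<K. F (\<omega> i) h) / K - w h\<bar> \<partial>P \<partial>iid K (iid b D)) \<le> ennreal ((1 + \<eta>) / sqrt K)"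
      unfolding w_def F_def b_def by (rule limit_rate[OF prems K(1)])
    define Z where "Z = (\<integral>h. w h \<partial>P)"
    have Z: "\<delta> / 4 \<le> Z" using mass unfolding gap Z_def by simp
    have Zp: "0 < Z" using Z \<delta> by linarith
    have w0: "0 \<le> w h" for h
      unfolding w_def F_def using dA0 by (intro integral_nonneg_AE) auto
    define u where "u S = (\<mu>s S, S)" for S
    have um: "u \<in> iid m (examples X) \<rightarrow>\<^sub>M ?L" unfolding u_def by measurable
    \<comment> \<open>Identifies what the procedure computes from its queries with an average of
      \<open>F\<close> over the independent blocks, to which \<open>L1_rate\<close> applies.\<close>
    have W_eq: "W (u S) h = (\<Sum>i<K. F ((\<lambda>i\<in>{..<K}. \<lambda>j\<in>{..<b}. S (i * b + j)) i) h) / K" for S h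
    proof -
      have "\<mu>s S (2 * i) = A (\<lambda>j\<in>{..<n}. S (i * b + j))" "\<mu>s S (2 * i + 1) = A (\<lambda>j\<in>{..<n}. S (i * b + (n + j)))" if "i < K" for i
        using that by (auto simp: \<mu>s_def q_def)
      moreover have "(\<lambda>j\<in>{..<n}. (\<lambda>j\<in>{..<b}. S (i * b + j)) j) = (\<lambda>j\<in>{..<n}. S (i * b + j))"
        "(\<lambda>j\<in>{..<n}. (\<lambda>j\<in>{..<b}. S (i * b + j)) (n + j)) = (\<lambda>j\<in>{..<n}. S (i * b + (n + j)))"
        "(\<lambda>j\<in>{..<T}. (\<lambda>j\<in>{..<b}. S (i * b + j)) (n + (n + j))) = (\<lambda>j\<in>{..<T}. S (i * b + (n + (n + j))))" for i
        by (auto simp: fun_eq_iff b_def)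
      moreover have "{..<b} \<inter> {..<n} = {..<n}" by (auto simp: b_def)
      ultimately show ?thesis
        unfolding W_def overlap_weight_def u_def fst_conv snd_conv F_def dA_def b_def[symmetric]
        by (intro arg_cong[where f="\<lambda>x. x / real K"] sum.cong refl) simp
    qed
    define e where "e S = (\<integral>h. \<bar>W (u S) h - w h\<bar> \<partial>P)" for S
    have e0: "0 \<le> e S" for S unfolding e_def by (intro integral_nonneg_AE) auto
    have wm[measurable]: "w \<in> borel_measurable P" using wi by auto
    have Wu[measurable]: "(\<lambda>(S, h). W (u S) h) \<in> borel_measurable (iid m D \<Otimes>\<^sub>M P)"
    proof -
      have "(\<lambda>v. (u (fst v), snd v)) \<in> iid m D \<Otimes>\<^sub>M P \<rightarrow>\<^sub>M ?L \<Otimes>\<^sub>M P"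
        using um by (intro measurable_Pair measurable_compose[OF measurable_fst]) (simp_all add: measurable_cong_sets[OF seq refl])
      from measurable_compose[OF this W] show ?thesis unfolding split_beta by simp
    qed
    have em[measurable]: "e \<in> borel_measurable (iid m D)" unfolding e_def by measurable
    have ui: "integrable P (W (u S))" if "S \<in> space (iid m D)" for S
      using that measurable_space[OF um] spm by (intro Wi) auto
    have rate: "(\<integral>\<^sup>+S. ennreal (e S) \<partial>iid m D) \<le> ennreal (\<delta> * \<theta> / 32)"
    proof -
      let ?s = "\<lambda>S. \<lambda>i\<in>{..<K}. \<lambda>j\<in>{..<b}. S (i * b + j)"
      let ?X = "\<lambda>\<omega>. \<integral>\<^sup>+h. ennreal \<bar>(\<Sum>i<K. F (\<omega> i) h) / K - w h\<bar> \<partial>P"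
      have sm: "?s \<in> iid m D \<rightarrow>\<^sub>M iid K (iid b D)"
      proof (intro measurable_restrict measurable_component_singleton)
        fix i j assume "i \<in> {..<K}" "j \<in> {..<b}"
        then show "i * b + j \<in> {..<m}" using mult_le_mono1[of "Suc i" K b] by (simp add: m_def)
      qed
      have Xm: "?X \<in> borel_measurable (iid K (iid b D))"
      proof -
        note [measurable] = average_measurable[OF Fm, of K]
        show ?thesis by measurable
      qed
      have "(\<integral>\<^sup>+S. ennreal (e S) \<partial>iid m D) = (\<integral>\<^sup>+S. ?X (?s S) \<partial>iid m D)"
      proof (rule nn_integral_cong)
        fix S assume S: "S \<in> space (iid m D)"
        have "ennreal (e S) = (\<integral>\<^sup>+h. ennreal \<bar>W (u S) h - w h\<bar> \<partial>P)"
          unfolding e_def using ui[OF S] wi by (intro nn_integral_eq_integral[symmetric]) auto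
        then show "ennreal (e S) = ?X (?s S)" by (simp only: W_eq)
      qed
      also have "\<dots> = (\<integral>\<^sup>+\<omega>. ?X \<omega> \<partial>distr (iid m D) (iid K (iid b D)) ?s)"
        by (rule nn_integral_distr[symmetric, OF sm]) (use Xm in simp)
      also have "distr (iid m D) (iid K (iid b D)) ?s = iid K (iid b D)"
        unfolding m_def by (rule distr_iid_blocks[OF D(1) K(1)])
      also have "(\<integral>\<^sup>+\<omega>. ?X \<omega> \<partial>iid K (iid b D)) \<le> ennreal ((1 + \<eta>) / sqrt K)" by (rule L1_rate)
      also have "\<dots> \<le> ennreal (\<delta> * \<theta> / 32)" by (rule ennreal_leI[OF K(2)])
      finally show ?thesis .
    qed
    \<comment> \<open>The target law: the normalized limit weight, which depends on \<open>A\<close>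
      and \<open>D\<close> but not on the sample.\<close>
    define \<nu> where "\<nu> B = (\<integral>h. indicator B h * w h \<partial>P) / Z" for B
    have \<nu>0: "0 \<le> \<nu> B" for B
      unfolding \<nu>_def using w0 Zp by (intro divide_nonneg_pos integral_nonneg_AE) auto
    define g where "g S = \<kappa> + 2 * e S / Z" for S
    have close: "\<bar>measure (?O S) B - \<nu> B\<bar> \<le> g S" if S: "S \<in> space (iid m D)" and B: "B \<in> sets H" for S B
    proof -
      have BP: "B \<in> sets P" using B P(2) by simp
      have S': "S \<in> space (iid m (examples X))" using S spm by simp
      interpret OS: prob_space "?O S" unfolding O_eq by (rule Q.prob_space_distr[OF GS'[OF S']])
      have OB: "measure (?O S) B = measure (iid k R) {r \<in> space (iid k R). poisson_sample (space P) h0 k (f (u S)) r \<in> B}"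
        unfolding O_eq using B GS'[OF S']
        by (subst measure_distr) (auto simp: G_def u_def intro!: arg_cong[where f="measure (iid k R)"])
      show ?thesis
        unfolding \<nu>_def g_def e_def Z_def
      proof (rule normalized_deviation[OF ui[OF S] W0 wi w0 Zp[unfolded Z_def] BP _ _ \<kappa>(1)])
        \<comment> \<open>Only with positive total weight is \<open>f (u S)\<close> a probability
          density, as the law of the sampler demands.\<close>
        assume C: "0 < (\<integral>h. W (u S) h \<partial>P)"
        have fi: "integrable P (f (u S))" unfolding f_def using ui[OF S] by simp
        have f0: "0 \<le> f (u S) h" for h unfolding f_def using C W0 by simp
        have f1: "(\<integral>\<^sup>+h. ennreal (f (u S) h) \<partial>P) = 1"
        proof -
          have "(\<integral>\<^sup>+h. ennreal (f (u S) h) \<partial>P) = ennreal (\<integral>h. f (u S) h \<partial>P)"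
            using f0 by (intro nn_integral_eq_integral fi) auto
          also have "(\<integral>h. f (u S) h \<partial>P) = 1" unfolding f_def using C by simp
          finally show ?thesis by simp
        qed
        have "(\<integral>h. indicator B h * f (u S) h \<partial>P) = (\<integral>h. indicator B h * W (u S) h \<partial>P) / (\<integral>h. W (u S) h \<partial>P)"
          unfolding f_def by simp
        then show "\<bar>measure (?O S) B - (\<integral>h. indicator B h * W (u S) h \<partial>P) / (\<integral>h. W (u S) h \<partial>P)\<bar> \<le> \<kappa>"
          unfolding OB \<kappa>_def using poisson_sample_law[OF P(1) _ f0 f1 h0 R BP, of k] fi by auto
      qed auto
    qed
    have gm: "g \<in> borel_measurable (iid m D)" unfolding g_def by measurable
    have g0: "0 \<le> g S" for S unfolding g_def using \<kappa> e0 Zp by simp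
    interpret M: prob_space "iid m D" by (rule prob_space_iid[OF D(1)])
    have g1: "(\<integral>\<^sup>+S. ennreal (g S) \<partial>iid m D) \<le> ennreal (\<theta> / 2)"
    proof -
      have "(\<integral>\<^sup>+S. ennreal (g S) \<partial>iid m D) = (\<integral>\<^sup>+S. ennreal \<kappa> + ennreal (2 / Z) * ennreal (e S) \<partial>iid m D)"
        unfolding g_def using \<kappa> e0 Zp
        by (intro nn_integral_cong) (simp add: ennreal_mult[symmetric] ennreal_plus[symmetric] del: ennreal_plus)
      also have "\<dots> = ennreal \<kappa> + ennreal (2 / Z) * (\<integral>\<^sup>+S. ennreal (e S) \<partial>iid m D)"
        by (simp add: nn_integral_add nn_integral_cmult M.emeasure_space_1)
      also have "\<dots> \<le> ennreal \<kappa> + ennreal (2 / Z) * ennreal (\<delta> * \<theta> / 32)"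
        by (intro add_left_mono mult_left_mono rate) auto
      also have "\<dots> = ennreal (\<kappa> + 2 / Z * (\<delta> * \<theta> / 32))"
        using \<kappa> Zp \<delta> \<theta> by (simp add: ennreal_mult[symmetric] ennreal_plus[symmetric] del: ennreal_plus)
      also have "\<dots> \<le> ennreal (\<theta> / 2)"
      proof (rule ennreal_leI)
        have "2 / Z * (\<delta> * \<theta> / 32) \<le> 2 / (\<delta> / 4) * (\<delta> * \<theta> / 32)"
          using Z \<delta> \<theta> by (intro mult_right_mono divide_left_mono) auto
        also have "\<dots> = \<theta> / 4" using \<delta> by simp
        finally show "\<kappa> + 2 / Z * (\<delta> * \<theta> / 32) \<le> \<theta> / 2" using \<kappa> by linarith
      qed
      finally show ?thesis .
    qed
    have \<theta>2: "0 \<le> \<theta> / 2" using \<theta> by simp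
    \<comment> \<open>Each output is within \<open>\<theta> / 2\<close> of \<nu> in the mean, so two
      differ by at most \<theta>, and \<open>\<theta> \<le> \<rho>'\<close>.\<close>
    have "tv_indistinguishable D m ?O \<rho>'"
      unfolding tv_indistinguishable_def
      by (rule order_trans[OF concentrated_tv[OF M.prob_space_axioms OmD gm g0 g1 \<theta>2 close]]) (use \<theta> in \<open>auto intro: ennreal_leI\<close>)
    moreover have "accurate H D m ?O (\<alpha> + \<epsilon>) \<beta>'"
    proof -
      let ?bad = "{h \<in> space H. \<alpha> + \<epsilon> < err D h}"
      have bad: "?bad \<in> sets H" using err_measurable[OF H D] by measurable
      \<comment> \<open>Half of \<beta>' pays for the inaccurate mass of \<nu>, the other half for
        the distance of the output from \<nu>, since \<open>\<theta> \<le> \<beta>'\<close>.\<close>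
      have "\<nu> ?bad \<le> \<beta>' / 2"
      proof -
        have "(\<integral>h. indicator ?bad h * w h \<partial>P) \<le> 4 / (T * \<epsilon>\<^sup>2) * (1 + \<eta>)" by (rule bad_mass)
        also have "\<dots> \<le> (\<delta> * \<beta>' / 32) * 2" using T(3) \<eta> \<delta> pos by (intro mult_mono) auto
        finally have "\<nu> ?bad \<le> (\<delta> * \<beta>' / 32) * 2 / Z" unfolding \<nu>_def using Zp by (intro divide_right_mono) auto
        also have "\<dots> \<le> (\<delta> * \<beta>' / 32) * 2 / (\<delta> / 4)" using Z \<delta> pos by (intro divide_left_mono) auto
        also have "\<dots> \<le> \<beta>' / 2" using \<delta> pos by simp
        finally show ?thesis .
      qed
      then show ?thesis
        using concentrated_measure_bind[OF M.prob_space_axioms OmD gm g0 g1 \<theta>2 close bad \<nu>0] \<theta>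
        unfolding accurate_def by linarith
    qed
    ultimately show ?thesis using Om by (simp add: learning_rule_def)
  qed
  show ?thesis using bb main by blast
qed

end
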